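(* Let $K$ be a unital commutative $\mathbb Q$-algebra. For any non-empty $W\subseteq\mathbb N^+$, the graded dual $\mathcal T_W^*:\mathcal H_{CK}^W\to\mathcal Q Sym$ of the homomorphism $\mathcal T_W:\mathcal N Sym\to\mathcal H_{GL}^W$ is a homomorphism of graded $K$-Hopf algebras.
   Context: **Trees.** All rooted trees are finite, considered up to isomorphism (preserving root and labels). $\mathbb T^W$ is the set of rooted trees with every vertex labeled by an element of $W$ (its weight); $\mathbb F^W$ is the set of finite disjoint unions of such trees (forests, including the empty one). $B_+(T_1,\dots,T_m)$ is the rooted tree obtained by joining the roots of $T_1,\dots,T_m$ to a new root labeled $0$; $B_+(\emptyset)=\circ$ is the single vertex labeled $0$. $\bar{\mathbb T}^W:=\{B_+(F): F\in\mathbb F^W\}$. $|\cdot|$ is the sum of the labels of all vertices (a root labeled $0$ counts $0$), $v(T)$ the number of vertices, $\alpha(T)$ the number of (root- and label-preserving) automorphisms, $\mathcal V_T:=T/\alpha(T)$. **Grossman-Larson Hopf algebra.** $\mathcal H_{GL}^W$ is the free $K$-module with basis $\bar{\mathbb T}^W$, graded by $|T|$. For $T=B_+(T_1,\dots,T_m)$ and $S$ in $\bar{\mathbb T}^W$, $T\cdot S$ is the sum of the $v(S)^m$ rooted trees obtained by joining the root of each $T_i$ by an edge to some vertex of $S$, in all possible ways; the unit is $\circ=1$. The coproduct is $\Delta(T)=\sum_{I\sqcup J=\{1,\dots,m\}}B_+(T_I)\otimes B_+(T_J)$, where $B_+(T_I)$ is $B_+$ applied to the $T_i$, $i\in I$;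 the counit sends $\circ$ to $1$ and all other trees to $0$. **Connes-Kreimer Hopf algebra.** $\mathcal H_{CK}^W$ is the free commutative $K$-algebra on the non-empty trees in $\mathbb T^W$ (so it has basis $\mathbb F^W$, product = disjoint union, unit = empty forest), graded by $|\cdot|$. An admissible cut $C$ of a tree $T$ is a set of edges (possibly empty) no two of which lie on a common path from the root to a leaf; deleting $C$, $R_C(T)$ is the component containing the root and $P_C(T)$ the forest of the other components. The coproduct is the algebra homomorphism with $\Delta(T)=T\otimes1+\sum_CP_C(T)\otimes R_C(T)$, sum over all admissible cuts $C$ of $T$; the counit kills all non-empty trees. It is the graded dual of $\mathcal H_{GL}^W$ through the pairing $\langle T,F\rangle=\alpha(T)$ if $T\simeq B_+(F)$ and $0$ otherwise ($T\in\bar{\mathbb T}^W$, $F\in\mathbb F^W$). **$\mathcal N Sym$ and $\mathcal Q Sym$.** $\mathcal N Sym$ is the free associative $K$-algebra on $\Lambda_1,\Lambda_2,\dots$ ($\Lambda_0=1$), graded by giving $\Lambda_m$ weight $m$, with Hopf algebra structure $\Delta(\Lambda_m)=\sum_{k=0}^m\Lambda_k\otimes\Lambda_{m-k}$. (Equivalently, the $\Psi_m$ defined by $\sigma'(t)=\sigma(t)\sum_{m\ge1}t^{m-1}\Psi_m$, where $\sigma(t)=\left(\sum_m(-t)^m\Lambda_m\right)^{-1}$, are primitive.) Its graded dual is the Hopf algebra $\mathcal Q Sym$ of quasi-symmetric functions over $K$. **The map $\mathcal T_W$.** $\mathcal T_W:\mathcal N Sym\to\mathcal H_{GL}^W$ is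 the $K$-algebra homomorphism determined by $\mathcal T_W(\Lambda_m)=\sum_T(-1)^{o(T)+|T|}\mathcal V_T$ for $m\ge1$, the sum over all $T\in\bar{\mathbb T}^W$ of height at most $1$ with $|T|=m$, where $o(T)$ is the number of children of the root; it preserves the gradings, and $\mathcal T_W^*$ is its graded dual (the transpose in each degree), where the graded dual of $\mathcal H_{GL}^W$ is identified with $\mathcal H_{CK}^W$ through the pairing $\langle T,F\rangle$ ($=\alpha(T)$ if $T\simeq B_+(F)$ and $0$ otherwise), and the graded dual of $\mathcal N Sym$ is identified with $\mathcal Q Sym$. *)

theory Defs
  imports Complex_Main "HOL-Library.Multiset" "HOL-Library.Poly_Mapping"
    "HOL-Library.Product_Plus" "HOL-Library.FuncSet" "HOL-Combinatorics.Permutations"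
begin

section \<open>Free modules and graded Hopf algebras on a basis\<close>

text \<open>
  The free \<open>K\<close>-module on a set \<open>B\<close> is the set of all \<open>x :: 'b \<Rightarrow>\<^sub>0 'k\<close> with
  \<open>keys x \<subseteq> B\<close>, and the tensor product of the free modules on \<open>A\<close> and \<open>B\<close> is the free module
  on \<open>A \<times> B\<close>.
\<close>

definition scal :: "'k::comm_ring_1 \<Rightarrow> ('b \<Rightarrow>\<^sub>0 'k) \<Rightarrow> ('b \<Rightarrow>\<^sub>0 'k)" where
  "scal c x = Poly_Mapping.map ((*) c) x"

definition lin_ext :: "('a \<Rightarrow> ('b \<Rightarrow>\<^sub>0 'k)) \<Rightarrow> ('a \<Rightarrow>\<^sub>0 'k::comm_ring_1) \<Rightarrow> ('b \<Rightarrow>\<^sub>0 'k)" where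
  "lin_ext g x = (\<Sum>a\<in>Poly_Mapping.keys x. scal (Poly_Mapping.lookup x a) (g a))"

definition bilin_ext ::
    "('a \<Rightarrow> 'b \<Rightarrow> ('c \<Rightarrow>\<^sub>0 'k)) \<Rightarrow> ('a \<Rightarrow>\<^sub>0 'k::comm_ring_1) \<Rightarrow> ('b \<Rightarrow>\<^sub>0 'k) \<Rightarrow> ('c \<Rightarrow>\<^sub>0 'k)" where
  "bilin_ext g x y = lin_ext (\<lambda>a. lin_ext (g a) y) x"

definition basis_elem :: "'b \<Rightarrow> ('b \<Rightarrow>\<^sub>0 'k::comm_ring_1)" where
  "basis_elem b = Poly_Mapping.single b 1"

definition tensor :: "('a \<Rightarrow>\<^sub>0 'k::comm_ring_1) \<Rightarrow> ('b \<Rightarrow>\<^sub>0 'k) \<Rightarrow> ('a \<times> 'b \<Rightarrow>\<^sub>0 'k)" where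
  "tensor = bilin_ext (\<lambda>a b. basis_elem (a, b))"

definition tensor_map ::
    "(('a \<Rightarrow>\<^sub>0 'k::comm_ring_1) \<Rightarrow> ('c \<Rightarrow>\<^sub>0 'k)) \<Rightarrow> (('b \<Rightarrow>\<^sub>0 'k) \<Rightarrow> ('d \<Rightarrow>\<^sub>0 'k))
      \<Rightarrow> ('a \<times> 'b \<Rightarrow>\<^sub>0 'k) \<Rightarrow> ('c \<times> 'd \<Rightarrow>\<^sub>0 'k)" where
  "tensor_map f g = lin_ext (\<lambda>(a, b). tensor (f (basis_elem a)) (g (basis_elem b)))"

record (overloaded) ('b, 'k) hopf =
  basis :: "'b set"
  wt :: "'b \<Rightarrow> nat"
  unit :: "'b \<Rightarrow>\<^sub>0 'k"
  mult :: "('b \<Rightarrow>\<^sub>0 'k) \<Rightarrow> ('b \<Rightarrow>\<^sub>0 'k) \<Rightarrow> ('b \<Rightarrow>\<^sub>0 'k)"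
  counit :: "('b \<Rightarrow>\<^sub>0 'k) \<Rightarrow> 'k"
  comult :: "('b \<Rightarrow>\<^sub>0 'k) \<Rightarrow> ('b \<times> 'b \<Rightarrow>\<^sub>0 'k)"

definition hopf_space :: "('b, 'k::comm_ring_1) hopf \<Rightarrow> ('b \<Rightarrow>\<^sub>0 'k) set" where
  "hopf_space H = {x. Poly_Mapping.keys x \<subseteq> basis H}"

definition homogeneous :: "('b, 'k::comm_ring_1) hopf \<Rightarrow> nat \<Rightarrow> ('b \<Rightarrow>\<^sub>0 'k) set" where
  "homogeneous H n = {x. Poly_Mapping.keys x \<subseteq> {b \<in> basis H. wt H b = n}}"

definition linear_between ::
    "('a \<Rightarrow>\<^sub>0 'k::comm_ring_1) set \<Rightarrow> ('b \<Rightarrow>\<^sub>0 'k) set \<Rightarrow> (('a \<Rightarrow>\<^sub>0 'k) \<Rightarrow> ('b \<Rightarrow>\<^sub>0 'k)) \<Rightarrow> bool" where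
  "linear_between X Y f \<longleftrightarrow>
     (\<forall>x\<in>X. f x \<in> Y) \<and>
     (\<forall>x\<in>X. \<forall>y\<in>X. f (x + y) = f x + f y) \<and>
     (\<forall>c. \<forall>x\<in>X. f (scal c x) = scal c (f x))"

text \<open>\<open>S\<close> is a two-sided convolution inverse of the identity: \<open>mult \<circ> (S \<otimes> id) \<circ> comult\<close> and
  \<open>mult \<circ> (id \<otimes> S) \<circ> comult\<close> are both equal to \<open>unit \<circ> counit\<close>.\<close>

definition is_antipode ::
    "('b, 'k::comm_ring_1) hopf \<Rightarrow> (('b \<Rightarrow>\<^sub>0 'k) \<Rightarrow> ('b \<Rightarrow>\<^sub>0 'k)) \<Rightarrow> bool" where
  "is_antipode H S \<longleftrightarrow>
     linear_between (hopf_space H) (hopf_space H) S \<and>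
     (\<forall>x\<in>hopf_space H.
        lin_ext (\<lambda>(a, b). mult H (S (basis_elem a)) (basis_elem b)) (comult H x)
          = scal (counit H x) (unit H) \<and>
        lin_ext (\<lambda>(a, b). mult H (basis_elem a) (S (basis_elem b))) (comult H x)
          = scal (counit H x) (unit H))"

text \<open>An antipode is unique if it exists, so the last clause is compatibility with the antipodes.\<close>

definition graded_hopf_hom ::
    "('a, 'k::comm_ring_1) hopf \<Rightarrow> ('b, 'k) hopf \<Rightarrow> (('a \<Rightarrow>\<^sub>0 'k) \<Rightarrow> ('b \<Rightarrow>\<^sub>0 'k)) \<Rightarrow> bool" where
  "graded_hopf_hom A B f \<longleftrightarrow>
     linear_between (hopf_space A) (hopf_space B) f \<and>
     (\<forall>n. \<forall>x\<in>homogeneous A n. f x \<in> homogeneous B n) \<and>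
     f (unit A) = unit B \<and>
     (\<forall>x\<in>hopf_space A. \<forall>y\<in>hopf_space A. f (mult A x y) = mult B (f x) (f y)) \<and>
     (\<forall>x\<in>hopf_space A. counit B (f x) = counit A x) \<and>
     (\<forall>x\<in>hopf_space A. comult B (f x) = tensor_map f f (comult A x)) \<and>
     (\<forall>S S'. is_antipode A S \<longrightarrow> is_antipode B S' \<longrightarrow> (\<forall>x\<in>hopf_space A. f (S x) = S' (f x)))"

text \<open>A (unital) \<open>\<rat>\<close>-algebra structure on \<open>'k\<close>, given by its structure map.\<close>

definition rat_algebra :: "(rat \<Rightarrow> 'k::comm_ring_1) \<Rightarrow> bool" where
  "rat_algebra \<iota> \<longleftrightarrow>
     \<iota> 1 = 1 \<and> (\<forall>a b. \<iota> (a + b) = \<iota> a + \<iota> b) \<and> (\<forall>a b. \<iota> (a * b) = \<iota> a * \<iota> b)"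


section \<open>Rooted trees\<close>

text \<open>
  Finite rooted trees with vertices labeled in \<open>'a\<close>, up to isomorphism: the children of a vertex
  form a multiset.
\<close>

datatype 'a rtree = Node (tree_root: 'a) (children: "'a rtree multiset")

type_synonym wtree = "nat rtree"
type_synonym wforest = "nat rtree multiset"

primrec num_vertices :: "'a rtree \<Rightarrow> nat" where
  "num_vertices (Node a F) = 1 + (\<Sum>u\<in>#F. num_vertices u)"

primrec height :: "'a rtree \<Rightarrow> nat" where
  "height (Node a F) = Max (insert 0 (set_mset (image_mset (\<lambda>u. Suc (height u)) F)))"

primrec weight :: "wtree \<Rightarrow> nat" where
  "weight (Node a F) = a + (\<Sum>u\<in>#F. weight u)"

definition forest_weight :: "wforest \<Rightarrow> nat" where
  "forest_weight F = (\<Sum>u\<in>#F. weight u)"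

definition trees :: "nat set \<Rightarrow> wtree set" where
  "trees W = {T. set_rtree T \<subseteq> W}"

definition forests :: "nat set \<Rightarrow> wforest set" where
  "forests W = {F. \<forall>T\<in>#F. T \<in> trees W}"

definition B_plus :: "wforest \<Rightarrow> wtree" where
  "B_plus F = Node 0 F"

definition bar_trees :: "nat set \<Rightarrow> wtree set" where
  "bar_trees W = B_plus ` forests W"

text \<open>
  To speak about the individual vertices and edges of \<open>T\<close> we use a concrete representative: a tree
  \<open>t\<close> whose vertices \<open>set_rtree t\<close> are pairwise distinct numbers, with a weight function \<open>l\<close> on the
  vertices. An edge is identified with its endpoint farther from the root. For trees with distinct
  vertices, \<open>=\<close> is equality of rooted trees on a given vertex set, not just isomorphism.
\<close>

definition represents :: "nat rtree \<times> (nat \<Rightarrow> nat) \<Rightarrow> wtree \<Rightarrow> bool" where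
  "represents = (\<lambda>(t, l) T. card (set_rtree t) = num_vertices t \<and> map_rtree l t = T)"

definition representative :: "wtree \<Rightarrow> nat rtree \<times> (nat \<Rightarrow> nat)" where
  "representative T = (SOME p. represents p T)"

definition num_automorphisms :: "wtree \<Rightarrow> nat" where
  "num_automorphisms T = (case representative T of (t, l) \<Rightarrow>
     card {f. f permutes set_rtree t \<and> map_rtree f t = t \<and> (\<forall>v\<in>set_rtree t. l (f v) = l v)})"


section \<open>The Grossman-Larson algebra\<close>

text \<open>
  \<open>graft h l s\<close> joins to every vertex \<open>v\<close> of \<open>s\<close> the roots of the trees in the forest \<open>h v\<close>; the
  vertices of \<open>s\<close> get their weights from \<open>l\<close>.
\<close>

primrec graft :: "(nat \<Rightarrow> wforest) \<Rightarrow> (nat \<Rightarrow> nat) \<Rightarrow> nat rtree \<Rightarrow> wtree" where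
  "graft h l (Node v G) = Node (l v) (image_mset (graft h l) G + h v)"

text \<open>
  The branches of a representative \<open>t\<close> of \<open>T\<close> are pairwise distinct, so \<open>g\<close> below ranges over the
  \<open>v(S) ^ m\<close> ways of choosing a vertex of \<open>S\<close> for each of the \<open>m\<close> branches of \<open>T\<close>.
\<close>

definition gl_mult_basis :: "wtree \<Rightarrow> wtree \<Rightarrow> (wtree \<Rightarrow>\<^sub>0 'k::comm_ring_1)" where
  "gl_mult_basis T S = (case (representative T, representative S) of ((t, k), (s, l)) \<Rightarrow>
     \<Sum>g\<in>set_mset (children t) \<rightarrow>\<^sub>E set_rtree s.
       basis_elem (graft (\<lambda>v. image_mset (map_rtree k) (filter_mset (\<lambda>u. g u = v) (children t))) l s))"

definition gl_mult :: "(wtree \<Rightarrow>\<^sub>0 'k::comm_ring_1) \<Rightarrow> (wtree \<Rightarrow>\<^sub>0 'k) \<Rightarrow> (wtree \<Rightarrow>\<^sub>0 'k)" where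
  "gl_mult = bilin_ext gl_mult_basis"

definition gl_unit :: "wtree \<Rightarrow>\<^sub>0 'k::comm_ring_1" where
  "gl_unit = basis_elem (B_plus {#})"


section \<open>The Connes-Kreimer Hopf algebra\<close>

text \<open>The vertex sets of the paths from the root to the leaves.\<close>

primrec root_leaf_paths :: "'a rtree \<Rightarrow> 'a set set" where
  "root_leaf_paths (Node v F) =
     (if F = {#} then {{v}} else insert v ` \<Union> (set_mset (image_mset root_leaf_paths F)))"

definition tree_edges :: "'a rtree \<Rightarrow> 'a set" where
  "tree_edges t = set_rtree t - {tree_root t}"

definition admissible_cuts :: "'a rtree \<Rightarrow> 'a set set" where
  "admissible_cuts t = {C. C \<subseteq> tree_edges t \<and> (\<forall>p\<in>root_leaf_paths t. card (p \<inter> C) \<le> 1)}"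

primrec cut_root_part :: "'a set \<Rightarrow> 'a rtree \<Rightarrow> 'a rtree" where
  "cut_root_part C (Node v F) =
     Node v (\<Sum>u\<in>#F. if tree_root u \<in> C then {#} else {#cut_root_part C u#})"

text \<open>For an admissible cut there is nothing left to cut inside a component that is split off.\<close>

primrec cut_off_part :: "'a set \<Rightarrow> 'a rtree \<Rightarrow> 'a rtree multiset" where
  "cut_off_part C (Node v F) =
     (\<Sum>u\<in>#F. if tree_root u \<in> C then {#u#} else cut_off_part C u)"

definition ck_comult_tree :: "wtree \<Rightarrow> (wforest \<times> wforest \<Rightarrow>\<^sub>0 'k::comm_ring_1)" where
  "ck_comult_tree T = (case representative T of (t, l) \<Rightarrow>
     basis_elem ({#T#}, {#}) +
     (\<Sum>C\<in>admissible_cuts t.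
        basis_elem (image_mset (map_rtree l) (cut_off_part C t), {#map_rtree l (cut_root_part C t)#})))"

text \<open>
  \<open>wforest \<Rightarrow>\<^sub>0 'k\<close> and \<open>wforest \<times> wforest \<Rightarrow>\<^sub>0 'k\<close> carry the convolution product of
  \<^theory>\<open>HOL-Library.Poly_Mapping\<close>, i.e.\ they are monoid algebras; on the first one this is the
  polynomial algebra on the trees, on the second one it is its tensor square.
\<close>

definition ck_comult_basis :: "wforest \<Rightarrow> (wforest \<times> wforest \<Rightarrow>\<^sub>0 'k::comm_ring_1)" where
  "ck_comult_basis F = (\<Prod>T\<in>#F. ck_comult_tree T)"

definition H_CK :: "nat set \<Rightarrow> (wforest, 'k::comm_ring_1) hopf" where
  "H_CK W = \<lparr>
     basis = forests W,
     wt = forest_weight,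
     unit = 1,
     mult = (*),
     counit = (\<lambda>x. Poly_Mapping.lookup x {#}),
     comult = lin_ext ck_comult_basis\<rparr>"

text \<open>The pairing of \<open>H_GL\<close> and \<open>H_CK\<close>: the bilinear extension of \<open>\<langle>T, F\<rangle> = \<alpha>(T)\<close> if
  \<open>T = B_plus F\<close>, and \<open>0\<close> otherwise.\<close>

definition gl_ck_pairing :: "(wtree \<Rightarrow>\<^sub>0 'k::comm_ring_1) \<Rightarrow> (wforest \<Rightarrow>\<^sub>0 'k) \<Rightarrow> 'k" where
  "gl_ck_pairing x y =
     (\<Sum>T\<in>Poly_Mapping.keys x. \<Sum>F\<in>Poly_Mapping.keys y.
        Poly_Mapping.lookup x T * Poly_Mapping.lookup y F *
        (if T = B_plus F then of_nat (num_automorphisms T) else 0))"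


section \<open>Noncommutative symmetric and quasi-symmetric functions\<close>

definition compositions :: "nat list set" where
  "compositions = {w. 0 \<notin> set w}"

text \<open>The basis element \<open>[m1, ..., mr]\<close> of \<open>NSym\<close> is the word
  \<open>\<Lambda>\<^bsub>m1\<^esub> \<cdots> \<Lambda>\<^bsub>mr\<^esub>\<close>.\<close>

definition NSym :: "(nat list \<Rightarrow>\<^sub>0 'k::comm_ring_1) set" where
  "NSym = {x. Poly_Mapping.keys x \<subseteq> compositions}"

definition ns_mult :: "(nat list \<Rightarrow>\<^sub>0 'k::comm_ring_1) \<Rightarrow> (nat list \<Rightarrow>\<^sub>0 'k) \<Rightarrow> (nat list \<Rightarrow>\<^sub>0 'k)" where
  "ns_mult = bilin_ext (\<lambda>u v. basis_elem (u @ v))"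

text \<open>
  The complete functions, that is the coefficients of the series \<open>\<sigma>(t)\<close>, the inverse of
  \<open>\<Sum>m. (- t) ^ m \<Lambda>\<^bsub>m\<^esub>\<close>.
\<close>

fun complete_sym :: "nat \<Rightarrow> (nat list \<Rightarrow>\<^sub>0 'k::comm_ring_1)" where
  "complete_sym 0 = basis_elem []"
| "complete_sym (Suc n) =
     (\<Sum>i\<le>n. scal ((-1) ^ i) (ns_mult (basis_elem [Suc i]) (complete_sym (n - i))))"

definition complete_word :: "nat list \<Rightarrow> (nat list \<Rightarrow>\<^sub>0 'k::comm_ring_1)" where
  "complete_word w = foldr (\<lambda>m x. ns_mult (complete_sym m) x) w (basis_elem [])"

text \<open>
  The basis element \<open>w\<close> of \<open>QSym\<close> is the monomial quasi-symmetric function \<open>M w\<close>. The monomial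
  \<open>x\<^sub>1^e1 x\<^sub>2^e2 \<cdots>\<close> has coefficient \<open>1\<close> in \<open>M w\<close> if \<open>w\<close> is obtained from \<open>e\<close> by deleting all
  zeros, and \<open>0\<close> otherwise. Hence the coefficient of \<open>M (map2 (+) a b)\<close> in the product of the power
  series \<open>M u\<close> and \<open>M v\<close> counts the pairs \<open>(a, b)\<close> of exponent vectors as below.
\<close>

definition remove_zeros :: "nat list \<Rightarrow> nat list" where
  "remove_zeros = filter (\<lambda>n. n \<noteq> 0)"

definition qs_mult_basis :: "nat list \<Rightarrow> nat list \<Rightarrow> (nat list \<Rightarrow>\<^sub>0 'k::comm_ring_1)" where
  "qs_mult_basis u v =
     (\<Sum>(a, b)\<in>{(a, b). length a = length b \<and> remove_zeros a = u \<and> remove_zeros b = v \<and>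
                     map2 (+) a b \<in> compositions}.
        basis_elem (map2 (+) a b))"

definition qs_comult_basis :: "nat list \<Rightarrow> (nat list \<times> nat list \<Rightarrow>\<^sub>0 'k::comm_ring_1)" where
  "qs_comult_basis w = (\<Sum>i\<le>length w. basis_elem (take i w, drop i w))"

definition QSym :: "(nat list, 'k::comm_ring_1) hopf" where
  "QSym = \<lparr>
     basis = compositions,
     wt = sum_list,
     unit = basis_elem [],
     mult = bilin_ext qs_mult_basis,
     counit = (\<lambda>x. Poly_Mapping.lookup x []),
     comult = lin_ext qs_comult_basis\<rparr>"

text \<open>
  The standard duality between \<open>NSym\<close> and \<open>QSym\<close>: the monomial basis is dual to the basis of
  products of complete functions.
\<close>

definition complete_coords :: "(nat list \<Rightarrow>\<^sub>0 'k::comm_ring_1) \<Rightarrow> (nat list \<Rightarrow>\<^sub>0 'k)" where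
  "complete_coords x =
     (THE c. Poly_Mapping.keys c \<subseteq> compositions \<and> lin_ext complete_word c = x)"

definition ns_qs_pairing :: "(nat list \<Rightarrow>\<^sub>0 'k::comm_ring_1) \<Rightarrow> (nat list \<Rightarrow>\<^sub>0 'k) \<Rightarrow> 'k" where
  "ns_qs_pairing x y =
     (\<Sum>w\<in>Poly_Mapping.keys y. Poly_Mapping.lookup (complete_coords x) w * Poly_Mapping.lookup y w)"


section \<open>The homomorphism and its graded dual\<close>

definition TW_Lambda :: "(rat \<Rightarrow> 'k::comm_ring_1) \<Rightarrow> nat set \<Rightarrow> nat \<Rightarrow> (wtree \<Rightarrow>\<^sub>0 'k)" where
  "TW_Lambda \<iota> W m =
     (\<Sum>T\<in>{T \<in> bar_trees W. height T \<le> 1 \<and> weight T = m}.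
        scal ((-1) ^ (size (children T) + weight T) * \<iota> (1 / of_nat (num_automorphisms T)))
          (basis_elem T))"

definition TW :: "(rat \<Rightarrow> 'k::comm_ring_1) \<Rightarrow> nat set \<Rightarrow> (nat list \<Rightarrow>\<^sub>0 'k) \<Rightarrow> (wtree \<Rightarrow>\<^sub>0 'k)" where
  "TW \<iota> W = lin_ext (\<lambda>w. foldr (\<lambda>m x. gl_mult (TW_Lambda \<iota> W m) x) w gl_unit)"

text \<open>
  Both pairings vanish between different degrees and all homogeneous components are free of finite
  rank, so the adjoint with respect to the pairings is the transpose in each degree.
\<close>

definition is_graded_dual ::
    "(rat \<Rightarrow> 'k::comm_ring_1) \<Rightarrow> nat set \<Rightarrow> (wforest \<Rightarrow>\<^sub>0 'k) \<Rightarrow> (nat list \<Rightarrow>\<^sub>0 'k) \<Rightarrow> bool" where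
  "is_graded_dual \<iota> W y q \<longleftrightarrow>
     q \<in> hopf_space QSym \<and> (\<forall>x\<in>NSym. ns_qs_pairing x q = gl_ck_pairing (TW \<iota> W x) y)"

definition TW_dual :: "(rat \<Rightarrow> 'k::comm_ring_1) \<Rightarrow> nat set \<Rightarrow> (wforest \<Rightarrow>\<^sub>0 'k) \<Rightarrow> (nat list \<Rightarrow>\<^sub>0 'k)" where
  "TW_dual \<iota> W y = (THE q. is_graded_dual \<iota> W y q)"

end

theory Submission
  imports Defs
begin

text \<open>
  Let \<open>S\<^sub>w\<close> be the product of complete functions indexed by a composition \<open>w\<close>. As the monomial
  functions \<open>M\<^sub>w\<close> are dual to the \<open>S\<^sub>w\<close>, the transpose sends a forest \<open>F\<close> to the sum of
  \<open>\<langle>T\<^sub>W(S\<^sub>w), F\<rangle> M\<^sub>w\<close>, and everything follows from a closed description of these coefficients.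

  An element of the Grossman-Larson algebra gives a functional on forests (\<open>gl_functional\<close>), and
  products should become convolutions with respect to the cut coproduct. Only products with
  \<open>T\<^sub>W(\<Lambda>\<^sub>m)\<close> on the left are needed. There the statement says that grafting single vertices in all
  ways is adjoint to cutting off sets of leaves (\<open>graft_cut_duality\<close>,
  \<open>gl_functional_TW_Lambda\<close>): up to the sign \<open>(-1)^m\<close>, the functional convolved with is the character
  \<open>leaf_char\<close>, which is \<open>(-1)^k\<close> on a forest of \<open>k\<close> isolated vertices and \<open>0\<close> elsewhere, restricted
  to weight \<open>m\<close>. The alternating sum over the sets of leaves of a nonempty forest vanishes
  (\<open>cut_sum_leaf_char\<close>), so the inverse of \<open>leaf_char\<close> is the constant character \<open>1\<close>. Hence
  \<open>T\<^sub>W(S\<^sub>m)\<close> acts as convolution with the indicator of the forests of weight \<open>m\<close>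
  (\<open>gl_functional_complete_sym\<close>), and the coefficient of \<open>M\<^sub>w\<close> in the image of \<open>F\<close> is the number
  \<open>qsym_coeff w F\<close> of maps from the vertices of \<open>F\<close> to \<open>{1..length w}\<close> that weakly decrease away from
  the roots and whose fiber over \<open>i\<close> has weight \<open>w\<^sub>i\<close>.

  With this description the transpose is multiplicative because such a map on a disjoint union is a
  pair of such maps (\<open>qsym_coeff_union\<close>), and comultiplicative because splitting the word \<open>w\<close> in two
  means splitting the forest by a cut, which is coassociativity (\<open>qsym_coeff_append\<close>). Compatibility
  with antipodes follows from uniqueness of left convolution inverses on a connected graded coalgebra
  (\<open>left_convolution_inverse_unique\<close>).

  Vertices of unlabeled trees are only accessible through representatives. Three lemmas replace them
  by recursions on trees: \<open>ck_comult_tree_eq\<close> for the coproduct, \<open>num_automorphisms_eq_tree_aut\<close> for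
  automorphism numbers, and \<open>graft_sum_representation\<close> for grafting.
\<close>


section \<open>Linear functionals on free modules\<close>

abbreviation lookup where "lookup \<equiv> Poly_Mapping.lookup"

abbreviation keys where "keys \<equiv> Poly_Mapping.keys"

text \<open>
  The value at \<open>x\<close> of the linear functional that has the values \<open>\<phi>\<close> on the basis. Elements of a free
  module are equal as soon as all these functionals agree on them, and \<open>lin_ext\<close>, products and
  coproducts simplify under a functional to nested functionals.
\<close>

definition lin_fun :: "('b \<Rightarrow> 'k) \<Rightarrow> ('b \<Rightarrow>\<^sub>0 'k::comm_ring_1) \<Rightarrow> 'k" where
  "lin_fun \<phi> x = (\<Sum>b\<in>keys x. lookup x b * \<phi> b)"

lemma lookup_scal [simp]: "lookup (scal c x) b = c * lookup x b"
  by (simp add: scal_def Poly_Mapping.map.rep_eq when_def)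

lemma lookup_basis_elem: "lookup (basis_elem a) b = (if b = a then 1 else 0)"
  by (auto simp: basis_elem_def lookup_single when_def)

lemma keys_basis_elem [simp]: "keys (basis_elem a :: 'b \<Rightarrow>\<^sub>0 'k::comm_ring_1) = {a}"
  by (simp add: basis_elem_def)

lemma lin_fun_superset:
  assumes "finite A" "keys x \<subseteq> A"
  shows "lin_fun \<phi> x = (\<Sum>b\<in>A. lookup x b * \<phi> b)"
  unfolding lin_fun_def using assms
  by (intro sum.mono_neutral_left) (auto simp: in_keys_iff)

lemma lin_fun_zero [simp]: "lin_fun \<phi> 0 = 0"
  by (simp add: lin_fun_def)

lemma lin_fun_add: "lin_fun \<phi> (x + y) = lin_fun \<phi> x + lin_fun \<phi> y"
proof -
  let ?A = "keys x \<union> keys y"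
  have "keys (x + y) \<subseteq> ?A" by (rule keys_add)
  then show ?thesis
    by (simp add: lin_fun_superset[of ?A] lookup_add sum.distrib algebra_simps)
qed

lemma keys_scal: "keys (scal c x) \<subseteq> keys x"
  by (auto simp: in_keys_iff)

lemma lin_fun_scal: "lin_fun \<phi> (scal c x) = c * lin_fun \<phi> x"
  by (subst lin_fun_superset[OF finite_keys keys_scal])
    (simp add: lin_fun_def sum_distrib_left mult.assoc)

lemma lin_fun_sum: "lin_fun \<phi> (sum f A) = (\<Sum>a\<in>A. lin_fun \<phi> (f a))"
  by (induction A rule: infinite_finite_induct) (auto simp: lin_fun_add)

lemma lin_fun_basis_elem [simp]: "lin_fun \<phi> (basis_elem b) = \<phi> b"
  by (simp add: lin_fun_def lookup_basis_elem)

lemma lin_fun_one: "lin_fun \<phi> 1 = \<phi> 0"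
  using lin_fun_basis_elem[of \<phi> 0] by (simp add: basis_elem_def)

lemma lin_fun_indicator:
  "lin_fun (\<lambda>a. if a = b then 1 else 0) x = lookup x b"
  by (auto simp: lin_fun_def if_distrib in_keys_iff cong: if_cong)

lemma poly_mapping_eq_lin_funI: "(\<And>\<phi>. lin_fun \<phi> x = lin_fun \<phi> y) \<Longrightarrow> x = y"
  by (metis lin_fun_indicator poly_mapping_eqI)

lemma lin_fun_cong:
  "(\<And>b. b \<in> keys x \<Longrightarrow> \<phi> b = \<psi> b) \<Longrightarrow> lin_fun \<phi> x = lin_fun \<psi> x"
  by (simp add: lin_fun_def)

lemma lin_fun_add_functional: "lin_fun (\<lambda>b. \<phi> b + \<psi> b) x = lin_fun \<phi> x + lin_fun \<psi> x"
  by (simp add: lin_fun_def sum.distrib algebra_simps)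

lemma lin_fun_mult_left: "lin_fun (\<lambda>b. c * \<phi> b) x = c * lin_fun \<phi> x"
  by (simp add: lin_fun_def sum_distrib_left mult.left_commute)

lemma lin_fun_mult_right: "lin_fun (\<lambda>b. \<phi> b * c) x = lin_fun \<phi> x * c"
  by (simp add: lin_fun_def sum_distrib_right mult.assoc)

lemma lin_fun_sum_functional: "lin_fun (\<lambda>b. \<Sum>a\<in>A. \<phi> a b) x = (\<Sum>a\<in>A. lin_fun (\<phi> a) x)"
  unfolding lin_fun_def sum_distrib_left by (rule sum.swap)

lemma lin_fun_zero_functional [simp]: "lin_fun (\<lambda>b. 0) x = 0"
  by (simp add: lin_fun_def)

text \<open>
  The bilinear extension of \<open>\<phi>\<close> can be evaluated in either order. Used as a rewrite rule this
  equation is symmetric and loops, so it is applied by \<open>rule\<close> or \<open>subst\<close>.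
\<close>

lemma lin_fun_swap:
  "lin_fun (\<lambda>a. lin_fun (\<lambda>b. \<phi> a b) y) x = lin_fun (\<lambda>b. lin_fun (\<lambda>a. \<phi> a b) x) y"
  unfolding lin_fun_def sum_distrib_left
  by (subst sum.swap) (simp add: mult.left_commute)

lemma lin_fun_lin_ext: "lin_fun \<phi> (lin_ext g x) = lin_fun (\<lambda>a. lin_fun \<phi> (g a)) x"
  by (simp add: lin_ext_def lin_fun_sum lin_fun_scal lin_fun_def[of _ x])

lemma lookup_lin_ext:
  "lookup (lin_ext g x) b = lin_fun (\<lambda>a. lookup (g a) b) x"
  by (simp flip: lin_fun_indicator add: lin_fun_lin_ext)

lemma lin_fun_bilin_ext:
  "lin_fun \<phi> (bilin_ext g x y) = lin_fun (\<lambda>a. lin_fun (\<lambda>b. lin_fun \<phi> (g a b)) y) x"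
  by (simp add: bilin_ext_def lin_fun_lin_ext)

lemma times_eq_bilin_ext: "x * y = bilin_ext (\<lambda>a b. basis_elem (a + b)) x y"
proof -
  have expand: "z = (\<Sum>a\<in>keys z. scal (lookup z a) (basis_elem a))"
    for z :: "'a \<Rightarrow>\<^sub>0 'b"
    by (rule poly_mapping_eq_lin_funI) (simp add: lin_fun_sum lin_fun_scal lin_fun_def[of _ z])
  have "x * y = (\<Sum>a\<in>keys x. \<Sum>b\<in>keys y.
      scal (lookup x a) (basis_elem a) * scal (lookup y b) (basis_elem b))"
    by (metis (no_types) expand sum_product)
  also have "\<dots> = (\<Sum>a\<in>keys x. \<Sum>b\<in>keys y.
      scal (lookup x a) (scal (lookup y b) (basis_elem (a + b))))"
    by (simp add: scal_def basis_elem_def mult_single)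
  also have "\<dots> = bilin_ext (\<lambda>a b. basis_elem (a + b)) x y"
    by (rule poly_mapping_eq_lin_funI)
      (simp add: lin_fun_bilin_ext lin_fun_sum lin_fun_scal lin_fun_def[of _ x] lin_fun_def[of _ y]
        sum_distrib_left mult.assoc)
  finally show ?thesis .
qed

lemma lin_fun_times:
  "lin_fun \<phi> (x * y) = lin_fun (\<lambda>a. lin_fun (\<lambda>b. \<phi> (a + b)) y) x"
  by (simp add: times_eq_bilin_ext lin_fun_bilin_ext)

lemma basis_elem_times: "basis_elem a * basis_elem b = basis_elem (a + b)"
  by (simp add: basis_elem_def mult_single)

lemma basis_elem_zero: "basis_elem 0 = 1"
  by (simp add: basis_elem_def)

lemma lin_ext_basis_elem [simp]: "lin_ext g (basis_elem b) = g b"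
  by (rule poly_mapping_eq_lin_funI) (simp add: lin_fun_lin_ext)

lemma lin_ext_basis_id [simp]: "lin_ext basis_elem x = x"
  by (rule poly_mapping_eq_lin_funI) (simp add: lin_fun_lin_ext)

lemma lin_ext_add: "lin_ext g (x + y) = lin_ext g x + lin_ext g y"
  by (rule poly_mapping_eq_lin_funI) (simp add: lin_fun_lin_ext lin_fun_add)

lemma lin_ext_scal: "lin_ext g (scal c x) = scal c (lin_ext g x)"
  by (rule poly_mapping_eq_lin_funI) (simp add: lin_fun_lin_ext lin_fun_scal)

lemma lin_ext_sum: "lin_ext g (sum f A) = (\<Sum>a\<in>A. lin_ext g (f a))"
  by (rule poly_mapping_eq_lin_funI) (simp add: lin_fun_lin_ext lin_fun_sum)

lemma lin_ext_lin_ext: "lin_ext g (lin_ext h x) = lin_ext (\<lambda>a. lin_ext g (h a)) x"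
  by (rule poly_mapping_eq_lin_funI) (simp add: lin_fun_lin_ext)

lemma lin_ext_cong:
  "(\<And>b. b \<in> keys x \<Longrightarrow> g b = h b) \<Longrightarrow> lin_ext g x = lin_ext h x"
  by (simp add: lin_ext_def)

lemma keys_lin_ext:
  assumes "\<And>b. b \<in> keys x \<Longrightarrow> keys (g b) \<subseteq> A"
  shows "keys (lin_ext g x) \<subseteq> A"
proof
  fix c assume "c \<in> keys (lin_ext g x)"
  then have "lin_fun (\<lambda>a. lookup (g a) c) x \<noteq> 0"
    by (simp add: in_keys_iff lookup_lin_ext)
  then obtain b where "b \<in> keys x" "lookup (g b) c \<noteq> 0"
    using lin_fun_cong[of x "\<lambda>a. lookup (g a) c" "\<lambda>_. 0"] by auto
  then show "c \<in> A" by (meson assms in_keys_iff subsetD)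
qed

lemma bilin_ext_basis_elem [simp]: "bilin_ext g (basis_elem a) (basis_elem b) = g a b"
  by (simp add: bilin_ext_def)

lemma scal_scal: "scal a (scal b x) = scal (a * b) x"
  by (rule poly_mapping_eqI) (simp add: mult.assoc)

lemma scal_times:
  fixes x y :: "'b::comm_monoid_add \<Rightarrow>\<^sub>0 'a::comm_ring_1"
  shows "scal a x * scal b y = scal (a * b) (x * y)"
proof -
  have "Poly_Mapping.single 0 (a * b) = (Poly_Mapping.single 0 a * Poly_Mapping.single 0 b :: 'b \<Rightarrow>\<^sub>0 'a)"
    by (simp add: mult_single)
  then show ?thesis by (simp add: scal_def mult_map_scale_conv_mult ac_simps)
qed

lemma scal_one [simp]: "scal 1 x = x"
  by (rule poly_mapping_eqI) simp

lemma scal_sum: "scal c (sum f A) = (\<Sum>a\<in>A. scal c (f a))"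
  by (rule poly_mapping_eqI) (simp add: lookup_sum sum_distrib_left)

lemma lookup_bilin_ext:
  "lookup (bilin_ext g x y) c = lin_fun (\<lambda>a. lin_fun (\<lambda>b. lookup (g a b) c) y) x"
  by (simp add: bilin_ext_def lookup_lin_ext)

lemma lookup_times: "lookup (Y * Z) F =
  lin_fun (\<lambda>P. lin_fun (\<lambda>Q. if P + Q = F then 1 else 0) Z) Y"
  by (simp only: lin_fun_indicator[symmetric] lin_fun_times)

lemma lookup_sum_basis_elem:
  assumes "finite L"
  shows "lookup (\<Sum>P\<in>L. scal (w P) (basis_elem P)) Q = (if Q \<in> L then w Q else 0)"
proof -
  have "lookup (\<Sum>P\<in>L. scal (w P) (basis_elem P)) Q = (\<Sum>P\<in>L. if Q = P then w P else 0)"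
    unfolding lookup_sum by (rule sum.cong) (auto simp: lookup_basis_elem)
  then show ?thesis using assms by simp
qed


section \<open>Trees with pairwise distinct vertices\<close>

definition forest_vertices :: "'a rtree multiset \<Rightarrow> 'a set" where
  "forest_vertices G = (\<Union>u\<in>set_mset G. set_rtree u)"

lemma forest_vertices_simps [simp]:
  "forest_vertices {#} = {}"
  "forest_vertices (add_mset u G) = set_rtree u \<union> forest_vertices G"
  by (auto simp: forest_vertices_def)

lemma set_rtree_Node: "set_rtree (Node v G) = insert v (forest_vertices G)"
  by (auto simp: forest_vertices_def)

lemma set_rtree_subset_forest_vertices: "u \<in># G \<Longrightarrow> set_rtree u \<subseteq> forest_vertices G"
  by (auto simp: forest_vertices_def)

lemma finite_set_rtree [simp]: "finite (set_rtree t)"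
  by (induction t) auto

lemma finite_forest_vertices [simp]: "finite (forest_vertices G)"
  by (simp add: forest_vertices_def)

lemma tree_root_in_set_rtree [simp]: "tree_root t \<in> set_rtree t"
  by (cases t) auto

text \<open>
  A vertex occurring twice would be counted twice by \<open>num_vertices\<close> but only once by \<open>card\<close>. For
  forests this also forces the trees to have disjoint vertex sets.
\<close>

definition distinct_tree :: "'a rtree \<Rightarrow> bool" where
  "distinct_tree t \<longleftrightarrow> card (set_rtree t) = num_vertices t"

definition distinct_forest :: "'a rtree multiset \<Rightarrow> bool" where
  "distinct_forest G \<longleftrightarrow> card (forest_vertices G) = (\<Sum>u\<in>#G. num_vertices u)"

lemma card_forest_vertices_le_aux:
  assumes "\<And>u. u \<in># G \<Longrightarrow> card (set_rtree u) \<le> num_vertices u"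
  shows "card (forest_vertices G) \<le> (\<Sum>u\<in>#G. num_vertices u)"
  using assms
proof (induction G)
  case (add u G)
  have "card (forest_vertices (add_mset u G)) \<le> card (set_rtree u) + card (forest_vertices G)"
    by (simp add: card_Un_le)
  also have "\<dots> \<le> num_vertices u + (\<Sum>u\<in>#G. num_vertices u)"
    using add by (intro add_mono) auto
  finally show ?case by simp
qed simp

lemma card_set_rtree_le: "card (set_rtree t) \<le> num_vertices t"
proof (induction t)
  case (Node v G)
  have "card (set_rtree (Node v G)) \<le> Suc (card (forest_vertices G))"
    by (simp add: set_rtree_Node card_insert_if del: rtree.set)
  also have "\<dots> \<le> num_vertices (Node v G)"
    using card_forest_vertices_le_aux[of G] Node by simp
  finally show ?case .
qed

lemmas card_forest_vertices_le = card_forest_vertices_le_aux[OF card_set_rtree_le]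

lemma distinct_tree_Node:
  "distinct_tree (Node v G) \<longleftrightarrow> v \<notin> forest_vertices G \<and> distinct_forest G"
  using card_forest_vertices_le[of G]
  by (auto simp: distinct_tree_def distinct_forest_def set_rtree_Node card_insert_if
      simp del: rtree.set)

lemma distinct_forest_add_mset:
  "distinct_forest (add_mset u G) \<longleftrightarrow>
     distinct_tree u \<and> distinct_forest G \<and> set_rtree u \<inter> forest_vertices G = {}"
proof -
  let ?A = "set_rtree u" and ?B = "forest_vertices G"
  have *: "card (?A \<union> ?B) + card (?A \<inter> ?B) = card ?A + card ?B"
    by (simp flip: card_Un_Int)
  show ?thesis
  proof
    assume d: "distinct_forest (add_mset u G)"
    then have "card (?A \<union> ?B) = num_vertices u + (\<Sum>u\<in>#G. num_vertices u)"
      by (simp add: distinct_forest_def)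
    with * card_set_rtree_le[of u] card_forest_vertices_le[of G]
    have "card ?A = num_vertices u" "card ?B = (\<Sum>u\<in>#G. num_vertices u)" "card (?A \<inter> ?B) = 0"
      by linarith+
    then show "distinct_tree u \<and> distinct_forest G \<and> ?A \<inter> ?B = {}"
      by (simp add: distinct_tree_def distinct_forest_def)
  qed (use * in \<open>auto simp: distinct_tree_def distinct_forest_def\<close>)
qed

lemma distinct_forest_empty [simp]: "distinct_forest {#}"
  by (simp add: distinct_forest_def)

text \<open>
  The common induction scheme for everything that is computed from a representative: functions and
  sets of vertices decompose as products along the disjoint vertex sets in each step.
\<close>

lemma distinct_tree_forest_induct:
  assumes "\<And>v G. distinct_forest G \<Longrightarrow> v \<notin> forest_vertices G \<Longrightarrow> Q G \<Longrightarrow> P (Node v G)"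
    and "Q {#}"
    and "\<And>u G. distinct_tree u \<Longrightarrow> distinct_forest G \<Longrightarrow> set_rtree u \<inter> forest_vertices G = {}
          \<Longrightarrow> P u \<Longrightarrow> Q G \<Longrightarrow> Q (add_mset u G)"
  shows "distinct_tree t \<Longrightarrow> P t" and "distinct_forest G \<Longrightarrow> Q G"
proof -
  have forest: "Q G" if "distinct_forest G" "\<And>u. u \<in># G \<Longrightarrow> distinct_tree u \<Longrightarrow> P u" for G
    using that
  proof (induction G)
    case (add u G)
    then show ?case using assms(3)[of u G] by (auto simp: distinct_forest_add_mset)
  qed (use assms in simp)
  have tree: "distinct_tree t \<Longrightarrow> P t" for t
  proof (induction t)
    case (Node v G)
    then show ?case using forest[of G] assms(1)[of G v] by (auto simp: distinct_tree_Node)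
  qed
  show "distinct_tree t \<Longrightarrow> P t" by (rule tree)
  show "distinct_forest G \<Longrightarrow> Q G" using forest tree by blast
qed

lemma num_vertices_map_rtree [simp]: "num_vertices (map_rtree f t) = num_vertices t"
proof (induction t)
  case (Node v G)
  then have "image_mset (\<lambda>u. num_vertices (map_rtree f u)) G = image_mset num_vertices G"
    by (intro image_mset_cong) auto
  then show ?case by (simp add: multiset.map_comp comp_def)
qed

lemma distinct_tree_map_rtree:
  assumes "inj f" "distinct_tree t"
  shows "distinct_tree (map_rtree f t)"
  using assms by (simp add: distinct_tree_def rtree.set_map card_image inj_on_subset)

lemma forest_vertices_image_mset_map_rtree:
  "forest_vertices (image_mset (map_rtree f) G) = f ` forest_vertices G"
  by (auto simp: forest_vertices_def rtree.set_map)

lemma distinct_forest_image_mset_map_rtree: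
  assumes "inj f" "distinct_forest G"
  shows "distinct_forest (image_mset (map_rtree f) G)"
  using assms
  by (simp add: distinct_forest_def forest_vertices_image_mset_map_rtree card_image inj_on_subset
      multiset.map_comp comp_def)

lemma map_rtree_cong_set: "(\<And>v. v \<in> set_rtree t \<Longrightarrow> f v = g v) \<Longrightarrow> map_rtree f t = map_rtree g t"
  by (auto intro: rtree.map_cong)

lemma image_map_rtree_cong_set:
  "(\<And>v. v \<in> forest_vertices G \<Longrightarrow> f v = g v) \<Longrightarrow> image_mset (map_rtree f) G = image_mset (map_rtree g) G"
  by (intro image_mset_cong map_rtree_cong_set) (auto simp: forest_vertices_def)

text \<open>
  Representatives of the parts are made disjoint by moving them to the even and the odd numbers; the
  root gets the number \<open>0\<close>, after a shift of the vertices of the branches.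
\<close>

lemma representation_exists: "\<exists>t l. distinct_tree (t :: nat rtree) \<and> map_rtree l t = (T :: 'a rtree)"
proof (induction T)
  case (Node a F)
  have "\<exists>G l. distinct_forest (G :: nat rtree multiset) \<and> image_mset (map_rtree l) G = F"
    using Node
  proof (induction F)
    case (add T F)
    from add.prems[of T] obtain t l where tl: "distinct_tree (t :: nat rtree)" "map_rtree l t = T"
      by auto
    have "\<exists>G l. distinct_forest (G :: nat rtree multiset) \<and> image_mset (map_rtree l) G = F"
      by (rule add.IH) (use add.prems in auto)
    then obtain G k where Gk: "distinct_forest (G :: nat rtree multiset)" "image_mset (map_rtree k) G = F"
      by blast
    define l' where "l' n = (if even n then l (n div 2) else k (n div 2))" for n :: nat
    define t' where "t' = map_rtree (\<lambda>v. 2 * v) t"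
    define G' where "G' = image_mset (map_rtree (\<lambda>v. 2 * v + 1)) G"
    have "distinct_tree t'" "distinct_forest G'"
      unfolding t'_def G'_def
      by (rule distinct_tree_map_rtree distinct_forest_image_mset_map_rtree; use tl Gk in \<open>simp add: inj_def\<close>)+
    moreover have "set_rtree t' \<inter> forest_vertices G' = {}"
      unfolding t'_def G'_def forest_vertices_image_mset_map_rtree by (auto simp: rtree.set_map) presburger
    moreover have "map_rtree l' t' = T"
      using tl by (simp add: t'_def rtree.map_comp comp_def l'_def)
    moreover have "image_mset (map_rtree l') G' = F"
      using Gk by (simp add: G'_def rtree.map_comp comp_def l'_def multiset.map_comp)
    ultimately have "distinct_forest (add_mset t' G') \<and> image_mset (map_rtree l') (add_mset t' G') = add_mset T F"
      by (simp add: distinct_forest_add_mset)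
    then show ?case by blast
  qed (auto intro: exI[of _ "{#}"])
  then obtain G l where G: "distinct_forest (G :: nat rtree multiset)" "image_mset (map_rtree l) G = F"
    by blast
  define t where "t = Node 0 (image_mset (map_rtree Suc) G)"
  define l' where "l' n = (case n of 0 \<Rightarrow> a | Suc m \<Rightarrow> l m)" for n
  have "distinct_tree t"
    using G by (auto simp: t_def distinct_tree_Node forest_vertices_image_mset_map_rtree
        distinct_forest_image_mset_map_rtree)
  moreover have "map_rtree l' t = Node a F"
    using G by (simp add: t_def l'_def multiset.map_comp rtree.map_comp comp_def)
  ultimately show ?case by blast
qed

lemma representativeE:
  obtains t l where "representative T = (t, l)" "distinct_tree t" "map_rtree l t = T"
proof -
  obtain t :: "nat rtree" and l where "distinct_tree t" "map_rtree l t = T"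
    using representation_exists by blast
  then have "represents (t, l) T" by (simp add: represents_def distinct_tree_def)
  then have "represents (representative T) T" unfolding representative_def by (rule someI)
  then show thesis using that by (cases "representative T") (auto simp: represents_def distinct_tree_def)
qed


section \<open>Admissible cuts\<close>

text \<open>
  The analogues of \<open>cut_root_part\<close> and \<open>cut_off_part\<close> for a forest whose roots hang from a common
  vertex, so that the edges above the roots may be cut as well.
\<close>

definition cut_root_forest :: "'a set \<Rightarrow> 'a rtree multiset \<Rightarrow> 'a rtree multiset" where
  "cut_root_forest C G = (\<Sum>u\<in>#G. if tree_root u \<in> C then {#} else {#cut_root_part C u#})"

definition cut_off_forest :: "'a set \<Rightarrow> 'a rtree multiset \<Rightarrow> 'a rtree multiset" where
  "cut_off_forest C G = (\<Sum>u\<in>#G. if tree_root u \<in> C then {#u#} else cut_off_part C u)"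

lemma cut_parts_Node:
  "cut_root_part C (Node v G) = Node v (cut_root_forest C G)"
  "cut_off_part C (Node v G) = cut_off_forest C G"
  by (simp_all add: cut_root_forest_def cut_off_forest_def multiset.map_comp comp_def)

lemma cut_parts_cong:
  "C \<inter> set_rtree t = C' \<inter> set_rtree t \<Longrightarrow>
    cut_root_part C t = cut_root_part C' t \<and> cut_off_part C t = cut_off_part C' t"
proof (induction t)
  case (Node v G)
  have "cut_root_part C u = cut_root_part C' u \<and> cut_off_part C u = cut_off_part C' u
      \<and> (tree_root u \<in> C \<longleftrightarrow> tree_root u \<in> C')"
    if "u \<in># G" for u
  proof -
    have "C \<inter> set_rtree u = C' \<inter> set_rtree u" using Node.prems that by fastforce
    then show ?thesis using Node.IH[OF that] tree_root_in_set_rtree[of u] by blast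
  qed
  then show ?case
    by (auto simp: cut_parts_Node cut_root_forest_def cut_off_forest_def
        intro!: arg_cong[of _ _ sum_mset] image_mset_cong)
qed

lemma cut_forest_cong:
  assumes "C \<inter> forest_vertices G = C' \<inter> forest_vertices G"
  shows "cut_root_forest C G = cut_root_forest C' G" "cut_off_forest C G = cut_off_forest C' G"
proof -
  have "cut_root_part C u = cut_root_part C' u \<and> cut_off_part C u = cut_off_part C' u
      \<and> (tree_root u \<in> C \<longleftrightarrow> tree_root u \<in> C')"
    if "u \<in># G" for u
  proof -
    have "C \<inter> set_rtree u = C' \<inter> set_rtree u"
      using assms set_rtree_subset_forest_vertices[OF that] by blast
    then show ?thesis using cut_parts_cong tree_root_in_set_rtree[of u] by blast
  qed
  then show "cut_root_forest C G = cut_root_forest C' G" "cut_off_forest C G = cut_off_forest C' G"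
    by (auto simp: cut_root_forest_def cut_off_forest_def
        intro!: arg_cong[of _ _ sum_mset] image_mset_cong)
qed

text \<open>
  Admissible ways to cut a tree that hangs from another vertex: either the edge above its root, and
  then nothing else, or an admissible cut of the tree itself.
\<close>

definition tree_cuts :: "'a rtree \<Rightarrow> 'a set set" where
  "tree_cuts t = insert {tree_root t} (admissible_cuts t)"

definition forest_cuts :: "'a rtree multiset \<Rightarrow> 'a set set" where
  "forest_cuts G = {C. C \<subseteq> forest_vertices G \<and> (\<forall>u\<in>#G. C \<inter> set_rtree u \<in> tree_cuts u)}"

lemma root_leaf_paths_props:
  shows "p \<in> root_leaf_paths t \<Longrightarrow> tree_root t \<in> p \<and> p \<subseteq> set_rtree t"
    and "v \<in> set_rtree t \<Longrightarrow> \<exists>p\<in>root_leaf_paths t. v \<in> p"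
proof -
  have "(\<forall>p\<in>root_leaf_paths t. tree_root t \<in> p \<and> p \<subseteq> set_rtree t) \<and>
        root_leaf_paths t \<noteq> {} \<and> (\<forall>v\<in>set_rtree t. \<exists>p\<in>root_leaf_paths t. v \<in> p)"
  proof (induction t)
    case (Node v G)
    show ?case
    proof (cases "G = {#}")
      case False
      then obtain u where u: "u \<in># G" by blast
      from Node[OF u] have ne: "root_leaf_paths u \<noteq> {}" by blast
      have eq: "root_leaf_paths (Node v G) = insert v ` (\<Union>u\<in>set_mset G. root_leaf_paths u)"
        using False by simp
      have "\<exists>p\<in>root_leaf_paths (Node v G). w \<in> p" if "w \<in> set_rtree (Node v G)" for w
      proof (cases "w = v")
        case True
        then show ?thesis using ne u unfolding eq by blast
      next
        case False
        then obtain u' where "u' \<in># G" "w \<in> set_rtree u'" using \<open>w \<in> set_rtree (Node v G)\<close> by auto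
        then show ?thesis using Node[of u'] unfolding eq by blast
      qed
      moreover have "\<forall>p\<in>root_leaf_paths (Node v G). v \<in> p \<and> p \<subseteq> set_rtree (Node v G)"
        using Node unfolding eq by fastforce
      ultimately show ?thesis using ne u unfolding eq by auto
    qed simp
  qed
  then show "p \<in> root_leaf_paths t \<Longrightarrow> tree_root t \<in> p \<and> p \<subseteq> set_rtree t"
    "v \<in> set_rtree t \<Longrightarrow> \<exists>p\<in>root_leaf_paths t. v \<in> p"
    by blast+
qed

text \<open>
  Every path contains the root and every vertex lies on a path, so a set that meets each path at most
  once and contains the root is just the root.
\<close>

lemma tree_cuts_iff:
  assumes "D \<subseteq> set_rtree t"
  shows "D \<in> tree_cuts t \<longleftrightarrow> (\<forall>p\<in>root_leaf_paths t. card (p \<inter> D) \<le> 1)"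
proof
  assume "D \<in> tree_cuts t"
  then show "\<forall>p\<in>root_leaf_paths t. card (p \<inter> D) \<le> 1"
  proof (unfold tree_cuts_def, elim insertE)
    assume "D = {tree_root t}"
    then have "card (p \<inter> D) \<le> card {tree_root t}" for p by (intro card_mono) auto
    then show ?thesis by simp
  qed (simp add: admissible_cuts_def)
next
  assume *: "\<forall>p\<in>root_leaf_paths t. card (p \<inter> D) \<le> 1"
  show "D \<in> tree_cuts t"
  proof (cases "tree_root t \<in> D")
    case True
    have "v = tree_root t" if "v \<in> D" for v
    proof -
      have "v \<in> set_rtree t" using that assms by blast
      then obtain p where p: "p \<in> root_leaf_paths t" "v \<in> p"
        using root_leaf_paths_props(2)[of v t] by blast
      have "tree_root t \<in> p" "p \<subseteq> set_rtree t" using root_leaf_paths_props(1)[OF p(1)] by auto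
      then have "finite (p \<inter> D)" using finite_subset[OF _ finite_set_rtree[of t]] by blast
      moreover have "card (p \<inter> D) \<le> Suc 0" using * p by auto
      ultimately have "\<forall>a\<in>p \<inter> D. \<forall>b\<in>p \<inter> D. a = b" by (simp only: card_le_Suc0_iff_eq)
      then show ?thesis using p that True \<open>tree_root t \<in> p\<close> by blast
    qed
    with True have "D = {tree_root t}" by blast
    then show ?thesis by (simp add: tree_cuts_def)
  next
    case False
    then have "D \<in> admissible_cuts t" using * assms by (auto simp: admissible_cuts_def tree_edges_def)
    then show ?thesis by (simp add: tree_cuts_def)
  qed
qed

lemma admissible_cuts_Node:
  assumes "v \<notin> forest_vertices G"
  shows "admissible_cuts (Node v G) = forest_cuts G"
proof -
  have "(\<forall>p\<in>root_leaf_paths (Node v G). card (p \<inter> C) \<le> 1) \<longleftrightarrow>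
        (\<forall>u\<in>#G. C \<inter> set_rtree u \<in> tree_cuts u)" if C: "C \<subseteq> forest_vertices G" for C
  proof (cases "G = {#}")
    case False
    have "card (insert v p \<inter> C) = card (p \<inter> (C \<inter> set_rtree u))" if "p \<in> root_leaf_paths u" for p u
    proof -
      have "insert v p \<inter> C = p \<inter> (C \<inter> set_rtree u)"
        using root_leaf_paths_props(1)[OF that] C assms by blast
      then show ?thesis by simp
    qed
    then show ?thesis using False by (simp add: tree_cuts_iff)
  qed (use C in auto)
  moreover have "tree_edges (Node v G) = forest_vertices G"
    using assms by (auto simp: tree_edges_def set_rtree_Node simp del: rtree.set)
  ultimately show ?thesis
    by (auto simp: admissible_cuts_def forest_cuts_def simp del: root_leaf_paths.simps)
qed

lemma tree_cuts_subset: "C \<in> tree_cuts t \<Longrightarrow> C \<subseteq> set_rtree t"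
  by (auto simp: tree_cuts_def admissible_cuts_def tree_edges_def)

lemma finite_tree_cuts: "finite (tree_cuts t)" "finite (admissible_cuts t)" "finite (forest_cuts G)"
proof -
  show "finite (tree_cuts t)"
    by (rule finite_subset[of _ "Pow (set_rtree t)"]) (use tree_cuts_subset in auto)
  then show "finite (admissible_cuts t)" by (simp add: tree_cuts_def)
  show "finite (forest_cuts G)"
    by (rule finite_subset[of _ "Pow (forest_vertices G)"]) (auto simp: forest_cuts_def)
qed

lemma sum_forest_cuts_add_mset:
  assumes "set_rtree u \<inter> forest_vertices G = {}"
  shows "(\<Sum>C\<in>forest_cuts (add_mset u G). f C) =
         (\<Sum>D\<in>tree_cuts u. \<Sum>C\<in>forest_cuts G. f (D \<union> C))"
proof -
  have D: "(D \<union> C) \<inter> set_rtree u = D" "(D \<union> C) \<inter> forest_vertices G = C"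
    if "D \<in> tree_cuts u" "C \<in> forest_cuts G" for D C
    using that assms tree_cuts_subset[of D u] by (auto simp: forest_cuts_def)
  have E: "C \<inter> forest_vertices G \<inter> set_rtree w = C \<inter> set_rtree w" if "w \<in># G" for w C
    using set_rtree_subset_forest_vertices[OF that] by blast
  have "(\<Sum>C\<in>forest_cuts (add_mset u G). f C) =
        (\<Sum>(D, C)\<in>tree_cuts u \<times> forest_cuts G. f (D \<union> C))"
  proof (rule sum.reindex_bij_witness[where i = "\<lambda>(D, C). D \<union> C"
        and j = "\<lambda>C. (C \<inter> set_rtree u, C \<inter> forest_vertices G)"])
    fix C assume C: "C \<in> forest_cuts (add_mset u G)"
    then have eq: "C \<inter> set_rtree u \<union> C \<inter> forest_vertices G = C"
      by (auto simp: forest_cuts_def)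
    show "(case (C \<inter> set_rtree u, C \<inter> forest_vertices G) of (D, C) \<Rightarrow> D \<union> C) = C"
      using eq by simp
    show "(case (C \<inter> set_rtree u, C \<inter> forest_vertices G) of (D, C) \<Rightarrow> f (D \<union> C)) = f C"
      using eq by simp
    show "(C \<inter> set_rtree u, C \<inter> forest_vertices G) \<in> tree_cuts u \<times> forest_cuts G"
      using C by (auto simp: forest_cuts_def E)
  next
    fix DC assume "DC \<in> tree_cuts u \<times> forest_cuts G"
    then obtain D C where DC: "DC = (D, C)" "D \<in> tree_cuts u" "C \<in> forest_cuts G" by blast
    note DC' = D[OF DC(2,3)]
    show "((case DC of (D, C) \<Rightarrow> D \<union> C) \<inter> set_rtree u, (case DC of (D, C) \<Rightarrow> D \<union> C) \<inter> forest_vertices G) = DC"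
      using DC' DC by simp
    have "(D \<union> C) \<inter> set_rtree w = C \<inter> set_rtree w" if "w \<in># G" for w
      using E[OF that, of "D \<union> C"] DC' by simp
    then show "(case DC of (D, C) \<Rightarrow> D \<union> C) \<in> forest_cuts (add_mset u G)"
      using DC DC' tree_cuts_subset[of D u] by (auto simp: forest_cuts_def)
  qed
  then show ?thesis by (simp add: sum.cartesian_product)
qed

lemma basis_elem_empty_pair: "basis_elem ({#}, {#}) = 1"
  by (metis basis_elem_zero zero_prod_def)

text \<open>
  The coproduct of a tree by recursion: the full cut, and the grafting operator applied to the root
  parts of the coproduct of the branches, which makes the grafting operator a Hochschild cocycle.
\<close>

primrec ck_tree :: "wtree \<Rightarrow> (wforest \<times> wforest \<Rightarrow>\<^sub>0 'k::comm_ring_1)" where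
  "ck_tree (Node a F) = basis_elem ({#Node a F#}, {#}) +
     lin_ext (\<lambda>(P, R). basis_elem (P, {#Node a R#})) (prod_mset (image_mset ck_tree F))"

text \<open>
  A cut of a forest chooses a cut in each of its trees independently, so the sum over the cuts of the
  branches is a product. The choice \<open>{tree_root u}\<close> for a branch \<open>u\<close> produces the summand
  \<open>u \<otimes> 1\<close> of the coproduct of \<open>u\<close>.
\<close>

lemma ck_tree_representation:
  assumes "distinct_tree t"
  shows "basis_elem ({#map_rtree l t#}, {#}) +
     (\<Sum>C\<in>admissible_cuts t.
        basis_elem (image_mset (map_rtree l) (cut_off_part C t), {#map_rtree l (cut_root_part C t)#}))
     = (ck_tree (map_rtree l t) :: _ \<Rightarrow>\<^sub>0 'k::comm_ring_1)"
proof -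
  define P where "P t \<longleftrightarrow> basis_elem ({#map_rtree l t#}, {#}) +
     (\<Sum>C\<in>admissible_cuts t.
        basis_elem (image_mset (map_rtree l) (cut_off_part C t), {#map_rtree l (cut_root_part C t)#}))
     = (ck_tree (map_rtree l t) :: _ \<Rightarrow>\<^sub>0 'k::comm_ring_1)" for t
  define b where "b C G = (basis_elem (image_mset (map_rtree l) (cut_off_forest C G),
      image_mset (map_rtree l) (cut_root_forest C G)) :: _ \<Rightarrow>\<^sub>0 'k)" for C G
  define Q where "Q G \<longleftrightarrow> (\<Sum>C\<in>forest_cuts G. b C G) = (\<Prod>u\<in>#G. ck_tree (map_rtree l u))" for G
  have "P t"
  proof (rule distinct_tree_forest_induct(1)[of Q P, OF _ _ _ assms])
    fix v :: 'a and G assume "distinct_forest G" and v: "v \<notin> forest_vertices G" and "Q G"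
    have "(\<Sum>C\<in>forest_cuts G. basis_elem (image_mset (map_rtree l) (cut_off_forest C G),
            {#Node (l v) (image_mset (map_rtree l) (cut_root_forest C G))#}))
        = lin_ext (\<lambda>(P, R). basis_elem (P, {#Node (l v) R#})) (\<Sum>C\<in>forest_cuts G. b C G)"
      by (simp add: lin_ext_sum b_def)
    also have "\<dots> = lin_ext (\<lambda>(P, R). basis_elem (P, {#Node (l v) R#})) (\<Prod>u\<in>#G. ck_tree (map_rtree l u))"
      using \<open>Q G\<close> by (simp add: Q_def)
    finally show "P (Node v G)"
      by (simp add: P_def admissible_cuts_Node[OF v] cut_parts_Node multiset.map_comp comp_def
          del: cut_root_part.simps cut_off_part.simps)
  next
    have "forest_cuts ({#} :: 'a rtree multiset) = {{}}" by (auto simp: forest_cuts_def)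
    then show "Q {#}"
      by (simp add: Q_def b_def cut_off_forest_def cut_root_forest_def basis_elem_empty_pair)
  next
    fix u G assume disj: "set_rtree u \<inter> forest_vertices G = {}" and "P u" and "Q G"
    define c where "c D = (if tree_root u \<in> D then basis_elem ({#map_rtree l u#}, {#}) else
        basis_elem (image_mset (map_rtree l) (cut_off_part D u), {#map_rtree l (cut_root_part D u)#}) :: _ \<Rightarrow>\<^sub>0 'k)" for D
    have bc: "b (D \<union> C) (add_mset u G) = c D * b C G" if "D \<in> tree_cuts u" "C \<in> forest_cuts G" for D C
    proof -
      have "D \<subseteq> set_rtree u" "C \<subseteq> forest_vertices G"
        using that tree_cuts_subset by (auto simp: forest_cuts_def)
      then have *: "(D \<union> C) \<inter> forest_vertices G = C \<inter> forest_vertices G"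
          "(D \<union> C) \<inter> set_rtree u = D \<inter> set_rtree u"
        using disj by auto
      then have "tree_root u \<in> D \<union> C \<longleftrightarrow> tree_root u \<in> D"
        using tree_root_in_set_rtree[of u] by blast
      then show ?thesis
        using cut_forest_cong[OF *(1)] cut_parts_cong[OF *(2)]
        unfolding b_def c_def
        by (simp add: cut_off_forest_def cut_root_forest_def basis_elem_times del: Un_iff)
    qed
    have "{tree_root u} \<notin> admissible_cuts u" by (auto simp: admissible_cuts_def tree_edges_def)
    then have "(\<Sum>D\<in>tree_cuts u. c D) = c {tree_root u} + (\<Sum>D\<in>admissible_cuts u. c D)"
      using finite_tree_cuts(2)[of u] by (simp add: tree_cuts_def)
    also have "(\<Sum>D\<in>admissible_cuts u. c D) = (\<Sum>D\<in>admissible_cuts u.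
        basis_elem (image_mset (map_rtree l) (cut_off_part D u), {#map_rtree l (cut_root_part D u)#}))"
      by (intro sum.cong) (auto simp: c_def admissible_cuts_def tree_edges_def)
    also have "c {tree_root u} + \<dots> = ck_tree (map_rtree l u)"
      using \<open>P u\<close> by (simp add: c_def P_def)
    finally have c: "(\<Sum>D\<in>tree_cuts u. c D) = ck_tree (map_rtree l u)" .
    have "(\<Sum>C\<in>forest_cuts (add_mset u G). b C (add_mset u G)) = (\<Sum>D\<in>tree_cuts u. \<Sum>C\<in>forest_cuts G. c D * b C G)"
      unfolding sum_forest_cuts_add_mset[OF disj] by (intro sum.cong refl) (simp add: bc)
    also have "\<dots> = (\<Sum>D\<in>tree_cuts u. c D) * (\<Sum>C\<in>forest_cuts G. b C G)"
      by (simp add: sum_product)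
    finally show "Q (add_mset u G)" using \<open>Q G\<close> c by (simp add: Q_def)
  qed
  then show ?thesis by (simp add: P_def)
qed

lemma ck_comult_tree_eq: "ck_comult_tree T = ck_tree T"
proof -
  obtain t l where "representative T = (t, l)" "distinct_tree t" "map_rtree l t = T"
    by (rule representativeE)
  then show ?thesis using ck_tree_representation[of t l] by (simp add: ck_comult_tree_def)
qed

section \<open>Automorphisms\<close>

definition multiplicity_factorial :: "'a multiset \<Rightarrow> nat" where
  "multiplicity_factorial F = (\<Prod>x\<in>set_mset F. fact (count F x))"

lemma multiplicity_factorial_empty [simp]: "multiplicity_factorial {#} = 1"
  by (simp add: multiplicity_factorial_def)

lemma multiplicity_factorial_add_mset:
  "multiplicity_factorial (add_mset u F) = Suc (count F u) * multiplicity_factorial F"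
proof -
  let ?A = "insert u (set_mset F)"
  have "multiplicity_factorial F = (\<Prod>x\<in>?A. fact (count F x))"
    unfolding multiplicity_factorial_def
    by (rule prod.mono_neutral_left) (auto simp: not_in_iff)
  also have "\<dots> = fact (count F u) * (\<Prod>x\<in>?A - {u}. fact (count F x))"
    by (rule prod.remove) auto
  finally have *: "multiplicity_factorial F = fact (count F u) * (\<Prod>x\<in>?A - {u}. fact (count F x))" .
  have "multiplicity_factorial (add_mset u F) = (\<Prod>x\<in>?A. fact (count (add_mset u F) x))"
    by (simp add: multiplicity_factorial_def)
  also have "\<dots> = fact (count (add_mset u F) u) * (\<Prod>x\<in>?A - {u}. fact (count (add_mset u F) x))"
    by (rule prod.remove) auto
  also have "(\<Prod>x\<in>?A - {u}. fact (count (add_mset u F) x)) = (\<Prod>x\<in>?A - {u}. fact (count F x) :: nat)"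
    by (rule prod.cong) auto
  finally show ?thesis using * by (simp add: algebra_simps)
qed

lemma multiplicity_factorial_pos: "multiplicity_factorial F > 0"
  by (auto simp: multiplicity_factorial_def intro: prod_pos)

text \<open>
  An automorphism permutes isomorphic branches and acts on each branch.
\<close>

primrec tree_aut :: "'a rtree \<Rightarrow> nat" where
  "tree_aut (Node a F) = multiplicity_factorial F * (\<Prod>u\<in>#F. tree_aut u)"

definition forest_aut :: "'a rtree multiset \<Rightarrow> nat" where
  "forest_aut F = multiplicity_factorial F * (\<Prod>u\<in>#F. tree_aut u)"

lemma tree_aut_Node: "tree_aut (Node a F) = forest_aut F"
  by (simp add: forest_aut_def)

lemma forest_aut_empty [simp]: "forest_aut {#} = 1"
  by (simp add: forest_aut_def)

lemma forest_aut_add_mset: "forest_aut (add_mset u F) = Suc (count F u) * tree_aut u * forest_aut F"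
  by (simp add: forest_aut_def multiplicity_factorial_add_mset algebra_simps)

text \<open>
  Isomorphisms between representatives of possibly different labeled trees. This generality is needed
  for the induction, where a branch may be mapped to any isomorphic branch.
\<close>

definition tree_isos :: "('a \<Rightarrow> 'c) \<Rightarrow> 'a rtree \<Rightarrow> ('b \<Rightarrow> 'c) \<Rightarrow> 'b rtree \<Rightarrow> ('a \<Rightarrow> 'b) set" where
  "tree_isos l t l' t' = {f \<in> set_rtree t \<rightarrow>\<^sub>E set_rtree t'. map_rtree f t = t' \<and> (\<forall>v\<in>set_rtree t. l' (f v) = l v)}"

definition forest_isos ::
    "('a \<Rightarrow> 'c) \<Rightarrow> 'a rtree multiset \<Rightarrow> ('b \<Rightarrow> 'c) \<Rightarrow> 'b rtree multiset \<Rightarrow> ('a \<Rightarrow> 'b) set" where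
  "forest_isos l G l' G' = {f \<in> forest_vertices G \<rightarrow>\<^sub>E forest_vertices G'.
     image_mset (map_rtree f) G = G' \<and> (\<forall>v\<in>forest_vertices G. l' (f v) = l v)}"

lemma finite_isos [simp]: "finite (tree_isos l t l' t')" "finite (forest_isos l G l' G')"
proof -
  show "finite (tree_isos l t l' t')"
    by (rule finite_subset[of _ "set_rtree t \<rightarrow>\<^sub>E set_rtree t'"]) (auto simp: tree_isos_def finite_PiE)
  show "finite (forest_isos l G l' G')"
    by (rule finite_subset[of _ "forest_vertices G \<rightarrow>\<^sub>E forest_vertices G'"])
      (auto simp: forest_isos_def finite_PiE)
qed

lemma card_tree_isos_Node:
  assumes "v \<notin> forest_vertices G" "v' \<notin> forest_vertices G'"
  shows "card (tree_isos l (Node v G) l' (Node v' G')) =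
         (if l v = l' v' then card (forest_isos l G l' G') else 0)"
proof (cases "l v = l' v'")
  case False
  then have "tree_isos l (Node v G) l' (Node v' G') = {}" by (auto simp: tree_isos_def)
  then show ?thesis using False by simp
next
  case True
  have "bij_betw (\<lambda>f. f(v := v')) (forest_isos l G l' G') (tree_isos l (Node v G) l' (Node v' G'))"
  proof (rule bij_betw_byWitness[where f' = "\<lambda>f. f(v := undefined)"])
    show "\<forall>f\<in>forest_isos l G l' G'. (f(v := v'))(v := undefined) = f"
      using assms(1) by (auto simp: forest_isos_def PiE_def extensional_def)
    show "\<forall>f\<in>tree_isos l (Node v G) l' (Node v' G'). (f(v := undefined))(v := v') = f"
      by (auto simp: tree_isos_def)
    show "(\<lambda>f. f(v := v')) ` forest_isos l G l' G' \<subseteq> tree_isos l (Node v G) l' (Node v' G')"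
    proof safe
      fix f assume f: "f \<in> forest_isos l G l' G'"
      have "image_mset (map_rtree (f(v := v'))) G = image_mset (map_rtree f) G"
        by (rule image_map_rtree_cong_set) (use assms in auto)
      moreover have "f(v := v') \<in> set_rtree (Node v G) \<rightarrow>\<^sub>E set_rtree (Node v' G')"
        using f unfolding set_rtree_Node by (auto simp: forest_isos_def PiE_def Pi_def extensional_def)
      moreover have "\<forall>w\<in>set_rtree (Node v G). l' ((f(v := v')) w) = l w"
        using f True unfolding set_rtree_Node by (auto simp: forest_isos_def)
      ultimately show "f(v := v') \<in> tree_isos l (Node v G) l' (Node v' G')"
        using f by (simp add: tree_isos_def forest_isos_def del: rtree.set)
    qed
    show "(\<lambda>f. f(v := undefined)) ` tree_isos l (Node v G) l' (Node v' G') \<subseteq> forest_isos l G l' G'"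
    proof safe
      fix f assume f: "f \<in> tree_isos l (Node v G) l' (Node v' G')"
      have 1: "image_mset (map_rtree (f(v := undefined))) G = image_mset (map_rtree f) G"
        by (rule image_map_rtree_cong_set) (use assms in auto)
      have 2: "image_mset (map_rtree f) G = G'" using f by (simp add: tree_isos_def)
      have "f ` forest_vertices G = forest_vertices G'"
        unfolding 2[symmetric] forest_vertices_image_mset_map_rtree ..
      moreover have "f \<in> extensional (insert v (forest_vertices G))"
        using f by (simp add: tree_isos_def PiE_def set_rtree_Node del: rtree.set)
      ultimately have "f(v := undefined) \<in> forest_vertices G \<rightarrow>\<^sub>E forest_vertices G'"
        using assms(1) by (auto simp: PiE_def Pi_def extensional_def)
      moreover have "\<forall>w\<in>forest_vertices G. l' ((f(v := undefined)) w) = l w"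
        using f assms(1) by (auto simp: tree_isos_def set_rtree_Node simp del: rtree.set)
      ultimately show "f(v := undefined) \<in> forest_isos l G l' G'"
        using 1 2 by (simp add: forest_isos_def)
    qed
  qed
  then show ?thesis using True by (simp add: bij_betw_same_card)
qed

lemma distinct_forest_remove:
  assumes "distinct_forest G" "u \<in># G"
  shows "distinct_tree u" "distinct_forest (G - {#u#})"
    "set_rtree u \<inter> forest_vertices (G - {#u#}) = {}"
  using assms distinct_forest_add_mset[of u "G - {#u#}"] by auto

lemma distinct_forest_count:
  assumes "distinct_forest G" "u \<in># G"
  shows "count G u = 1"
proof -
  have "u \<notin># G - {#u#}"
    using distinct_forest_remove(3)[OF assms] set_rtree_subset_forest_vertices[of u "G - {#u#}"]
      tree_root_in_set_rtree[of u] by blast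
  then have "\<not> 1 < count G u" by (simp add: in_diff_count)
  moreover have "0 < count G u" using assms(2) by simp
  ultimately show ?thesis by linarith
qed

text \<open>
  An isomorphism sends the tree \<open>u\<close> to some tree of \<open>G'\<close> and the others to the remaining ones.
\<close>

lemma card_forest_isos_add_mset:
  assumes disj: "set_rtree u \<inter> forest_vertices G = {}" and G': "distinct_forest G'"
  shows "card (forest_isos l (add_mset u G) l' G') =
    (\<Sum>u'\<in>set_mset G'. card (tree_isos l u l' u') * card (forest_isos l G l' (G' - {#u'#})))"
proof -
  define S where "S u' = {f \<in> forest_isos l (add_mset u G) l' G'. map_rtree f u = u'}" for u'
  have "forest_isos l (add_mset u G) l' G' = (\<Union>u'\<in>set_mset G'. S u')"
    by (auto simp: S_def forest_isos_def)
  then have "card (forest_isos l (add_mset u G) l' G') = card (\<Union>u'\<in>set_mset G'. S u')"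
    by simp
  also have "\<dots> = (\<Sum>u'\<in>set_mset G'. card (S u'))"
    by (rule card_UN_disjoint) (auto simp: S_def)
  finally have sum_S: "card (forest_isos l (add_mset u G) l' G') = (\<Sum>u'\<in>set_mset G'. card (S u'))" .
  have card_S: "card (S u') = card (tree_isos l u l' u' \<times> forest_isos l G l' (G' - {#u'#}))"
    if u': "u' \<in># G'" for u'
  proof -
    define G0 where "G0 = G' - {#u'#}"
    have G'_eq: "G' = add_mset u' G0" using u' by (simp add: G0_def)
    let ?m = "\<lambda>(f, g) x. if x \<in> set_rtree u then f x else g x"
    have "bij_betw ?m (tree_isos l u l' u' \<times> forest_isos l G l' G0) (S u')"
    proof (rule bij_betw_byWitness[where
          f' = "\<lambda>f. (restrict f (set_rtree u), restrict f (forest_vertices G))"])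
      show "\<forall>fg\<in>tree_isos l u l' u' \<times> forest_isos l G l' G0.
          (restrict (?m fg) (set_rtree u), restrict (?m fg) (forest_vertices G)) = fg"
      proof
        fix p assume "p \<in> tree_isos l u l' u' \<times> forest_isos l G l' G0"
        then obtain f g where p: "p = (f, g)"
          and fg: "f \<in> tree_isos l u l' u'" "g \<in> forest_isos l G l' G0" by blast
        have "restrict (?m (f, g)) (set_rtree u) = f"
          using fg by (auto simp: tree_isos_def PiE_def extensional_def restrict_def)
        moreover have "restrict (?m (f, g)) (forest_vertices G) = g"
          using fg disj by (fastforce simp: forest_isos_def PiE_def extensional_def restrict_def)
        ultimately show "(restrict (?m p) (set_rtree u), restrict (?m p) (forest_vertices G)) = p"
          by (simp only: p)
      qed
      show "\<forall>f\<in>S u'. ?m (restrict f (set_rtree u), restrict f (forest_vertices G)) = f"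
        by (fastforce simp: S_def forest_isos_def PiE_def extensional_def restrict_def)
      show "?m ` (tree_isos l u l' u' \<times> forest_isos l G l' G0) \<subseteq> S u'"
      proof (rule image_subsetI)
        fix p assume "p \<in> tree_isos l u l' u' \<times> forest_isos l G l' G0"
        then obtain f g where p: "p = (f, g)"
          and fg: "f \<in> tree_isos l u l' u'" "g \<in> forest_isos l G l' G0" by blast
        let ?h = "?m (f, g)"
        have h: "?h x = f x" if "x \<in> set_rtree u" for x using that by simp
        have h': "?h x = g x" if "x \<in> forest_vertices G" for x using that disj by auto
        have "map_rtree ?h u = map_rtree f u" by (rule map_rtree_cong_set) (rule h)
        then have 1: "map_rtree ?h u = u'" using fg by (simp add: tree_isos_def)
        have "image_mset (map_rtree ?h) G = image_mset (map_rtree g) G"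
          by (rule image_map_rtree_cong_set) (rule h')
        then have 2: "image_mset (map_rtree ?h) G = G0" using fg by (simp add: forest_isos_def)
        have 3: "?h \<in> forest_vertices (add_mset u G) \<rightarrow>\<^sub>E forest_vertices G'"
          using fg unfolding G'_eq by (auto simp: tree_isos_def forest_isos_def PiE_def Pi_def extensional_def)
        have 4: "l' (?h v) = l v" if "v \<in> forest_vertices (add_mset u G)" for v
          using that fg h[of v] h'[of v] by (auto simp: tree_isos_def forest_isos_def)
        have "?h \<in> S u'" unfolding S_def forest_isos_def using 1 2 3 4 G'_eq by simp
        then show "?m p \<in> S u'" by (simp only: p)
      qed
      show "(\<lambda>f. (restrict f (set_rtree u), restrict f (forest_vertices G))) ` S u' \<subseteq>
          tree_isos l u l' u' \<times> forest_isos l G l' G0"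
      proof safe
        fix f assume f: "f \<in> S u'"
        have "map_rtree (restrict f (set_rtree u)) u = map_rtree f u"
          by (rule map_rtree_cong_set) simp
        then have 1: "map_rtree (restrict f (set_rtree u)) u = u'" using f by (simp add: S_def)
        have "image_mset (map_rtree (restrict f (forest_vertices G))) G = image_mset (map_rtree f) G"
          by (rule image_map_rtree_cong_set) simp
        also have f2: "\<dots> = G0" using f G'_eq by (auto simp: S_def forest_isos_def)
        finally have 2: "image_mset (map_rtree (restrict f (forest_vertices G))) G = G0" .
        have "f ` set_rtree u = set_rtree u'" using f by (auto simp: S_def rtree.set_map)
        then have 3: "restrict f (set_rtree u) \<in> set_rtree u \<rightarrow>\<^sub>E set_rtree u'" by auto
        have "f ` forest_vertices G = forest_vertices G0"
          unfolding f2[symmetric] forest_vertices_image_mset_map_rtree ..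
        then have 4: "restrict f (forest_vertices G) \<in> forest_vertices G \<rightarrow>\<^sub>E forest_vertices G0" by auto
        have 5: "l' (f v) = l v" if "v \<in> set_rtree u \<union> forest_vertices G" for v
          using f that by (simp add: S_def forest_isos_def)
        show "restrict f (set_rtree u) \<in> tree_isos l u l' u'"
          using 1 3 5 by (simp add: tree_isos_def)
        show "restrict f (forest_vertices G) \<in> forest_isos l G l' G0"
          using 2 4 5 by (simp add: forest_isos_def)
      qed
    qed
    then show ?thesis by (simp add: bij_betw_same_card G0_def)
  qed
  show ?thesis unfolding sum_S by (rule sum.cong) (simp_all add: card_S card_cartesian_product)
qed

text \<open>
  The number of trees in \<open>G'\<close> to which \<open>u\<close> can be sent is the multiplicity of the isomorphism class of
  \<open>u\<close>, which is the factor in \<open>forest_aut_add_mset\<close>.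
\<close>

lemma card_tree_isos:
  assumes "distinct_tree t" "distinct_tree t'"
  shows "card (tree_isos l t l' t') = (if map_rtree l t = map_rtree l' t' then tree_aut (map_rtree l t) else 0)"
proof -
  define P where "P t \<longleftrightarrow> (\<forall>t'. distinct_tree t' \<longrightarrow>
    card (tree_isos l t l' t') = (if map_rtree l t = map_rtree l' t' then tree_aut (map_rtree l t) else 0))" for t
  define im where "im G = image_mset (map_rtree l) G" for G
  define im' where "im' G = image_mset (map_rtree l') G" for G
  define Q where "Q G \<longleftrightarrow> (\<forall>G'. distinct_forest G' \<longrightarrow>
    card (forest_isos l G l' G') = (if im G = im' G' then forest_aut (im G) else 0))" for G
  have "P t"
  proof (rule distinct_tree_forest_induct(1)[of Q P, OF _ _ _ assms(1)])
    fix v G assume G: "distinct_forest G" "v \<notin> forest_vertices G" "Q G"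
    show "P (Node v G)"
      unfolding P_def
    proof (intro allI impI)
      fix t' :: "'b rtree" assume t': "distinct_tree t'"
      obtain v' G' where "t' = Node v' G'" by (cases t')
      with t' G show "card (tree_isos l (Node v G) l' t') =
          (if map_rtree l (Node v G) = map_rtree l' t' then tree_aut (map_rtree l (Node v G)) else 0)"
        by (simp add: card_tree_isos_Node distinct_tree_Node Q_def im_def im'_def tree_aut_Node del: tree_aut.simps)
    qed
  next
    have "forest_isos l {#} l' {#} = {\<lambda>_. undefined}" by (auto simp: forest_isos_def)
    moreover have "forest_isos l {#} l' G' = {}" if "G' \<noteq> {#}" for G'
      using that by (auto simp: forest_isos_def)
    ultimately show "Q {#}" by (auto simp: Q_def im_def im'_def)
  next
    fix u G assume u: "set_rtree u \<inter> forest_vertices G = {}" "P u" "Q G"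
    show "Q (add_mset u G)"
      unfolding Q_def
    proof (intro allI impI)
      fix G' :: "'b rtree multiset" assume G': "distinct_forest G'"
      have summand: "card (tree_isos l u l' u') * card (forest_isos l G l' (G' - {#u'#})) =
         (if map_rtree l' u' = map_rtree l u \<and> im (add_mset u G) = im' G'
          then tree_aut (map_rtree l u) * forest_aut (im G) else 0)" if u': "u' \<in># G'" for u'
      proof -
        define G0 where "G0 = G' - {#u'#}"
        have "im' G' = add_mset (map_rtree l' u') (im' G0)"
          using u' by (metis G0_def im'_def image_mset_add_mset insert_DiffM)
        moreover have "card (tree_isos l u l' u') =
            (if map_rtree l u = map_rtree l' u' then tree_aut (map_rtree l u) else 0)"
          using u distinct_forest_remove[OF G' u'] by (simp add: P_def)
        moreover have "card (forest_isos l G l' G0) = (if im G = im' G0 then forest_aut (im G) else 0)"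
          using u distinct_forest_remove[OF G' u'] by (simp add: Q_def G0_def)
        moreover have "im (add_mset u G) = add_mset (map_rtree l u) (im G)" by (simp add: im_def)
        ultimately show ?thesis
          unfolding G0_def[symmetric]
          by (cases "map_rtree l u = map_rtree l' u'"; cases "im G = im' G0") simp_all
      qed
      have "card (forest_isos l (add_mset u G) l' G') =
        (\<Sum>u'\<in>set_mset G'. if map_rtree l' u' = map_rtree l u \<and> im (add_mset u G) = im' G'
          then tree_aut (map_rtree l u) * forest_aut (im G) else 0)"
        unfolding card_forest_isos_add_mset[OF u(1) G'] by (rule sum.cong) (use summand in auto)
      also have "\<dots> = (if im (add_mset u G) = im' G' then forest_aut (im (add_mset u G)) else 0)"
      proof (cases "im (add_mset u G) = im' G'")
        case True
        have "(\<Sum>u'\<in>set_mset G'. if map_rtree l' u' = map_rtree l u \<and> im (add_mset u G) = im' G'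
          then tree_aut (map_rtree l u) * forest_aut (im G) else 0) =
          (\<Sum>u'\<in>{u' \<in> set_mset G'. map_rtree l' u' = map_rtree l u}. tree_aut (map_rtree l u) * forest_aut (im G))"
          by (subst sum.inter_filter) (use True in auto)
        also have "\<dots> = card {u' \<in> set_mset G'. map_rtree l' u' = map_rtree l u} * tree_aut (map_rtree l u) * forest_aut (im G)"
          by simp
        also have "card {u' \<in> set_mset G'. map_rtree l' u' = map_rtree l u} =
            (\<Sum>u'\<in>{u' \<in> set_mset G'. map_rtree l' u' = map_rtree l u}. count G' u')"
          using distinct_forest_count[OF G'] by simp
        also have "\<dots> = count (im' G') (map_rtree l u)"
          unfolding im'_def count_image_mset by (rule sum.cong) auto
        also have "\<dots> = Suc (count (im G) (map_rtree l u))"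
          unfolding True[symmetric] by (simp add: im_def)
        also have "\<dots> * tree_aut (map_rtree l u) * forest_aut (im G) = forest_aut (im (add_mset u G))"
          by (simp add: im_def forest_aut_add_mset)
        finally show ?thesis by (simp add: True)
      qed simp
      finally show "card (forest_isos l (add_mset u G) l' G') =
        (if im (add_mset u G) = im' G' then forest_aut (im (add_mset u G)) else 0)" .
    qed
  qed
  then show ?thesis using assms(2) by (simp add: P_def)
qed

lemma num_automorphisms_eq_tree_aut: "num_automorphisms T = tree_aut T"
proof -
  obtain t l where t: "representative T = (t, l)" "distinct_tree t" "map_rtree l t = T"
    by (rule representativeE)
  let ?A = "{f. f permutes set_rtree t \<and> map_rtree f t = t \<and> (\<forall>v\<in>set_rtree t. l (f v) = l v)}"
  have "bij_betw (\<lambda>f. restrict f (set_rtree t)) ?A (tree_isos l t l t)"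
  proof (rule bij_betw_byWitness[where f' = "\<lambda>f x. if x \<in> set_rtree t then f x else x"])
    show "\<forall>f\<in>?A. (\<lambda>x. if x \<in> set_rtree t then restrict f (set_rtree t) x else x) = f"
      by (auto simp: permutes_def)
    show "\<forall>f\<in>tree_isos l t l t. restrict (\<lambda>x. if x \<in> set_rtree t then f x else x) (set_rtree t) = f"
      by (auto simp: tree_isos_def PiE_def extensional_def restrict_def)
    show "(\<lambda>f. restrict f (set_rtree t)) ` ?A \<subseteq> tree_isos l t l t"
    proof safe
      fix f assume f: "f permutes set_rtree t" "map_rtree f t = t" "\<forall>v\<in>set_rtree t. l (f v) = l v"
      have "map_rtree (restrict f (set_rtree t)) t = map_rtree f t"
        by (rule map_rtree_cong_set) simp
      then show "restrict f (set_rtree t) \<in> tree_isos l t l t"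
        using f by (auto simp: tree_isos_def permutes_in_image)
    qed
    show "(\<lambda>f x. if x \<in> set_rtree t then f x else x) ` tree_isos l t l t \<subseteq> ?A"
    proof safe
      fix f assume f: "f \<in> tree_isos l t l t"
      let ?g = "\<lambda>x. if x \<in> set_rtree t then f x else x"
      have "map_rtree ?g t = map_rtree f t"
        by (rule map_rtree_cong_set) simp
      then show g: "map_rtree ?g t = t" using f by (simp add: tree_isos_def)
      have "?g ` set_rtree t = set_rtree t" by (metis g rtree.set_map)
      then have "bij_betw ?g (set_rtree t) (set_rtree t)"
        by (simp add: bij_betw_def eq_card_imp_inj_on)
      then show "?g permutes set_rtree t" by (rule bij_imp_permutes) auto
      fix v assume "v \<in> set_rtree t"
      then show "l (?g v) = l v" using f by (auto simp: tree_isos_def)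
    qed
  qed
  then have "card ?A = card (tree_isos l t l t)" by (rule bij_betw_same_card)
  then show ?thesis using card_tree_isos[OF t(2) t(2), of l l] t by (simp add: num_automorphisms_def)
qed

section \<open>Grafting\<close>

lemma sum_PiE_insert:
  assumes "v \<notin> B"
  shows "(\<Sum>h\<in>insert v B \<rightarrow>\<^sub>E L. F h) = (\<Sum>P\<in>L. \<Sum>h\<in>B \<rightarrow>\<^sub>E L. F (h(v := P)))"
proof -
  have "(\<Sum>h\<in>insert v B \<rightarrow>\<^sub>E L. F h) = (\<Sum>(P, h)\<in>L \<times> (B \<rightarrow>\<^sub>E L). F (h(v := P)))"
    unfolding PiE_insert_eq using inj_combinator[OF assms, of "\<lambda>_. L"]
    by (subst sum.reindex) (auto simp: case_prod_unfold)
  then show ?thesis by (simp add: sum.cartesian_product)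
qed

lemma sum_PiE_Un:
  assumes "A \<inter> B = {}"
  shows "(\<Sum>h\<in>A \<union> B \<rightarrow>\<^sub>E L. F h) =
    (\<Sum>f\<in>A \<rightarrow>\<^sub>E L. \<Sum>g\<in>B \<rightarrow>\<^sub>E L. F (\<lambda>x. if x \<in> A then f x else g x))"
proof -
  have "(\<Sum>h\<in>A \<union> B \<rightarrow>\<^sub>E L. F h) =
      (\<Sum>p\<in>(A \<rightarrow>\<^sub>E L) \<times> (B \<rightarrow>\<^sub>E L). F (\<lambda>x. if x \<in> A then fst p x else snd p x))"
  proof (rule sum.reindex_bij_witness[where j = "\<lambda>h. (restrict h A, restrict h B)"
        and i = "\<lambda>p x. if x \<in> A then fst p x else snd p x"])
    fix h assume h: "h \<in> A \<union> B \<rightarrow>\<^sub>E L"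
    show eq: "(\<lambda>x. if x \<in> A then fst (restrict h A, restrict h B) x else snd (restrict h A, restrict h B) x) = h"
      using h by (auto simp: PiE_def extensional_def restrict_def)
    show "(restrict h A, restrict h B) \<in> (A \<rightarrow>\<^sub>E L) \<times> (B \<rightarrow>\<^sub>E L)" using h by auto
    show "F (\<lambda>x. if x \<in> A then fst (restrict h A, restrict h B) x else snd (restrict h A, restrict h B) x) = F h"
      using eq by simp
  next
    fix p assume "p \<in> (A \<rightarrow>\<^sub>E L) \<times> (B \<rightarrow>\<^sub>E L)"
    then obtain f g where p: "p = (f, g)" and fg: "f \<in> A \<rightarrow>\<^sub>E L" "g \<in> B \<rightarrow>\<^sub>E L" by blast
    have "restrict (\<lambda>x. if x \<in> A then f x else g x) A = f"
      using fg by (auto simp: PiE_def extensional_def restrict_def)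
    moreover have "restrict (\<lambda>x. if x \<in> A then f x else g x) B = g"
      using fg assms by (fastforce simp: PiE_def extensional_def restrict_def)
    ultimately show "(restrict (\<lambda>x. if x \<in> A then fst p x else snd p x) A,
        restrict (\<lambda>x. if x \<in> A then fst p x else snd p x) B) = p"
      by (simp only: p fst_conv snd_conv)
    show "(\<lambda>x. if x \<in> A then fst p x else snd p x) \<in> A \<union> B \<rightarrow>\<^sub>E L"
      using fg by (auto simp: p PiE_def extensional_def)
  qed
  then show ?thesis by (simp add: sum.cartesian_product case_prod_unfold)
qed

lemma graft_cong: "(\<And>v. v \<in> set_rtree t \<Longrightarrow> h v = h' v) \<Longrightarrow> graft h l t = graft h' l t"
proof (induction t)
  case (Node v G)
  have "image_mset (graft h l) G = image_mset (graft h' l) G"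
    by (rule image_mset_cong) (use Node in auto)
  then show ?case using Node.prems by simp
qed

lemma image_graft_cong:
  "(\<And>v. v \<in> forest_vertices G \<Longrightarrow> h v = h' v) \<Longrightarrow> image_mset (graft h l) G = image_mset (graft h' l) G"
  by (rule image_mset_cong, rule graft_cong) (auto simp: forest_vertices_def)

lemma weight_Node: "weight (Node a F) = a + forest_weight F"
  by (simp add: forest_weight_def)

lemma forest_weight_simps [simp]:
  "forest_weight {#} = 0"
  "forest_weight (add_mset T F) = weight T + forest_weight F"
  "forest_weight (F + F') = forest_weight F + forest_weight F'"
  by (simp_all add: forest_weight_def)

lemma weight_graft:
  assumes "distinct_tree t"
  shows "weight (graft h l t) = weight (map_rtree l t) + (\<Sum>v\<in>set_rtree t. forest_weight (h v))"
proof (rule distinct_tree_forest_induct(1)[where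
      Q = "\<lambda>G. forest_weight (image_mset (graft h l) G) =
        forest_weight (image_mset (map_rtree l) G) + (\<Sum>v\<in>forest_vertices G. forest_weight (h v))",
      OF _ _ _ assms])
  fix v G assume "v \<notin> forest_vertices G"
    "forest_weight (image_mset (graft h l) G) =
        forest_weight (image_mset (map_rtree l) G) + (\<Sum>v\<in>forest_vertices G. forest_weight (h v))"
  then show "weight (graft h l (Node v G)) =
      weight (map_rtree l (Node v G)) + (\<Sum>v\<in>set_rtree (Node v G). forest_weight (h v))"
    by (simp add: weight_Node set_rtree_Node del: weight.simps rtree.set)
qed (simp_all add: sum.union_disjoint)

text \<open>
  The sum of all trees obtained by attaching to each vertex of the given tree some forest from \<open>L\<close>,
  weighted by the product of the weights \<open>\<omega>\<close> of these forests. The results are kept as one-element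
  forests: then the branches at a vertex and the newly attached forest can be multiplied in the
  monoid algebra of forests.
\<close>

primrec graft_sum ::
    "wforest set \<Rightarrow> (wforest \<Rightarrow> 'k) \<Rightarrow> wtree \<Rightarrow> (wforest \<Rightarrow>\<^sub>0 'k::comm_ring_1)" where
  "graft_sum L \<omega> (Node a R) = lin_ext (\<lambda>F. basis_elem {#Node a F#})
     ((\<Sum>P\<in>L. scal (\<omega> P) (basis_elem P)) * (\<Prod>s\<in>#R. graft_sum L \<omega> s))"

text \<open>
  Choosing the attached forest independently for each vertex amounts to a sum over all functions \<open>h\<close>
  from the vertices to \<open>L\<close>; on disjoint sets of vertices the functions can be chosen separately.
\<close>

lemma graft_sum_representation:
  fixes \<omega> :: "wforest \<Rightarrow> 'k::comm_ring_1"
  assumes "distinct_tree t"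
  shows "graft_sum L \<omega> (map_rtree l t) =
    (\<Sum>h\<in>set_rtree t \<rightarrow>\<^sub>E L. scal (\<Prod>v\<in>set_rtree t. \<omega> (h v)) (basis_elem {#graft h l t#}))"
proof (rule distinct_tree_forest_induct(1)[where
      Q = "\<lambda>G. (\<Prod>u\<in>#G. graft_sum L \<omega> (map_rtree l u)) =
        (\<Sum>h\<in>forest_vertices G \<rightarrow>\<^sub>E L.
           scal (\<Prod>v\<in>forest_vertices G. \<omega> (h v)) (basis_elem (image_mset (graft h l) G)))",
      OF _ _ _ assms])
  fix v G
  assume v: "v \<notin> forest_vertices G"
    and IH: "(\<Prod>u\<in>#G. graft_sum L \<omega> (map_rtree l u)) =
        (\<Sum>h\<in>forest_vertices G \<rightarrow>\<^sub>E L.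
           scal (\<Prod>v\<in>forest_vertices G. \<omega> (h v)) (basis_elem (image_mset (graft h l) G)))"
  let ?S = "forest_vertices G"
  have upd: "scal (\<Prod>w\<in>insert v ?S. \<omega> ((h(v := P)) w)) (basis_elem {#graft (h(v := P)) l (Node v G)#}) =
     scal (\<omega> P * (\<Prod>w\<in>?S. \<omega> (h w))) (basis_elem {#Node (l v) (P + image_mset (graft h l) G)#})" for h P
  proof -
    have "(\<Prod>w\<in>?S. \<omega> ((h(v := P)) w)) = (\<Prod>w\<in>?S. \<omega> (h w))"
      by (rule prod.cong) (use v in auto)
    moreover have "image_mset (graft (h(v := P)) l) G = image_mset (graft h l) G"
      by (rule image_graft_cong) (use v in auto)
    ultimately show ?thesis using v by (simp add: add.commute)
  qed
  have "graft_sum L \<omega> (map_rtree l (Node v G)) = lin_ext (\<lambda>F. basis_elem {#Node (l v) F#})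
     ((\<Sum>P\<in>L. scal (\<omega> P) (basis_elem P)) * (\<Prod>u\<in>#G. graft_sum L \<omega> (map_rtree l u)))"
    by (simp add: multiset.map_comp comp_def)
  also have "\<dots> = (\<Sum>P\<in>L. \<Sum>h\<in>?S \<rightarrow>\<^sub>E L. scal (\<omega> P * (\<Prod>w\<in>?S. \<omega> (h w)))
      (basis_elem {#Node (l v) (P + image_mset (graft h l) G)#}))"
    by (simp add: IH sum_product lin_ext_sum lin_ext_scal scal_times basis_elem_times)
  also have "\<dots> = (\<Sum>h\<in>insert v ?S \<rightarrow>\<^sub>E L.
      scal (\<Prod>w\<in>insert v ?S. \<omega> (h w)) (basis_elem {#graft h l (Node v G)#}))"
    unfolding sum_PiE_insert[OF v] upd ..
  finally show "graft_sum L \<omega> (map_rtree l (Node v G)) =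
    (\<Sum>h\<in>set_rtree (Node v G) \<rightarrow>\<^sub>E L.
      scal (\<Prod>w\<in>set_rtree (Node v G). \<omega> (h w)) (basis_elem {#graft h l (Node v G)#}))"
    unfolding set_rtree_Node .
next
  show "(\<Prod>u\<in>#{#}. graft_sum L \<omega> (map_rtree l u)) =
        (\<Sum>h\<in>forest_vertices {#} \<rightarrow>\<^sub>E L.
           scal (\<Prod>v\<in>forest_vertices {#}. \<omega> (h v)) (basis_elem (image_mset (graft h l) {#})))"
    by (simp add: basis_elem_zero)
next
  fix u G
  assume disj: "set_rtree u \<inter> forest_vertices G = {}"
    and u: "graft_sum L \<omega> (map_rtree l u) =
    (\<Sum>h\<in>set_rtree u \<rightarrow>\<^sub>E L. scal (\<Prod>v\<in>set_rtree u. \<omega> (h v)) (basis_elem {#graft h l u#}))"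
    and G: "(\<Prod>u\<in>#G. graft_sum L \<omega> (map_rtree l u)) =
        (\<Sum>h\<in>forest_vertices G \<rightarrow>\<^sub>E L.
           scal (\<Prod>v\<in>forest_vertices G. \<omega> (h v)) (basis_elem (image_mset (graft h l) G)))"
  let ?A = "set_rtree u" and ?B = "forest_vertices G"
  have upd: "scal (\<Prod>v\<in>?A \<union> ?B. \<omega> (if v \<in> ?A then f v else g v))
      (basis_elem (image_mset (graft (\<lambda>v. if v \<in> ?A then f v else g v) l) (add_mset u G))) =
     scal ((\<Prod>v\<in>?A. \<omega> (f v)) * (\<Prod>v\<in>?B. \<omega> (g v)))
      (basis_elem ({#graft f l u#} + image_mset (graft g l) G))" for f g
  proof -
    let ?h = "\<lambda>v. if v \<in> ?A then f v else g v"
    have "(\<Prod>v\<in>?B. \<omega> (?h v)) = (\<Prod>v\<in>?B. \<omega> (g v))"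
      by (rule prod.cong) (use disj in auto)
    moreover have "(\<Prod>v\<in>?A. \<omega> (?h v)) = (\<Prod>v\<in>?A. \<omega> (f v))"
      by (rule prod.cong) auto
    moreover have "graft ?h l u = graft f l u" by (rule graft_cong) simp
    moreover have "image_mset (graft ?h l) G = image_mset (graft g l) G"
      by (rule image_graft_cong) (use disj in auto)
    ultimately show ?thesis using disj by (simp add: prod.union_disjoint)
  qed
  have "(\<Prod>u\<in>#add_mset u G. graft_sum L \<omega> (map_rtree l u)) =
     (\<Sum>f\<in>?A \<rightarrow>\<^sub>E L. \<Sum>g\<in>?B \<rightarrow>\<^sub>E L. scal ((\<Prod>v\<in>?A. \<omega> (f v)) * (\<Prod>v\<in>?B. \<omega> (g v)))
      (basis_elem ({#graft f l u#} + image_mset (graft g l) G)))"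
    by (simp add: u G sum_product scal_times basis_elem_times)
  also have "\<dots> = (\<Sum>h\<in>?A \<union> ?B \<rightarrow>\<^sub>E L.
      scal (\<Prod>v\<in>?A \<union> ?B. \<omega> (h v)) (basis_elem (image_mset (graft h l) (add_mset u G))))"
    unfolding sum_PiE_Un[OF disj] upd ..
  finally show "(\<Prod>u\<in>#add_mset u G. graft_sum L \<omega> (map_rtree l u)) =
        (\<Sum>h\<in>forest_vertices (add_mset u G) \<rightarrow>\<^sub>E L.
           scal (\<Prod>v\<in>forest_vertices (add_mset u G). \<omega> (h v)) (basis_elem (image_mset (graft h l) (add_mset u G))))"
    unfolding forest_vertices_simps .
qed

text \<open>
  The multinomial coefficient: if the elements \<open>D\<close> carry colors \<open>k\<close>, then a prescribed distribution \<open>h\<close>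
  of the colors onto \<open>V\<close> is realized by
  \<open>multiplicity_factorial (\<Sum>v\<in>V. h v) / (\<Prod>v\<in>V. multiplicity_factorial (h v))\<close> maps. The induction
  removes an element \<open>d\<close> of \<open>D\<close> and sums over the places where it is sent.
\<close>

lemma card_fiber_functions:
  fixes h :: "'v \<Rightarrow> 'b multiset"
  assumes "finite D" "finite V"
  shows "card {g \<in> D \<rightarrow>\<^sub>E V. \<forall>v\<in>V. image_mset k (filter_mset (\<lambda>u. g u = v) (mset_set D)) = h v}
      * (\<Prod>v\<in>V. multiplicity_factorial (h v)) =
    (if (\<Sum>v\<in>V. h v) = image_mset k (mset_set D) then multiplicity_factorial (\<Sum>v\<in>V. h v) else 0)"
  using assms(1)
proof (induction D arbitrary: h rule: finite_induct)
  case empty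
  show ?case
  proof (cases "\<forall>v\<in>V. h v = {#}")
    case True
    then have *: "{g. g = (\<lambda>x. undefined) \<and> (\<forall>v\<in>V. {#} = h v)} = {\<lambda>_ :: 'a. undefined :: 'v}" by auto
    show ?thesis using True by (simp add: *)
  next
    case False
    then have "(\<Sum>v\<in>V. h v) \<noteq> {#}" using assms(2) by (auto simp: sum_eq_empty_iff)
    then show ?thesis using False by auto
  qed
next
  case (insert d D)
  define N where "N D h = {g \<in> D \<rightarrow>\<^sub>E V. \<forall>v\<in>V. image_mset k (filter_mset (\<lambda>u. g u = v) (mset_set D)) = h v}"
    for D h
  \<comment> \<open>The admissible images \<open>w\<close> of \<open>d\<close>, and the distribution that is left to the other elements.\<close>
  define W where "W = {w \<in> V. k d \<in># h w}"
  define h' where "h' w = h(w := h w - {#k d#})" for w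
  have split: "(g(d := w) \<in> N (insert d D) h) \<longleftrightarrow> w \<in> W \<and> g \<in> N D (h' w)"
    if g: "g \<in> D \<rightarrow>\<^sub>E V" "w \<in> V" for g w
  proof -
    define g' where "g' = g(d := w)"
    have "filter_mset (\<lambda>u. g' u = v) (mset_set D) = filter_mset (\<lambda>u. g u = v) (mset_set D)" for v
      by (rule filter_mset_cong) (use insert in \<open>auto simp: g'_def\<close>)
    moreover have "g' d = w" by (simp add: g'_def)
    ultimately have fiber: "image_mset k (filter_mset (\<lambda>u. g' u = v) (mset_set (insert d D))) =
        (if w = v then {#k d#} else {#}) + image_mset k (filter_mset (\<lambda>u. g u = v) (mset_set D))" for v
      using insert(1,2) by (simp del: filter_mset_mset_set)
    have "g' \<in> insert d D \<rightarrow>\<^sub>E V" using g by (auto simp: g'_def PiE_def extensional_def)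
    then have "g(d := w) \<in> N (insert d D) h \<longleftrightarrow>
       (\<forall>v\<in>V. (if w = v then {#k d#} else {#}) + image_mset k (filter_mset (\<lambda>u. g u = v) (mset_set D)) = h v)"
      unfolding N_def mem_Collect_eq g'_def[symmetric] fiber by simp
    also have "\<dots> \<longleftrightarrow> w \<in> W \<and> (\<forall>v\<in>V. image_mset k (filter_mset (\<lambda>u. g u = v) (mset_set D)) = h' w v)"
    proof -
      have "(if w = v then {#k d#} else {#}) + B = h v \<longleftrightarrow> (w = v \<longrightarrow> k d \<in># h w) \<and> B = h' w v" for v B
      proof -
        have "add_mset (k d) B = h w \<longleftrightarrow> k d \<in># h w \<and> B = h w - {#k d#}"
          by (metis add_mset_remove_trivial insert_DiffM union_single_eq_member)
        then show ?thesis by (cases "w = v") (simp_all add: h'_def)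
      qed
      then show ?thesis using g(2) by (auto simp: W_def)
    qed
    finally show ?thesis using g by (simp add: N_def)
  qed
  have "N (insert d D) h = (\<lambda>(w, g). g(d := w)) ` (SIGMA w:W. N D (h' w))"
  proof (intro equalityI subsetI)
    fix g assume g: "g \<in> N (insert d D) h"
    then have "g \<in> insert d D \<rightarrow>\<^sub>E V" by (simp add: N_def)
    then obtain w g0 where wg: "g = g0(d := w)" "w \<in> V" "g0 \<in> D \<rightarrow>\<^sub>E V"
      unfolding PiE_insert_eq by auto
    then show "g \<in> (\<lambda>(w, g). g(d := w)) ` (SIGMA w:W. N D (h' w))"
      using split[OF wg(3,2)] g by auto
  next
    fix g assume "g \<in> (\<lambda>(w, g). g(d := w)) ` (SIGMA w:W. N D (h' w))"
    then obtain w g0 where wg: "g = g0(d := w)" "w \<in> W" "g0 \<in> N D (h' w)" by auto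
    then have "g0 \<in> D \<rightarrow>\<^sub>E V" "w \<in> V" by (auto simp: N_def W_def)
    then show "g \<in> N (insert d D) h" using split[of g0 w] wg by simp
  qed
  moreover have "inj_on (\<lambda>(w, g). g(d := w)) (SIGMA w:W. N D (h' w))"
    by (rule inj_on_subset[OF inj_combinator[OF insert(2), of "\<lambda>_. V"]]) (auto simp: W_def N_def)
  ultimately have "card (N (insert d D) h) = card (SIGMA w:W. N D (h' w))"
    by (simp add: card_image)
  also have "\<dots> = (\<Sum>w\<in>W. card (N D (h' w)))"
  proof (rule card_SigmaI)
    show "finite W" using assms(2) by (simp add: W_def)
    show "\<forall>w\<in>W. finite (N D (h' w))"
      using finite_PiE[OF insert(1), of "\<lambda>_. V"] assms(2) by (auto simp: N_def)
  qed
  finally have card: "card (N (insert d D) h) = (\<Sum>w\<in>W. card (N D (h' w)))" .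
  have sum: "add_mset (k d) (\<Sum>v\<in>V. h' w v) = (\<Sum>v\<in>V. h v)" if w: "w \<in> W" for w
  proof -
    have wV: "w \<in> V" using w by (simp add: W_def)
    have "(\<Sum>v\<in>V - {w}. h' w v) = (\<Sum>v\<in>V - {w}. h v)" by (rule sum.cong) (auto simp: h'_def)
    then show ?thesis
      using w by (simp add: sum.remove[OF assms(2) wV] h'_def W_def flip: union_mset_add_mset_left)
  qed
  have prod: "(\<Prod>v\<in>V. multiplicity_factorial (h v)) =
      count (h w) (k d) * (\<Prod>v\<in>V. multiplicity_factorial (h' w v))" if w: "w \<in> W" for w
  proof -
    have wV: "w \<in> V" using w by (simp add: W_def)
    have "(\<Prod>v\<in>V - {w}. multiplicity_factorial (h' w v)) = (\<Prod>v\<in>V - {w}. multiplicity_factorial (h v))"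
      by (rule prod.cong) (auto simp: h'_def)
    moreover have "multiplicity_factorial (h w) = count (h w) (k d) * multiplicity_factorial (h w - {#k d#})"
    proof -
      obtain B where "h w = add_mset (k d) B" using w by (auto simp: W_def dest: multi_member_split)
      then show ?thesis by (simp add: multiplicity_factorial_add_mset)
    qed
    ultimately show ?thesis by (simp add: prod.remove[OF assms(2) wV] h'_def)
  qed
  let ?K = "image_mset k (mset_set D)"
  have "card (N (insert d D) h) * (\<Prod>v\<in>V. multiplicity_factorial (h v)) =
     (\<Sum>w\<in>W. count (h w) (k d) * (card (N D (h' w)) * (\<Prod>v\<in>V. multiplicity_factorial (h' w v))))"
    unfolding card sum_distrib_right by (rule sum.cong) (auto simp: prod)
  also have "\<dots> = (\<Sum>w\<in>W. count (h w) (k d) *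
      (if (\<Sum>v\<in>V. h v) = add_mset (k d) ?K then multiplicity_factorial ?K else 0))"
  proof (rule sum.cong)
    fix w assume w: "w \<in> W"
    have "(\<Sum>v\<in>V. h' w v) = ?K \<longleftrightarrow> (\<Sum>v\<in>V. h v) = add_mset (k d) ?K"
      unfolding sum[OF w, symmetric] by simp
    then show "count (h w) (k d) * (card (N D (h' w)) * (\<Prod>v\<in>V. multiplicity_factorial (h' w v))) =
        count (h w) (k d) * (if (\<Sum>v\<in>V. h v) = add_mset (k d) ?K then multiplicity_factorial ?K else 0)"
      using insert.IH[of "h' w"] unfolding N_def[symmetric]
      by (cases "(\<Sum>v\<in>V. h' w v) = ?K") simp_all
  qed simp
  also have "\<dots> = (\<Sum>w\<in>W. count (h w) (k d)) *
      (if (\<Sum>v\<in>V. h v) = add_mset (k d) ?K then multiplicity_factorial ?K else 0)"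
    by (simp add: sum_distrib_right)
  also have "(\<Sum>w\<in>W. count (h w) (k d)) = (\<Sum>w\<in>V. count (h w) (k d))"
    by (rule sum.mono_neutral_left) (use assms(2) in \<open>auto simp: W_def not_in_iff\<close>)
  also have "\<dots> = count (\<Sum>w\<in>V. h w) (k d)" by (simp add: count_sum)
  finally show ?case
    using insert(1,2) by (simp add: N_def multiplicity_factorial_add_mset)
qed

section \<open>Products with sums of corollas\<close>

lemma rat_algebra_props:
  assumes "rat_algebra (\<iota> :: rat \<Rightarrow> 'k::comm_ring_1)"
  shows "\<iota> 1 = 1" "\<iota> (a * b) = \<iota> a * \<iota> b" "\<iota> (of_nat n) = of_nat n"
    and "n > 0 \<Longrightarrow> \<iota> (1 / of_nat n) * of_nat n = 1"
proof -
  show one: "\<iota> 1 = 1" and mult: "\<iota> (a * b) = \<iota> a * \<iota> b" for a b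
    using assms by (simp_all add: rat_algebra_def)
  have add: "\<iota> (a + b) = \<iota> a + \<iota> b" for a b using assms by (simp add: rat_algebra_def)
  have zero: "\<iota> 0 = 0" using add[of 0 0] by simp
  show nat: "\<iota> (of_nat n) = of_nat n" for n by (induction n) (simp_all add: zero one add)
  assume "n > 0"
  then have "1 / rat_of_nat n * rat_of_nat n = 1" by simp
  then show "\<iota> (1 / of_nat n) * of_nat n = 1" by (metis mult nat one)
qed

text \<open>
  The bound \<open>M\<close> makes the set finite. It has no influence on results of weight at most \<open>M\<close>.
\<close>

definition leaf_forests :: "nat set \<Rightarrow> nat \<Rightarrow> wforest set" where
  "leaf_forests W M = {P. (\<forall>u\<in>#P. children u = {#} \<and> tree_root u \<in> W) \<and> forest_weight P \<le> M}"

text \<open>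
  Up to the global sign \<open>(-1)^m\<close>, the coefficient of the tree with branches \<open>P\<close> in \<open>T\<^sub>W(\<Lambda>\<^sub>m)\<close>. With
  such exponential weights the sum over all ways to distribute the trees of \<open>P\<close> to the vertices of a
  tree becomes a product over these vertices.
\<close>

definition leaf_coeff :: "(rat \<Rightarrow> 'k::comm_ring_1) \<Rightarrow> wforest \<Rightarrow> 'k" where
  "leaf_coeff \<iota> P = (-1) ^ size P * \<iota> (1 / of_nat (multiplicity_factorial P))"

lemma forest_weight_mono: "P \<subseteq># Q \<Longrightarrow> forest_weight P \<le> forest_weight Q"
  by (metis forest_weight_simps(3) le_add1 subset_mset.le_iff_add)

lemma leaf_forests_mono: "Q \<in> leaf_forests W M \<Longrightarrow> P \<subseteq># Q \<Longrightarrow> P \<in> leaf_forests W M"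
  using forest_weight_mono[of P Q] by (auto simp: leaf_forests_def dest: mset_subset_eqD)

lemma weight_ge_root: "tree_root u \<le> weight u"
  by (cases u) simp

lemma weight_le_forest_weight: "u \<in># P \<Longrightarrow> weight u \<le> forest_weight P"
  by (metis forest_weight_simps(2) insert_DiffM le_add1)

lemma finite_leaf_forests:
  assumes "W \<subseteq> {n. n > 0}"
  shows "finite (leaf_forests W M)"
proof -
  let ?A = "(\<lambda>a. Node a {#}) ` {..M}"
  have "size P \<le> forest_weight P" if "\<forall>u\<in>#P. tree_root u \<in> W" for P :: wforest
    using that
  proof (induction P)
    case (add u P)
    then have "tree_root u > 0" using assms by auto
    then show ?case using add weight_ge_root[of u] by auto
  qed simp
  moreover have "u \<in> ?A" if "P \<in> leaf_forests W M" "u \<in># P" for u P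
  proof -
    have "children u = {#}" "forest_weight P \<le> M" using that by (auto simp: leaf_forests_def)
    moreover have "tree_root u \<le> M"
      using weight_ge_root[of u] weight_le_forest_weight[OF that(2)] \<open>forest_weight P \<le> M\<close> by linarith
    ultimately show ?thesis by (cases u) auto
  qed
  ultimately have "leaf_forests W M \<subseteq> mset ` {xs. set xs \<subseteq> ?A \<and> length xs \<le> M}"
  proof (intro subsetI)
    fix P assume *: "\<And>P :: wforest. \<forall>u\<in>#P. tree_root u \<in> W \<Longrightarrow> size P \<le> forest_weight P"
      "\<And>P u. P \<in> leaf_forests W M \<Longrightarrow> u \<in># P \<Longrightarrow> u \<in> ?A" and P: "P \<in> leaf_forests W M"
    obtain xs where xs: "mset xs = P" using ex_mset by blast
    have "size P \<le> M" using *(1)[of P] P by (auto simp: leaf_forests_def)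
    then have "length xs \<le> M" using xs by auto
    moreover have "set xs \<subseteq> ?A" using *(2)[OF P] xs by auto
    ultimately show "P \<in> mset ` {xs. set xs \<subseteq> ?A \<and> length xs \<le> M}" using xs by blast
  qed
  then show ?thesis by (rule finite_subset) (intro finite_imageI finite_lists_length_le, simp)
qed

text \<open>
  The grafting maps \<open>g\<close> are collected according to the forests \<open>h v\<close> that they attach to the vertices
  \<open>v\<close>; their number is given by \<open>card_fiber_functions\<close>.
\<close>

lemma gl_mult_basis_expansion:
  assumes \<iota>: "rat_algebra (\<iota> :: rat \<Rightarrow> 'k::comm_ring_1)"
    and L: "finite L" "\<And>P. P \<subseteq># children T \<Longrightarrow> P \<in> L"
    and rep: "representative S = (s, l)"
  shows "scal (\<iota> (1 / of_nat (multiplicity_factorial (children T)))) (gl_mult_basis T S) =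
    (\<Sum>h\<in>set_rtree s \<rightarrow>\<^sub>E L. if (\<Sum>v\<in>set_rtree s. h v) = children T then
       scal (\<Prod>v\<in>set_rtree s. \<iota> (1 / of_nat (multiplicity_factorial (h v)))) (basis_elem (graft h l s))
     else 0)"
proof -
  obtain t k where t: "representative T = (t, k)" "distinct_tree t" "map_rtree k t = T"
    by (rule representativeE)
  define G where "G = children t"
  define D where "D = set_mset G"
  define V where "V = set_rtree s"
  have finV: "finite V" by (simp add: V_def)
  have finVL: "finite (V \<rightarrow>\<^sub>E L)" using finV L(1) by (intro finite_PiE) auto
  have "distinct_forest G" using t(2) unfolding G_def by (cases t) (simp add: distinct_tree_Node)
  then have G: "mset_set D = G"
    by (intro multiset_eqI) (auto simp: D_def count_mset_set' distinct_forest_count not_in_iff)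
  have finD: "finite D" by (simp add: D_def)
  have chT: "children T = image_mset (map_rtree k) (mset_set D)"
    unfolding t(3)[symmetric] G by (simp add: G_def rtree.map_sel)
  define fib where "fib g v = image_mset (map_rtree k) (filter_mset (\<lambda>u. g u = v) G)" for g :: "nat rtree \<Rightarrow> nat" and v
  \<comment> \<open>\<open>graft\<close> only depends on the values on the vertices; \<open>restrict\<close> gives each fiber map a
    canonical form in the set over which the sum runs.\<close>
  define r where "r g = restrict (fib g) V" for g
  have "fib g v \<in> L" for g v
    unfolding fib_def by (rule L(2)) (simp add: chT G image_mset_subseteq_mono)
  then have rL: "r g \<in> V \<rightarrow>\<^sub>E L" for g by (auto simp: r_def)
  define N where "N h = {g \<in> D \<rightarrow>\<^sub>E V. r g = h}" for h
  have "gl_mult_basis T S = (\<Sum>g\<in>D \<rightarrow>\<^sub>E V. (basis_elem (graft (fib g) l s) :: _ \<Rightarrow>\<^sub>0 'k))"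
    unfolding gl_mult_basis_def t(1) rep by (simp add: D_def V_def G_def fib_def[abs_def])
  also have "\<dots> = (\<Sum>g\<in>D \<rightarrow>\<^sub>E V. basis_elem (graft (r g) l s))"
    by (intro sum.cong refl arg_cong[where f = basis_elem] graft_cong) (simp add: r_def V_def)
  also have "\<dots> = (\<Sum>h\<in>V \<rightarrow>\<^sub>E L. \<Sum>g\<in>N h. basis_elem (graft (r g) l s))"
    unfolding N_def by (rule sum.group[symmetric]) (use rL finVL finD finV in \<open>auto intro: finite_PiE\<close>)
  also have "\<dots> = (\<Sum>h\<in>V \<rightarrow>\<^sub>E L. scal (of_nat (card (N h))) (basis_elem (graft h l s)))"
    by (intro sum.cong refl poly_mapping_eqI) (simp add: N_def lookup_sum)
  finally have gl: "gl_mult_basis T S = (\<Sum>h\<in>V \<rightarrow>\<^sub>E L. scal (of_nat (card (N h))) (basis_elem (graft h l s) :: _ \<Rightarrow>\<^sub>0 'k))" .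
  let ?c = "\<iota> (1 / of_nat (multiplicity_factorial (children T)))"
  let ?d = "\<lambda>h. \<Prod>v\<in>V. \<iota> (1 / of_nat (multiplicity_factorial (h v)))"
  have coeff: "?c * of_nat (card (N h)) = (if (\<Sum>v\<in>V. h v) = children T then ?d h else 0)"
    if h: "h \<in> V \<rightarrow>\<^sub>E L" for h
  proof -
    have "r g = h \<longleftrightarrow> (\<forall>v\<in>V. fib g v = h v)" for g
      using h by (auto simp: r_def PiE_def extensional_def restrict_def fun_eq_iff)
    then have Nh: "N h = {g \<in> D \<rightarrow>\<^sub>E V. \<forall>v\<in>V. image_mset (map_rtree k) (filter_mset (\<lambda>u. g u = v) (mset_set D)) = h v}"
      unfolding N_def fib_def G by simp
    have "card (N h) * (\<Prod>v\<in>V. multiplicity_factorial (h v)) =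
       (if (\<Sum>v\<in>V. h v) = children T then multiplicity_factorial (children T) else 0)"
      unfolding Nh chT using card_fiber_functions[OF finD finV, of "map_rtree k" h] by simp
    then have eq: "of_nat (card (N h)) * (\<Prod>v\<in>V. of_nat (multiplicity_factorial (h v))) =
       (if (\<Sum>v\<in>V. h v) = children T then of_nat (multiplicity_factorial (children T)) else (0 :: 'k))"
      by (metis of_nat_0 of_nat_mult of_nat_prod)
    have one: "?c * of_nat (multiplicity_factorial (children T)) = 1"
      by (rule rat_algebra_props(4)[OF \<iota> multiplicity_factorial_pos])
    have "?d h * (\<Prod>v\<in>V. of_nat (multiplicity_factorial (h v))) = 1"
      by (simp add: rat_algebra_props(4)[OF \<iota> multiplicity_factorial_pos] flip: prod.distrib)
    then have "?c * of_nat (card (N h)) =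
        ?c * of_nat (card (N h)) * (?d h * (\<Prod>v\<in>V. of_nat (multiplicity_factorial (h v))))"
      by simp
    also have "\<dots> = ?d h * (?c * (of_nat (card (N h)) * (\<Prod>v\<in>V. of_nat (multiplicity_factorial (h v)))))"
      by (simp only: ac_simps)
    also have "\<dots> = (if (\<Sum>v\<in>V. h v) = children T then ?d h else 0)"
      unfolding eq using one by simp
    finally show ?thesis .
  qed
  have "scal ?c (gl_mult_basis T S) =
      (\<Sum>h\<in>V \<rightarrow>\<^sub>E L. scal (?c * of_nat (card (N h))) (basis_elem (graft h l s)))"
    unfolding gl by (rule poly_mapping_eqI) (simp add: lookup_sum sum_distrib_left mult.assoc)
  also have "\<dots> = (\<Sum>h\<in>V \<rightarrow>\<^sub>E L. if (\<Sum>v\<in>V. h v) = children T then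
       scal (?d h) (basis_elem (graft h l s)) else 0)"
    by (intro sum.cong refl poly_mapping_eqI) (simp add: coeff)
  finally show ?thesis unfolding V_def .
qed

lemma height_le_one: "height (Node a F) \<le> 1 \<longleftrightarrow> (\<forall>u\<in>#F. children u = {#})"
proof -
  have "height u = 0 \<longleftrightarrow> children u = {#}" for u :: "'b rtree"
    by (cases u) (auto simp: Max_eq_iff)
  then show ?thesis by (auto simp: Ball_def)
qed

lemma forest_aut_leaves: "\<forall>u\<in>#P. children u = {#} \<Longrightarrow> forest_aut P = multiplicity_factorial P"
proof -
  assume *: "\<forall>u\<in>#P. children u = {#}"
  have "image_mset tree_aut P = image_mset (\<lambda>_. 1) P"
  proof (rule image_mset_cong)
    fix u assume "u \<in># P"
    then have "children u = {#}" using * by blast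
    then show "tree_aut u = 1" by (cases u) simp
  qed
  then show ?thesis by (simp add: forest_aut_def)
qed

lemma TW_Lambda_eq:
  assumes "m \<le> M"
  shows "TW_Lambda \<iota> W m =
    (\<Sum>P\<in>{P \<in> leaf_forests W M. forest_weight P = m}.
       scal ((-1) ^ m * leaf_coeff \<iota> P) (basis_elem (Node 0 P)))"
proof -
  let ?A = "{P \<in> leaf_forests W M. forest_weight P = m}"
  have trees_eq: "{T \<in> bar_trees W. height T \<le> 1 \<and> weight T = m} = Node 0 ` ?A"
  proof -
    have "Node 0 F \<in> bar_trees W \<longleftrightarrow> F \<in> forests W" for F
      by (auto simp: bar_trees_def B_plus_def)
    moreover have "F \<in> forests W \<longleftrightarrow> (\<forall>u\<in>#F. tree_root u \<in> W)" if "\<forall>u\<in>#F. children u = {#}" for F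
    proof -
      have "set_rtree u = {tree_root u}" if "u \<in># F" for u
        using that \<open>\<forall>u\<in>#F. children u = {#}\<close> by (cases u) auto
      then show ?thesis by (auto simp: forests_def trees_def)
    qed
    ultimately have "Node 0 F \<in> bar_trees W \<and> height (Node 0 F) \<le> 1 \<and> weight (Node 0 F) = m \<longleftrightarrow> F \<in> ?A" for F
      using assms unfolding height_le_one weight_Node leaf_forests_def by auto
    moreover have "\<exists>F. T = Node 0 F" if "T \<in> bar_trees W" for T
      using that by (auto simp: bar_trees_def B_plus_def)
    ultimately show ?thesis by blast
  qed
  have "TW_Lambda \<iota> W m = (\<Sum>P\<in>?A. scal ((-1) ^ (size P + forest_weight P) *
      \<iota> (1 / of_nat (num_automorphisms (Node 0 P)))) (basis_elem (Node 0 P)))"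
    unfolding TW_Lambda_def trees_eq
    by (subst sum.reindex) (auto simp: weight_Node inj_on_def simp del: weight.simps)
  also have "\<dots> = (\<Sum>P\<in>?A. scal ((-1) ^ m * leaf_coeff \<iota> P) (basis_elem (Node 0 P)))"
    by (rule sum.cong) (auto simp: num_automorphisms_eq_tree_aut tree_aut_Node forest_aut_leaves leaf_forests_def leaf_coeff_def
        power_add ac_simps simp del: tree_aut.simps)
  finally show ?thesis .
qed

text \<open>
  Grafting preserves the total weight. So instead of restricting the grafted leaves to weight \<open>m\<close>,
  all forests of \<open>leaf_forests W M\<close> can be grafted and only the weight of the result is fixed.
\<close>

lemma lookup_gl_mult_TW_Lambda:
  assumes \<iota>: "rat_algebra (\<iota> :: rat \<Rightarrow> 'k::comm_ring_1)" and W: "W \<subseteq> {n. n > 0}" and m: "m \<le> M"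
  shows "lookup (gl_mult (TW_Lambda \<iota> W m) X) U = (-1) ^ m *
    lin_fun (\<lambda>S. if weight U = m + weight S
      then lookup (graft_sum (leaf_forests W M) (leaf_coeff \<iota>) S) {#U#} else 0) X"
proof -
  let ?L = "leaf_forests W M"
  let ?A = "{P \<in> ?L. forest_weight P = m}"
  have finL: "finite ?L" by (rule finite_leaf_forests[OF W])
  have basis: "lin_fun (\<lambda>T. lookup (gl_mult_basis T S) U) (TW_Lambda \<iota> W m) =
      (-1) ^ m * (if weight U = m + weight S
        then lookup (graft_sum ?L (leaf_coeff \<iota>) S) {#U#} else 0)" for S
  proof -
    obtain s l where s: "representative S = (s, l)" "distinct_tree s" "map_rtree l s = S"
      by (rule representativeE)
    define V where "V = set_rtree s"
    have finV: "finite V" by (simp add: V_def)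
    have finVL: "finite (V \<rightarrow>\<^sub>E ?L)" using finV finL by (intro finite_PiE) auto
    let ?w = "\<lambda>h. \<Prod>v\<in>V. leaf_coeff \<iota> (h v)"
    let ?d = "\<lambda>h. \<Prod>v\<in>V. \<iota> (1 / of_nat (multiplicity_factorial (h v)))"
    let ?e = "\<lambda>h. if graft h l s = U then 1 else 0 :: 'k"
    have size: "(-1) ^ size (\<Sum>v\<in>V. h v) = (\<Prod>v\<in>V. (-1) ^ size (h v) :: 'k)" for h :: "nat \<Rightarrow> wforest"
      using finV by (induction V rule: finite_induct) (auto simp: power_add)
    have w: "?w h = (-1) ^ size (\<Sum>v\<in>V. h v) * ?d h" for h
      by (simp only: leaf_coeff_def prod.distrib size)
    have fw: "forest_weight (\<Sum>v\<in>V. h v) = (\<Sum>v\<in>V. forest_weight (h v))" for h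
      using finV by (induction V rule: finite_induct) auto
    have "lin_fun (\<lambda>T. lookup (gl_mult_basis T S) U) (TW_Lambda \<iota> W m) =
      (\<Sum>P\<in>?A. (-1) ^ m * leaf_coeff \<iota> P * lookup (gl_mult_basis (Node 0 P) S) U)"
      by (simp add: TW_Lambda_eq[OF m] lin_fun_sum lin_fun_scal)
    also have "\<dots> = (\<Sum>P\<in>?A. \<Sum>h\<in>V \<rightarrow>\<^sub>E ?L. if (\<Sum>v\<in>V. h v) = P then (-1) ^ m * (?w h * ?e h) else 0)"
    proof (rule sum.cong)
      fix P assume P: "P \<in> ?A"
      let ?c = "\<iota> (1 / of_nat (multiplicity_factorial P))"
      have "leaf_coeff \<iota> P * lookup (gl_mult_basis (Node 0 P) S) U =
         (-1) ^ size P * lookup (scal ?c (gl_mult_basis (Node 0 P) S)) U"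
        by (simp add: leaf_coeff_def mult.assoc)
      also have "scal ?c (gl_mult_basis (Node 0 P) S) =
         (\<Sum>h\<in>V \<rightarrow>\<^sub>E ?L. if (\<Sum>v\<in>V. h v) = P then scal (?d h) (basis_elem (graft h l s)) else 0)"
      proof -
        have "Q \<in> ?L" if "Q \<subseteq># children (Node 0 P)" for Q
          using leaf_forests_mono[of P W M Q] that P by simp
        from gl_mult_basis_expansion[where T = "Node 0 P", OF \<iota> finL this s(1)] show ?thesis
          unfolding V_def by simp
      qed
      also have "(-1) ^ size P * lookup \<dots> U =
          (\<Sum>h\<in>V \<rightarrow>\<^sub>E ?L. if (\<Sum>v\<in>V. h v) = P then ?w h * ?e h else 0)"
        unfolding lookup_sum sum_distrib_left
        by (rule sum.cong) (auto simp: w lookup_basis_elem)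
      finally show "(-1) ^ m * leaf_coeff \<iota> P * lookup (gl_mult_basis (Node 0 P) S) U =
          (\<Sum>h\<in>V \<rightarrow>\<^sub>E ?L. if (\<Sum>v\<in>V. h v) = P then (-1) ^ m * (?w h * ?e h) else 0)"
        by (simp add: mult.assoc sum_distrib_left if_distrib[of "(*) ((-1) ^ m)"] cong: if_cong)
    qed simp
    also have "\<dots> = (\<Sum>h\<in>V \<rightarrow>\<^sub>E ?L. \<Sum>P\<in>?A. if (\<Sum>v\<in>V. h v) = P then (-1) ^ m * (?w h * ?e h) else 0)"
      by (rule sum.swap)
    also have "\<dots> = (\<Sum>h\<in>V \<rightarrow>\<^sub>E ?L. if weight U = m + weight S then (-1) ^ m * (?w h * ?e h) else 0)"
    proof (rule sum.cong)
      fix h assume h: "h \<in> V \<rightarrow>\<^sub>E ?L"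
      have leaf: "\<forall>u\<in>#(\<Sum>v\<in>V. h v). children u = {#} \<and> tree_root u \<in> W"
        using h finV by (fastforce simp: leaf_forests_def set_mset_sum)
      have "(\<Sum>v\<in>V. h v) \<in> ?A \<longleftrightarrow> weight U = m + weight S" if "graft h l s = U"
        using leaf m weight_graft[OF s(2), of h l] that fw[of h] s(3) by (auto simp: leaf_forests_def V_def)
      then show "(\<Sum>P\<in>?A. if (\<Sum>v\<in>V. h v) = P then (-1) ^ m * (?w h * ?e h) else 0) =
          (if weight U = m + weight S then (-1) ^ m * (?w h * ?e h) else 0)"
        using finL by (cases "graft h l s = U") (simp_all add: sum.delta')
    qed simp
    also have "\<dots> = (-1) ^ m * (if weight U = m + weight S
        then lookup (graft_sum ?L (leaf_coeff \<iota>) S) {#U#} else 0)"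
      using graft_sum_representation[OF s(2), of ?L "leaf_coeff \<iota>" l]
      by (simp add: s(3) V_def lookup_sum lookup_basis_elem sum_distrib_left eq_commute[of U])
    finally show ?thesis .
  qed
  have "lookup (gl_mult (TW_Lambda \<iota> W m) X) U =
      lin_fun (\<lambda>T. lin_fun (\<lambda>S. lookup (gl_mult_basis T S) U) X) (TW_Lambda \<iota> W m)"
    by (simp add: gl_mult_def lookup_bilin_ext)
  also have "\<dots> = lin_fun (\<lambda>S. lin_fun (\<lambda>T. lookup (gl_mult_basis T S) U) (TW_Lambda \<iota> W m)) X"
    by (rule lin_fun_swap)
  finally show ?thesis by (simp add: basis lin_fun_mult_left)
qed

section \<open>The Connes-Kreimer coproduct\<close>

text \<open>
  The sum of \<open>\<phi> P R\<close> over all cuts of \<open>F\<close> into \<open>P\<close> and \<open>R\<close>. For \<open>\<phi> P R = \<alpha> P * \<beta> R\<close> it is the value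
  at \<open>F\<close> of the convolution product of the functionals \<open>\<alpha>\<close> and \<open>\<beta>\<close>; general \<open>\<phi>\<close> allow nested cuts.
\<close>

definition cut_sum :: "(wforest \<Rightarrow> wforest \<Rightarrow> 'k::comm_ring_1) \<Rightarrow> wforest \<Rightarrow> 'k" where
  "cut_sum \<phi> F = lin_fun (\<lambda>p. \<phi> (fst p) (snd p)) (ck_comult_basis F)"

lemma cut_sum_empty: "cut_sum \<phi> {#} = \<phi> {#} {#}"
  by (simp add: cut_sum_def ck_comult_basis_def lin_fun_one zero_prod_def)

lemma ck_comult_basis_union: "ck_comult_basis (F + G) = ck_comult_basis F * ck_comult_basis G"
  by (simp add: ck_comult_basis_def)

lemma cut_sum_union: "cut_sum \<phi> (F + G) = cut_sum (\<lambda>P R. cut_sum (\<lambda>P' R'. \<phi> (P + P') (R + R')) G) F"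
  by (simp add: cut_sum_def ck_comult_basis_union lin_fun_times)

lemma cut_sum_tree: "cut_sum \<phi> {#Node a G#} = \<phi> {#Node a G#} {#} + cut_sum (\<lambda>P R. \<phi> P {#Node a R#}) G"
  by (simp add: cut_sum_def ck_comult_basis_def ck_comult_tree_eq[abs_def] lin_fun_add lin_fun_lin_ext case_prod_unfold)

lemma cut_sum_add_mset:
  "cut_sum \<phi> (add_mset (Node a G) F) = cut_sum (\<lambda>P R. \<phi> (add_mset (Node a G) P) R) F +
     cut_sum (\<lambda>P R. cut_sum (\<lambda>P' R'. \<phi> (P + P') (add_mset (Node a R) R')) F) G"
  using cut_sum_union[of \<phi> "{#Node a G#}" F] by (simp add: cut_sum_tree)

lemma cut_sum_add: "cut_sum (\<lambda>P R. \<phi> P R + \<psi> P R) F = cut_sum \<phi> F + cut_sum \<psi> F"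
  by (simp add: cut_sum_def lin_fun_add_functional)

lemma cut_sum_sum: "cut_sum (\<lambda>P R. \<Sum>a\<in>A. \<phi> a P R) F = (\<Sum>a\<in>A. cut_sum (\<phi> a) F)"
  by (simp add: cut_sum_def lin_fun_sum_functional)

lemma cut_sum_mult_left: "cut_sum (\<lambda>P R. c * \<phi> P R) F = c * cut_sum \<phi> F"
  by (simp add: cut_sum_def lin_fun_mult_left)

lemma cut_sum_mult_right: "cut_sum (\<lambda>P R. \<phi> P R * c) F = cut_sum \<phi> F * c"
  by (simp add: cut_sum_def lin_fun_mult_right)

lemma cut_sum_zero [simp]: "cut_sum (\<lambda>P R. 0) F = 0"
  by (simp add: cut_sum_def)

lemma cut_sum_swap:
  "cut_sum (\<lambda>P R. cut_sum (\<lambda>P' R'. \<phi> P R P' R') G) F = cut_sum (\<lambda>P' R'. cut_sum (\<lambda>P R. \<phi> P R P' R') F) G"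
  unfolding cut_sum_def by (rule lin_fun_swap)

lemma lin_fun_cut_sum_swap:
  "lin_fun (\<lambda>x. cut_sum (\<lambda>P R. \<phi> x P R) F) X = cut_sum (\<lambda>P R. lin_fun (\<lambda>x. \<phi> x P R) X) F"
  unfolding cut_sum_def by (rule lin_fun_swap)

lemma forest_induct [case_names empty tree union]:
  assumes "Q {#}" "\<And>a G. Q G \<Longrightarrow> Q {#Node a G#}" "\<And>F G. Q F \<Longrightarrow> Q G \<Longrightarrow> Q (F + G)"
  shows "Q F"
proof -
  have forest: "Q F" if "\<And>T. T \<in># F \<Longrightarrow> Q {#T#}" for F
    using that
  proof (induction F)
    case (add T F)
    then show ?case using assms(3)[of "{#T#}" F] by simp
  qed (use assms in simp)
  have "Q {#T#}" for T
    by (induction T) (use assms(2) forest in blast)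
  then show ?thesis using forest by blast
qed

lemma forest_add_induct [case_names empty add]:
  assumes "Q {#}" "\<And>a G F. Q G \<Longrightarrow> Q F \<Longrightarrow> Q (add_mset (Node a G) F)"
  shows "Q F"
proof -
  have forest: "Q F" if "\<And>T. T \<in># F \<Longrightarrow> Q (children T)" for F
    using that
  proof (induction F)
    case (add T F)
    then show ?case using assms(2)[of "children T" F "tree_root T"] by simp
  qed (use assms in simp)
  have "Q (children T)" for T
    by (induction T) (use forest in simp)
  then show ?thesis using forest by blast
qed

text \<open>
  For a tree both sides consist of the term for the tree itself, the term for a single cut of the
  branches, and the nested cuts of the branches, to which the induction hypothesis applies.
\<close>

lemma cut_sum_coassoc:
  "cut_sum (\<lambda>P R. cut_sum (\<lambda>P\<^sub>1 P\<^sub>2. \<psi> P\<^sub>1 P\<^sub>2 R) P) F = cut_sum (\<lambda>P R. cut_sum (\<lambda>R\<^sub>1 R\<^sub>2. \<psi> P R\<^sub>1 R\<^sub>2) R) F"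
proof (induction F arbitrary: \<psi> rule: forest_induct)
  case (tree a G)
  have "cut_sum (\<lambda>P R. cut_sum (\<lambda>P\<^sub>1 P\<^sub>2. \<psi> P\<^sub>1 P\<^sub>2 R) P) {#Node a G#} =
     \<psi> {#Node a G#} {#} {#} + cut_sum (\<lambda>P R. \<psi> P {#Node a R#} {#}) G +
     cut_sum (\<lambda>P R. cut_sum (\<lambda>P\<^sub>1 P\<^sub>2. \<psi> P\<^sub>1 P\<^sub>2 {#Node a R#}) P) G"
    by (simp add: cut_sum_tree)
  also have "cut_sum (\<lambda>P R. cut_sum (\<lambda>P\<^sub>1 P\<^sub>2. \<psi> P\<^sub>1 P\<^sub>2 {#Node a R#}) P) G =
     cut_sum (\<lambda>P R. cut_sum (\<lambda>R\<^sub>1 R\<^sub>2. \<psi> P R\<^sub>1 {#Node a R\<^sub>2#}) R) G"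
    by (rule tree.IH)
  finally show ?case by (simp add: cut_sum_tree cut_sum_empty cut_sum_add)
next
  case (union F G)
  have "cut_sum (\<lambda>P R. cut_sum (\<lambda>P\<^sub>1 P\<^sub>2. \<psi> P\<^sub>1 P\<^sub>2 R) P) (F + G) =
    cut_sum (\<lambda>P R. cut_sum (\<lambda>P' R'. cut_sum (\<lambda>P\<^sub>1 P\<^sub>2. cut_sum (\<lambda>P\<^sub>1' P\<^sub>2'. \<psi> (P\<^sub>1 + P\<^sub>1') (P\<^sub>2 + P\<^sub>2') (R + R')) P') P) G) F"
    by (simp add: cut_sum_union)
  also have "\<dots> = cut_sum (\<lambda>P R. cut_sum (\<lambda>P\<^sub>1 P\<^sub>2. cut_sum (\<lambda>P' R'. cut_sum (\<lambda>P\<^sub>1' P\<^sub>2'. \<psi> (P\<^sub>1 + P\<^sub>1') (P\<^sub>2 + P\<^sub>2') (R + R')) P') G) P) F"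
    by (subst cut_sum_swap) (rule refl)
  also have "\<dots> = cut_sum (\<lambda>P R. cut_sum (\<lambda>R\<^sub>1 R\<^sub>2. cut_sum (\<lambda>P' R'. cut_sum (\<lambda>P\<^sub>1' P\<^sub>2'. \<psi> (P + P\<^sub>1') (R\<^sub>1 + P\<^sub>2') (R\<^sub>2 + R')) P') G) R) F"
    by (rule union.IH(1))
  also have "\<dots> = cut_sum (\<lambda>P R. cut_sum (\<lambda>R\<^sub>1 R\<^sub>2. cut_sum (\<lambda>P' R'. cut_sum (\<lambda>R\<^sub>1' R\<^sub>2'. \<psi> (P + P') (R\<^sub>1 + R\<^sub>1') (R\<^sub>2 + R\<^sub>2')) R') G) R) F"
    by (simp only: union.IH(2))
  also have "\<dots> = cut_sum (\<lambda>P R. cut_sum (\<lambda>P' R'. cut_sum (\<lambda>R\<^sub>1 R\<^sub>2. cut_sum (\<lambda>R\<^sub>1' R\<^sub>2'. \<psi> (P + P') (R\<^sub>1 + R\<^sub>1') (R\<^sub>2 + R\<^sub>2')) R') R) G) F"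
    by (subst cut_sum_swap) (rule refl)
  also have "\<dots> = cut_sum (\<lambda>P R. cut_sum (\<lambda>R\<^sub>1 R\<^sub>2. \<psi> P R\<^sub>1 R\<^sub>2) R) (F + G)"
    by (simp add: cut_sum_union)
  finally show ?case .
qed (simp add: cut_sum_empty)

lemma cut_sum_right_counit: "cut_sum (\<lambda>P R. if R = {#} then \<phi> P else 0) F = \<phi> F"
proof (induction F arbitrary: \<phi> rule: forest_induct)
  case (union F G)
  have "cut_sum (\<lambda>P R. if R = {#} then \<phi> P else 0) (F + G) =
    cut_sum (\<lambda>P R. if R = {#} then cut_sum (\<lambda>P' R'. if R' = {#} then \<phi> (P + P') else 0) G else 0) F"
    unfolding cut_sum_union by (intro arg_cong[where f = "\<lambda>f. cut_sum f F"] ext) auto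
  then show ?case by (simp add: union)
qed (simp_all add: cut_sum_empty cut_sum_tree)

lemma cut_sum_left_counit: "cut_sum (\<lambda>P R. if P = {#} then \<phi> R else 0) F = \<phi> F"
proof (induction F arbitrary: \<phi> rule: forest_induct)
  case (union F G)
  have "cut_sum (\<lambda>P R. if P = {#} then \<phi> R else 0) (F + G) =
    cut_sum (\<lambda>P R. if P = {#} then cut_sum (\<lambda>P' R'. if P' = {#} then \<phi> (R + R') else 0) G else 0) F"
    unfolding cut_sum_union by (intro arg_cong[where f = "\<lambda>f. cut_sum f F"] ext) auto
  then show ?case by (simp add: union)
qed (simp_all add: cut_sum_empty cut_sum_tree)

lemma forests_simps [simp]:
  "{#} \<in> forests W"
  "F + G \<in> forests W \<longleftrightarrow> F \<in> forests W \<and> G \<in> forests W"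
  "add_mset T F \<in> forests W \<longleftrightarrow> T \<in> trees W \<and> F \<in> forests W"
  "Node a G \<in> trees W \<longleftrightarrow> a \<in> W \<and> G \<in> forests W"
  by (auto simp: forests_def trees_def)

text \<open>
  The parts of a cut have labels in \<open>W\<close> and their weights add up.
\<close>

lemma cut_sum_cong:
  assumes "F \<in> forests W"
    "\<And>P R. P \<in> forests W \<Longrightarrow> R \<in> forests W \<Longrightarrow> forest_weight P + forest_weight R = forest_weight F
       \<Longrightarrow> \<phi> P R = \<psi> P R"
  shows "cut_sum \<phi> F = cut_sum \<psi> F"
  using assms
proof (induction F arbitrary: \<phi> \<psi> rule: forest_induct)
  case (tree a G)
  have "cut_sum (\<lambda>P R. \<phi> P {#Node a R#}) G = cut_sum (\<lambda>P R. \<psi> P {#Node a R#}) G"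
    using tree.prems by (intro tree.IH) (auto simp: weight_Node simp del: weight.simps)
  then show ?case using tree.prems by (simp add: cut_sum_tree)
next
  case (union F G)
  have "cut_sum (\<lambda>P R. cut_sum (\<lambda>P' R'. \<phi> (P + P') (R + R')) G) F = cut_sum (\<lambda>P R. cut_sum (\<lambda>P' R'. \<psi> (P + P') (R + R')) G) F"
    using union.prems by (intro union.IH union.prems(2)) auto
  then show ?case by (simp add: cut_sum_union)
qed (simp add: cut_sum_empty)

text \<open>
  The character of the Connes-Kreimer algebra that sends single vertices to \<open>-1\<close> and larger trees
  to \<open>0\<close>.
\<close>

definition leaf_char :: "wforest \<Rightarrow> 'k::comm_ring_1" where
  "leaf_char P = (if \<forall>u\<in>#P. children u = {#} then (-1) ^ size P else 0)"

lemma leaf_char_union: "leaf_char (P + Q) = leaf_char P * leaf_char Q"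
  by (auto simp: leaf_char_def power_add)

lemma leaf_char_empty: "leaf_char {#} = 1"
  by (simp add: leaf_char_def)

lemma leaf_char_add_mset: "leaf_char (add_mset (Node a G) P) = (if G = {#} then - leaf_char P else 0)"
  by (auto simp: leaf_char_def)

text \<open>
  The convolution of \<open>leaf_char\<close> with the constant \<open>1\<close> is the alternating sum over the sets of leaves.
  For a single vertex, the vertex itself contributes \<open>-1\<close> and the empty cut \<open>1\<close>.
\<close>

lemma cut_sum_leaf_char: "cut_sum (\<lambda>P R. leaf_char P) F = (if F = {#} then 1 else 0 :: 'k::comm_ring_1)"
proof (induction F rule: forest_add_induct)
  case (add a G F)
  have "cut_sum (\<lambda>P R. leaf_char P :: 'k) (add_mset (Node a G) F) =
     (if G = {#} then - cut_sum (\<lambda>P R. leaf_char P) F else 0) +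
     cut_sum (\<lambda>P R. leaf_char P) G * cut_sum (\<lambda>P R. leaf_char P) F"
    using cut_sum_mult_left[of "-1" "\<lambda>P R. leaf_char P :: 'k" F]
    by (simp add: cut_sum_add_mset leaf_char_add_mset leaf_char_union cut_sum_mult_left cut_sum_mult_right)
  then show ?case by (simp add: add)
qed (simp add: cut_sum_empty leaf_char_empty)


section \<open>Grafting leaves is adjoint to cutting leaves\<close>

text \<open>
  The effect of \<open>graft_sum\<close> on the branches \<open>R\<close> of a vertex: the first factor is the forest
  attached to the vertex itself.
\<close>

definition forest_graft_sum ::
    "wforest set \<Rightarrow> (wforest \<Rightarrow> 'k) \<Rightarrow> wforest \<Rightarrow> (wforest \<Rightarrow>\<^sub>0 'k::comm_ring_1)" where
  "forest_graft_sum L \<omega> R = (\<Sum>P\<in>L. scal (\<omega> P) (basis_elem P)) * (\<Prod>s\<in>#R. graft_sum L \<omega> s)"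

lemma graft_sum_Node:
  "graft_sum L \<omega> (Node a R) = lin_ext (\<lambda>F. basis_elem {#Node a F#}) (forest_graft_sum L \<omega> R)"
  by (simp add: forest_graft_sum_def)

lemma lookup_graft_sum_Node:
  "lookup (graft_sum L \<omega> (Node a R)) {#Node b G#} =
     (if a = b then lookup (forest_graft_sum L \<omega> R) G else 0)"
proof -
  have "lookup (graft_sum L \<omega> (Node a R)) {#Node b G#} =
     lin_fun (\<lambda>F. if a = b \<and> F = G then 1 else 0) (forest_graft_sum L \<omega> R)"
    unfolding graft_sum_Node lookup_lin_ext
    by (rule lin_fun_cong) (auto simp: lookup_basis_elem)
  then show ?thesis by (simp add: lin_fun_indicator)
qed

text \<open>
  The partial derivative with respect to the tree \<open>x\<close>, if the monoid algebra of forests is regarded as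
  the polynomial algebra on the trees.
\<close>

definition tree_derivation :: "wtree \<Rightarrow> (wforest \<Rightarrow>\<^sub>0 'k::comm_ring_1) \<Rightarrow> (wforest \<Rightarrow>\<^sub>0 'k)" where
  "tree_derivation x = lin_ext (\<lambda>F. scal (of_nat (count F x)) (basis_elem (F - {#x#})))"

lemma lin_fun_tree_derivation:
  "lin_fun \<phi> (tree_derivation x Y) = lin_fun (\<lambda>F. of_nat (count F x) * \<phi> (F - {#x#})) Y"
  by (simp add: tree_derivation_def lin_fun_lin_ext lin_fun_scal)

lemma lookup_tree_derivation:
  "lookup (tree_derivation x Y) F = of_nat (Suc (count F x)) * lookup Y (add_mset x F)"
proof -
  have "of_nat (count G x) * (if G - {#x#} = F then 1 else 0) =
      of_nat (Suc (count F x)) * (if G = add_mset x F then 1 else 0 :: 'a)" for G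
  proof (cases "x \<in># G")
    case True
    then obtain H where "G = add_mset x H" by (auto dest: multi_member_split)
    then show ?thesis by simp
  next
    case False
    then have "count G x = 0" "G \<noteq> add_mset x F" by (auto simp: not_in_iff)
    then show ?thesis by simp
  qed
  then have "lin_fun (\<lambda>G. if G = F then 1 else 0) (tree_derivation x Y) =
      of_nat (Suc (count F x)) * lin_fun (\<lambda>G. if G = add_mset x F then 1 else 0) Y"
    by (simp only: lin_fun_tree_derivation lin_fun_mult_left)
  then show ?thesis by (simp only: lin_fun_indicator)
qed

lemma tree_derivation_times:
  "tree_derivation x (Y * Z) = tree_derivation x Y * Z + Y * tree_derivation x Z"
proof (rule poly_mapping_eq_lin_funI)
  fix \<phi> :: "wforest \<Rightarrow> 'a"
  have "of_nat (count (F + G) x) * \<phi> (F + G - {#x#}) =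
      of_nat (count F x) * \<phi> (F - {#x#} + G) + of_nat (count G x) * \<phi> (F + (G - {#x#}))" for F G
  proof -
    have "of_nat (count F x) * \<phi> (F + G - {#x#}) = of_nat (count F x) * \<phi> (F - {#x#} + G)"
      by (cases "x \<in># F") (auto dest!: multi_member_split simp: not_in_iff)
    moreover have "of_nat (count G x) * \<phi> (F + G - {#x#}) = of_nat (count G x) * \<phi> (F + (G - {#x#}))"
      by (cases "x \<in># G") (auto dest!: multi_member_split simp: not_in_iff)
    ultimately show ?thesis by (simp add: distrib_right)
  qed
  then show "lin_fun \<phi> (tree_derivation x (Y * Z)) = lin_fun \<phi> (tree_derivation x Y * Z + Y * tree_derivation x Z)"
    by (simp only: lin_fun_add lin_fun_times lin_fun_tree_derivation lin_fun_add_functional lin_fun_mult_left)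
qed

lemma tree_derivation_one: "tree_derivation x 1 = 0"
  by (rule poly_mapping_eq_lin_funI) (simp add: lin_fun_tree_derivation lin_fun_one)

lemma tree_derivation_prod_mset:
  "tree_derivation x (\<Prod>s\<in>#R. g s) = (\<Sum>s\<in>#R. tree_derivation x (g s) * (\<Prod>r\<in>#R - {#s#}. g r))"
proof (induction R)
  case (add r R)
  have "(\<Sum>s\<in>#R. tree_derivation x (g s) * (\<Prod>r\<in>#add_mset r R - {#s#}. g r)) =
     (\<Sum>s\<in>#R. g r * (tree_derivation x (g s) * (\<Prod>r\<in>#R - {#s#}. g r)))"
  proof (rule arg_cong[where f = sum_mset], rule image_mset_cong)
    fix s assume "s \<in># R"
    then have "add_mset r R - {#s#} = add_mset r (R - {#s#})" by (auto dest!: multi_member_split)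
    then show "tree_derivation x (g s) * (\<Prod>r\<in>#add_mset r R - {#s#}. g r) =
        g r * (tree_derivation x (g s) * (\<Prod>r\<in>#R - {#s#}. g r))"
      by (simp add: ac_simps)
  qed
  also have "\<dots> = g r * (\<Sum>s\<in>#R. tree_derivation x (g s) * (\<Prod>r\<in>#R - {#s#}. g r))"
    by (simp add: sum_mset_distrib_left)
  finally show ?case by (simp add: tree_derivation_times add.IH)
qed (simp add: tree_derivation_one)

lemma tree_derivation_graft_sum:
  "tree_derivation x (graft_sum L \<omega> s) = scal (lookup (graft_sum L \<omega> s) {#x#}) 1"
proof (rule poly_mapping_eq_lin_funI)
  fix \<phi> :: "wforest \<Rightarrow> 'a"
  obtain a R where s: "s = Node a R" by (cases s)
  obtain b G where x: "x = Node b G" by (cases x)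
  have "lin_fun \<phi> (tree_derivation x (graft_sum L \<omega> s)) =
    lin_fun (\<lambda>F. (if a = b \<and> F = G then 1 else 0) * \<phi> {#}) (forest_graft_sum L \<omega> R)"
    unfolding s x graft_sum_Node lin_fun_tree_derivation lin_fun_lin_ext
    by (rule lin_fun_cong) auto
  also have "\<dots> = lookup (graft_sum L \<omega> s) {#x#} * \<phi> {#}"
    unfolding s x lookup_graft_sum_Node lin_fun_mult_right by (simp add: lin_fun_indicator)
  finally show "lin_fun \<phi> (tree_derivation x (graft_sum L \<omega> s)) =
     lin_fun \<phi> (scal (lookup (graft_sum L \<omega> s) {#x#}) 1)"
    by (simp add: lin_fun_scal lin_fun_one)
qed

lemma lookup_times_empty:
  "lookup (Y * Z) {#} = lookup Y {#} * lookup (Z :: 'a multiset \<Rightarrow>\<^sub>0 'k::comm_ring_1) {#}"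
proof -
  have "(if P + Q = {#} then 1 else 0) = (if P = {#} then 1 else 0) * (if Q = {#} then 1 else 0 :: 'k)"
    for P Q :: "'a multiset" by auto
  then have "lookup (Y * Z) {#} =
      lin_fun (\<lambda>P. if P = {#} then 1 else 0) Y * lin_fun (\<lambda>P. if P = {#} then 1 else 0) Z"
    by (simp only: lookup_times lin_fun_mult_left lin_fun_mult_right)
  then show ?thesis by (simp only: lin_fun_indicator)
qed

text \<open>
  The differential equation of the exponential function: the weights \<open>leaf_coeff\<close> are the coefficients
  of the exponential of minus the sum of all leaves.
\<close>

lemma leaf_coeff_add_mset:
  assumes "rat_algebra (\<iota> :: rat \<Rightarrow> 'k::comm_ring_1)"
  shows "of_nat (Suc (count P x)) * leaf_coeff \<iota> (add_mset x P) = - leaf_coeff \<iota> P"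
proof -
  let ?n = "Suc (count P x)"
  have "\<iota> (1 / of_nat (multiplicity_factorial (add_mset x P))) =
      \<iota> (1 / of_nat ?n) * \<iota> (1 / of_nat (multiplicity_factorial P))"
    unfolding multiplicity_factorial_add_mset rat_algebra_props(2)[OF assms, symmetric]
    by (simp add: distrib_right)
  moreover have "of_nat ?n * \<iota> (1 / of_nat ?n) = 1"
    using rat_algebra_props(4)[OF assms, of ?n] by (simp add: mult.commute)
  ultimately have "of_nat ?n * \<iota> (1 / of_nat (multiplicity_factorial (add_mset x P))) =
      \<iota> (1 / of_nat (multiplicity_factorial P))"
    by (metis mult.assoc mult_1)
  then have "(-1) ^ size P * (of_nat ?n * \<iota> (1 / of_nat (multiplicity_factorial (add_mset x P)))) =
      (-1) ^ size P * \<iota> (1 / of_nat (multiplicity_factorial P))"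
    by (rule arg_cong)
  then show ?thesis by (simp add: leaf_coeff_def mult.left_commute[of "of_nat ?n"] del: of_nat_Suc)
qed

text \<open>
  The truncated exponential \<open>E\<close> satisfies its differential equation only in low weights, which
  suffices for the coefficient at \<open>F\<close>.
\<close>

lemma lookup_leaf_derivation_times:
  assumes \<iota>: "rat_algebra (\<iota> :: rat \<Rightarrow> 'k::comm_ring_1)"
    and L: "finite (leaf_forests W M)"
    and x: "b \<in> W" and wt: "weight (Node b G) + forest_weight F \<le> M"
  defines "E \<equiv> \<Sum>P\<in>leaf_forests W M. scal (leaf_coeff \<iota> P) (basis_elem P)"
  shows "lookup (tree_derivation (Node b G) E * Z) F =
    (if G = {#} then - lookup (E * Z) F else 0)"
proof -
  let ?x = "Node b G" and ?L = "leaf_forests W M"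
  let ?c = "\<lambda>P. lin_fun (\<lambda>Q. if P + Q = F then 1 else 0 :: 'k) Z"
  let ?e = "if G = {#} then - 1 else 0 :: 'k"
  have E: "lookup E P = (if P \<in> ?L then leaf_coeff \<iota> P else 0)" for P
    using L by (simp add: E_def lookup_sum_basis_elem)
  have coeff: "lookup (tree_derivation ?x E) P * ?c P = ?e * (lookup E P * ?c P)" for P
  proof (cases "P \<subseteq># F")
    case False
    then have "lin_fun (\<lambda>Q. if P + Q = F then 1 else 0) Z = lin_fun (\<lambda>Q. 0) Z"
      by (intro lin_fun_cong) auto
    then show ?thesis by simp
  next
    case True
    then have "weight ?x + forest_weight P \<le> M" using wt forest_weight_mono[OF True] by linarith
    then have "add_mset ?x P \<in> ?L \<longleftrightarrow> G = {#} \<and> P \<in> ?L"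
      using x by (auto simp: leaf_forests_def)
    then have "lookup (tree_derivation ?x E) P = ?e * lookup E P"
      unfolding lookup_tree_derivation E using leaf_coeff_add_mset[OF \<iota>, of P ?x] by auto
    then show ?thesis by (simp add: mult.assoc)
  qed
  define A where "A = keys E \<union> keys (tree_derivation ?x E)"
  have "lin_fun ?c (tree_derivation ?x E) = (\<Sum>P\<in>A. lookup (tree_derivation ?x E) P * ?c P)"
    by (rule lin_fun_superset) (auto simp: A_def)
  also have "\<dots> = ?e * (\<Sum>P\<in>A. lookup E P * ?c P)"
    unfolding coeff by (rule sum_distrib_left[symmetric])
  also have "(\<Sum>P\<in>A. lookup E P * ?c P) = lin_fun ?c E"
    by (rule lin_fun_superset[symmetric]) (auto simp: A_def)
  finally show ?thesis unfolding lookup_times by simp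
qed

lemma sum_mset_eq_sum_count:
  "(\<Sum>s\<in>#R. f s) = (\<Sum>s\<in>set_mset R. of_nat (count R s) * f s :: 'k::comm_ring_1)"
proof -
  have "(\<Sum>s\<in>#R. f s) = (\<Sum>s\<in>A. of_nat (count R s) * f s)" if "finite A" "set_mset R \<subseteq> A" for A
    using that(2)
  proof (induction R)
    case (add r R)
    have "(\<Sum>s\<in>A. of_nat (count (add_mset r R) s) * f s) =
        (\<Sum>s\<in>A. of_nat (count R s) * f s + (if s = r then f s else 0))"
      by (rule sum.cong) (auto simp: algebra_simps)
    also have "\<dots> = (\<Sum>s\<in>A. of_nat (count R s) * f s) + f r"
      using add.prems that(1) by (simp add: sum.distrib)
    finally show ?case using add by simp
  qed simp
  then show ?thesis by simp
qed

text \<open>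
  Grafting leaves onto \<open>R\<close> is adjoint to cutting leaves off \<open>F\<close>, where the automorphism numbers are those
  of the pairing. Both sides satisfy the same recursion when a tree \<open>x\<close> is removed from \<open>F\<close>: by the
  Leibniz rule for \<open>tree_derivation\<close>, \<open>x\<close> is either a newly attached leaf, or arises by grafting onto
  some tree \<open>s\<close> of \<open>R\<close>; in a cut, \<open>x\<close> is either cut off as a whole, or has some \<open>s\<close> as its root part.
\<close>

lemma graft_cut_duality:
  assumes \<iota>: "rat_algebra (\<iota> :: rat \<Rightarrow> 'k::comm_ring_1)" and W: "W \<subseteq> {n. n > 0}"
    and "F \<in> forests W" and "forest_weight F \<le> M"
  shows "lookup (forest_graft_sum (leaf_forests W M) (leaf_coeff \<iota>) R) F * of_nat (forest_aut F) =
    of_nat (forest_aut R) * cut_sum (\<lambda>P R'. if R' = R then leaf_char P else 0) F"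
proof -
  let ?L = "leaf_forests W M"
  have finL: "finite ?L" by (rule finite_leaf_forests[OF W])
  define E where "E = (\<Sum>P\<in>?L. scal (leaf_coeff \<iota> P) (basis_elem P))"
  define g where "g = graft_sum ?L (leaf_coeff \<iota>)"
  define Y where "Y R = E * (\<Prod>s\<in>#R. g s)" for R
  have Y_eq: "forest_graft_sum ?L (leaf_coeff \<iota>) R = Y R" for R
    by (simp add: Y_def E_def g_def forest_graft_sum_def)
  have g_Node: "lookup (g (Node a S)) {#Node b G#} =
      (if a = b then lookup (Y S) G else 0)" for a b S G
    by (simp add: g_def lookup_graft_sum_Node Y_eq del: graft_sum.simps)
  define \<delta> where "\<delta> R = cut_sum (\<lambda>P R'. if R' = R then leaf_char P else 0 :: 'k)" for R
  have "lookup (Y R) F * of_nat (forest_aut F) = of_nat (forest_aut R) * \<delta> R F"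
    using assms(3,4)
  proof (induction F arbitrary: R rule: forest_add_induct)
    case empty
    have E0: "lookup E {#} = 1"
      using finL rat_algebra_props(1)[OF \<iota>]
      by (simp add: E_def lookup_sum_basis_elem leaf_coeff_def) (simp add: leaf_forests_def)
    show ?case
    proof (cases R)
      case (add s R')
      obtain a S where s: "s = Node a S" by (cases s)
      have "lookup (g s) {#} = lin_fun (\<lambda>F. 0) (forest_graft_sum ?L (leaf_coeff \<iota>) S)"
        unfolding g_def s graft_sum_Node lookup_lin_ext
        by (rule lin_fun_cong) (auto simp: lookup_basis_elem)
      then show ?thesis by (simp add: add Y_def lookup_times_empty \<delta>_def cut_sum_empty)
    qed (simp add: Y_def E0 \<delta>_def cut_sum_empty leaf_char_empty)
  next
    case (add b G F)
    let ?x = "Node b G"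
    have b: "b \<in> W" and GW: "G \<in> forests W" and FW: "F \<in> forests W" using add.prems by auto
    have wt: "weight ?x + forest_weight F \<le> M" using add.prems by simp
    then have wtG: "forest_weight G \<le> M" and wtF: "forest_weight F \<le> M"
      by (simp_all add: weight_Node del: weight.simps)
    note IHG = add.IH(1)[OF GW wtG] and IHF = add.IH(2)[OF FW wtF]
    \<comment> \<open>\<open>\<gamma> s\<close> counts the leaf cuts of the tree \<open>x\<close> with root part \<open>s\<close>.\<close>
    define \<gamma> where "\<gamma> s = cut_sum (\<lambda>P S. if s = Node b S then leaf_char P else 0 :: 'k) G" for s
    have \<gamma>: "lookup (g s) {#?x#} * of_nat (tree_aut ?x) = of_nat (tree_aut s) * \<gamma> s" for s
    proof -
      obtain a S where s: "s = Node a S" by (cases s)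
      show ?thesis
      proof (cases "a = b")
        case True
        have "\<gamma> s = \<delta> S G" by (simp add: \<gamma>_def \<delta>_def s True eq_commute)
        then show ?thesis using IHG[of S] by (simp add: s True g_Node tree_aut_Node del: tree_aut.simps)
      next
        case False
        then show ?thesis by (simp add: s g_Node \<gamma>_def)
      qed
    qed
    have "of_nat (Suc (count F ?x)) * lookup (Y R) (add_mset ?x F) =
        lookup (tree_derivation ?x (Y R)) F"
      by (simp only: lookup_tree_derivation)
    also have "tree_derivation ?x (Y R) = tree_derivation ?x E * (\<Prod>s\<in>#R. g s) +
        (\<Sum>s\<in>#R. scal (lookup (g s) {#?x#}) (Y (R - {#s#})))"
    proof -
      have "E * (scal c 1 * Z) = scal c (E * Z)" for c and Z :: "wforest \<Rightarrow>\<^sub>0 'k"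
        using scal_times[of c 1 1 "E * Z"] by (simp add: ac_simps)
      then show ?thesis
        by (simp add: Y_def tree_derivation_times tree_derivation_prod_mset sum_mset_distrib_left
            g_def tree_derivation_graft_sum)
    qed
    also have "lookup \<dots> F = (if G = {#} then - lookup (Y R) F else 0) +
        (\<Sum>s\<in>#R. lookup (g s) {#?x#} * lookup (Y (R - {#s#})) F)"
    proof -
      have "lookup (\<Sum>s\<in>#R. h s) F = (\<Sum>s\<in>#R. lookup (h s) F)"
        for h :: "wtree \<Rightarrow> wforest \<Rightarrow>\<^sub>0 'k" and R
        by (induction R) (simp_all add: lookup_add)
      then show ?thesis
        using lookup_leaf_derivation_times[OF \<iota> finL b wt, of "\<Prod>s\<in>#R. g s"]
        by (simp add: lookup_add E_def Y_def)
    qed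
    finally have step: "of_nat (Suc (count F ?x)) * lookup (Y R) (add_mset ?x F) =
        (if G = {#} then - lookup (Y R) F else 0) +
        (\<Sum>s\<in>#R. lookup (g s) {#?x#} * lookup (Y (R - {#s#})) F)" .
    let ?ax = "of_nat (tree_aut ?x) :: 'k" and ?aF = "of_nat (forest_aut F) :: 'k"
    have "lookup (Y R) (add_mset ?x F) * of_nat (forest_aut (add_mset ?x F)) =
      ?ax * ?aF * (of_nat (Suc (count F ?x)) * lookup (Y R) (add_mset ?x F))"
      by (simp only: forest_aut_add_mset of_nat_mult ac_simps)
    also have "\<dots> = (if G = {#} then - (lookup (Y R) F * ?aF) else 0) +
        (\<Sum>s\<in>#R. (lookup (g s) {#?x#} * ?ax) * (lookup (Y (R - {#s#})) F * ?aF))"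
      unfolding step by (simp add: distrib_left sum_mset_distrib_left ac_simps)
    also have "\<dots> = (if G = {#} then - (of_nat (forest_aut R) * \<delta> R F) else 0) +
        (\<Sum>s\<in>#R. of_nat (tree_aut s) * \<gamma> s * (of_nat (forest_aut (R - {#s#})) * \<delta> (R - {#s#}) F))"
      by (simp only: IHF \<gamma>)
    also have "(\<Sum>s\<in>#R. of_nat (tree_aut s) * \<gamma> s * (of_nat (forest_aut (R - {#s#})) * \<delta> (R - {#s#}) F)) =
       of_nat (forest_aut R) * (\<Sum>s\<in>set_mset R. \<gamma> s * \<delta> (R - {#s#}) F)"
    proof -
      have "(\<Sum>s\<in>#R. f s) = (\<Sum>s\<in>set_mset R. of_nat (count R s) * f s)" for f :: "wtree \<Rightarrow> 'k"
        by (rule sum_mset_eq_sum_count)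
      moreover have "of_nat (count R s) * (of_nat (tree_aut s) * \<gamma> s * (of_nat (forest_aut (R - {#s#})) * \<delta> (R - {#s#}) F))
          = of_nat (forest_aut R) * (\<gamma> s * \<delta> (R - {#s#}) F)" if "s \<in># R" for s
      proof -
        have "forest_aut R = count R s * tree_aut s * forest_aut (R - {#s#})"
          using that forest_aut_add_mset[of s "R - {#s#}"] by simp
        then show ?thesis by (simp add: ac_simps)
      qed
      ultimately show ?thesis by (simp add: sum_distrib_left)
    qed
    also have "(if G = {#} then - (of_nat (forest_aut R) * \<delta> R F) else 0) +
        of_nat (forest_aut R) * (\<Sum>s\<in>set_mset R. \<gamma> s * \<delta> (R - {#s#}) F) =
        of_nat (forest_aut R) * ((if G = {#} then - \<delta> R F else 0) + (\<Sum>s\<in>set_mset R. \<gamma> s * \<delta> (R - {#s#}) F))"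
      by (simp add: distrib_left)
    also have "(if G = {#} then - \<delta> R F else 0) = cut_sum (\<lambda>P R'. if R' = R then leaf_char (add_mset ?x P) else 0) F"
    proof -
      have "(\<lambda>P R'. if R' = R then leaf_char (add_mset ?x P) else 0 :: 'k) =
         (\<lambda>P R'. (if G = {#} then - 1 else 0) * (if R' = R then leaf_char P else 0))"
        by (intro ext) (simp add: leaf_char_add_mset)
      then show ?thesis by (simp only: cut_sum_mult_left \<delta>_def) simp
    qed
    also have "(\<Sum>s\<in>set_mset R. \<gamma> s * \<delta> (R - {#s#}) F) =
       cut_sum (\<lambda>P S. cut_sum (\<lambda>P' R'. if add_mset (Node b S) R' = R then leaf_char (P + P') else 0) F) G"
    proof -
      have "(if add_mset (Node b S) R' = R then leaf_char (P + P') else 0) =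
        (\<Sum>s\<in>set_mset R. (if s = Node b S then leaf_char P else 0) *
          (if R' = R - {#s#} then leaf_char P' else 0 :: 'k))" for S R' P P'
      proof -
        have "(\<Sum>s\<in>set_mset R. (if s = Node b S then leaf_char P else 0) *
          (if R' = R - {#s#} then leaf_char P' else 0 :: 'k)) =
          (\<Sum>s\<in>set_mset R. if s = Node b S then leaf_char P *
            (if R' = R - {#Node b S#} then leaf_char P' else 0 :: 'k) else 0)"
          by (rule sum.cong) auto
        also have "\<dots> = (if Node b S \<in># R then leaf_char P * (if R' = R - {#Node b S#} then leaf_char P' else 0) else 0)"
          by simp
        also have "\<dots> = (if add_mset (Node b S) R' = R then leaf_char (P + P') else 0)"
          by (auto simp: leaf_char_union)
        finally show ?thesis by simp
      qed
      then have "cut_sum (\<lambda>P S. cut_sum (\<lambda>P' R'. if add_mset (Node b S) R' = R then leaf_char (P + P') else 0 :: 'k) F) G =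
        cut_sum (\<lambda>P S. cut_sum (\<lambda>P' R'. \<Sum>s\<in>set_mset R. (if s = Node b S then leaf_char P else 0) *
          (if R' = R - {#s#} then leaf_char P' else 0)) F) G"
        by (simp only:)
      also have "\<dots> = (\<Sum>s\<in>set_mset R. \<gamma> s * \<delta> (R - {#s#}) F)"
        by (simp only: cut_sum_sum cut_sum_mult_left cut_sum_mult_right \<gamma>_def \<delta>_def)
      finally show ?thesis by simp
    qed
    also have "cut_sum (\<lambda>P R'. if R' = R then leaf_char (add_mset ?x P) else 0) F +
       cut_sum (\<lambda>P S. cut_sum (\<lambda>P' R'. if add_mset (Node b S) R' = R then leaf_char (P + P') else 0) F) G =
       \<delta> R (add_mset ?x F)"
      unfolding \<delta>_def cut_sum_add_mset ..
    finally show ?case .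
  qed
  then show ?thesis by (simp add: Y_eq \<delta>_def)
qed

definition gl_functional :: "(wtree \<Rightarrow>\<^sub>0 'k::comm_ring_1) \<Rightarrow> wforest \<Rightarrow> 'k" where
  "gl_functional X F = lookup X (Node 0 F) * of_nat (forest_aut F)"

text \<open>
  Pairing with \<open>T\<^sub>W(\<Lambda>\<^sub>m)\<close>; the automorphism number in the pairing cancels the one in the
  denominator of \<open>T / \<alpha>(T)\<close>.
\<close>

definition lambda_functional :: "nat \<Rightarrow> wforest \<Rightarrow> 'k::comm_ring_1" where
  "lambda_functional m P = (if forest_weight P = m then (-1) ^ m * leaf_char P else 0)"

lemma gl_ck_pairing_eq: "gl_ck_pairing X y = lin_fun (gl_functional X) y"
proof -
  have "gl_ck_pairing X y = lin_fun (\<lambda>F. lin_fun (\<lambda>T. if T = Node 0 F then of_nat (forest_aut F) else 0) X) y"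
    unfolding gl_ck_pairing_def
    by (subst sum.swap)
      (auto simp: lin_fun_def B_plus_def num_automorphisms_eq_tree_aut tree_aut_Node sum_distrib_left mult.assoc
        mult.left_commute simp del: tree_aut.simps intro!: sum.cong)
  also have "\<dots> = lin_fun (gl_functional X) y"
  proof (rule lin_fun_cong)
    fix F
    have "lin_fun (\<lambda>T. if T = Node 0 F then of_nat (forest_aut F) else 0) X =
      lin_fun (\<lambda>T. (if T = Node 0 F then 1 else 0) * of_nat (forest_aut F)) X"
      by (rule lin_fun_cong) auto
    also have "\<dots> = gl_functional X F"
      unfolding lin_fun_mult_right lin_fun_indicator gl_functional_def ..
    finally show "lin_fun (\<lambda>T. if T = Node 0 F then of_nat (forest_aut F) else 0) X = gl_functional X F" .
  qed
  finally show ?thesis .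
qed

text \<open>
  Multiplication by \<open>T\<^sub>W(\<Lambda>\<^sub>m)\<close> from the left becomes convolution with its functional.
\<close>

lemma gl_functional_TW_Lambda:
  assumes \<iota>: "rat_algebra (\<iota> :: rat \<Rightarrow> 'k::comm_ring_1)" and W: "W \<subseteq> {n. n > 0}"
    and F: "F \<in> forests W"
  shows "gl_functional (gl_mult (TW_Lambda \<iota> W m) X) F = cut_sum (\<lambda>P R. lambda_functional m P * gl_functional X R) F"
proof -
  \<comment> \<open>Large enough for both the grafted leaves and the resulting forest.\<close>
  define M where "M = m + forest_weight F"
  have le: "forest_weight F \<le> M" by (simp add: M_def)
  let ?L = "leaf_forests W M"
  let ?g = "\<lambda>S R'. if S = Node 0 R' then 1 else 0 :: 'k"
  have S: "(-1) ^ m * (if weight (Node 0 F) = m + weight S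
        then lookup (graft_sum ?L (leaf_coeff \<iota>) S) {#Node 0 F#} else 0) * of_nat (forest_aut F) =
      cut_sum (\<lambda>P R'. lambda_functional m P * (?g S R' * of_nat (forest_aut R'))) F" for S
  proof -
    obtain a R where S: "S = Node a R" by (cases S)
    show ?thesis
    proof (cases "a = 0")
      case False
      then show ?thesis by (simp add: S lookup_graft_sum_Node del: graft_sum.simps)
    next
      case True
      have "(-1) ^ m * (if weight (Node 0 F) = m + weight S
          then lookup (graft_sum ?L (leaf_coeff \<iota>) S) {#Node 0 F#} else 0) * of_nat (forest_aut F) =
        (if forest_weight F = m + forest_weight R then (-1) ^ m * of_nat (forest_aut R) else 0) *
          cut_sum (\<lambda>P R'. if R' = R then leaf_char P else 0) F"
        using graft_cut_duality[OF \<iota> W F le, of R]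
        by (simp add: S True lookup_graft_sum_Node weight_Node mult.assoc del: weight.simps graft_sum.simps)
      also have "\<dots> = cut_sum (\<lambda>P R'. (if forest_weight F = m + forest_weight R then (-1) ^ m * of_nat (forest_aut R) else 0) *
          (if R' = R then leaf_char P else 0)) F"
        by (rule cut_sum_mult_left[symmetric])
      also have "\<dots> = cut_sum (\<lambda>P R'. lambda_functional m P * (?g S R' * of_nat (forest_aut R'))) F"
        by (rule cut_sum_cong[OF F]) (auto simp: lambda_functional_def S True)
      finally show ?thesis .
    qed
  qed
  have "gl_functional (gl_mult (TW_Lambda \<iota> W m) X) F =
    lin_fun (\<lambda>S. (-1) ^ m * (if weight (Node 0 F) = m + weight S
        then lookup (graft_sum ?L (leaf_coeff \<iota>) S) {#Node 0 F#} else 0) * of_nat (forest_aut F)) X"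
    unfolding gl_functional_def using lookup_gl_mult_TW_Lambda[OF \<iota> W, of m M X "Node 0 F"]
    by (simp only: lin_fun_mult_left lin_fun_mult_right) (simp add: M_def)
  also have "\<dots> = cut_sum (\<lambda>P R'. lambda_functional m P * (lin_fun (\<lambda>S. ?g S R') X * of_nat (forest_aut R'))) F"
    unfolding S lin_fun_cut_sum_swap by (simp only: lin_fun_mult_left lin_fun_mult_right)
  also have "\<dots> = cut_sum (\<lambda>P R. lambda_functional m P * gl_functional X R) F"
    by (simp only: lin_fun_indicator gl_functional_def)
  finally show ?thesis .
qed

section \<open>The complete functions\<close>

lemma lin_fun_ns_mult: "lin_fun \<phi> (ns_mult x y) = lin_fun (\<lambda>u. lin_fun (\<lambda>v. \<phi> (u @ v)) y) x"
  by (simp add: ns_mult_def lin_fun_bilin_ext)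

lemma ns_mult_assoc: "ns_mult (ns_mult x y) z = ns_mult x (ns_mult y z)"
  by (rule poly_mapping_eq_lin_funI) (simp add: lin_fun_ns_mult)

lemma ns_mult_unit [simp]: "ns_mult (basis_elem []) x = x" "ns_mult x (basis_elem []) = x"
  by (rule poly_mapping_eq_lin_funI, simp add: lin_fun_ns_mult)+

lemma ns_mult_basis_elem: "ns_mult (basis_elem u) (basis_elem v) = basis_elem (u @ v)"
  by (simp add: ns_mult_def)

lemma ns_mult_linear:
  "ns_mult (sum f A) y = (\<Sum>a\<in>A. ns_mult (f a) y)"
  "ns_mult y (sum f A) = (\<Sum>a\<in>A. ns_mult y (f a))"
  "ns_mult (scal c x) y = scal c (ns_mult x y)"
  "ns_mult x (scal c y) = scal c (ns_mult x y)"
  "ns_mult 0 y = 0"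
  "ns_mult y 0 = 0"
  by (rule poly_mapping_eq_lin_funI,
      simp add: lin_fun_ns_mult lin_fun_sum lin_fun_scal lin_fun_mult_left lin_fun_sum_functional)+

definition elementary_sym :: "nat \<Rightarrow> (nat list \<Rightarrow>\<^sub>0 'k::comm_ring_1)" where
  "elementary_sym n = basis_elem (if n = 0 then [] else [n])"

definition signed_elementary :: "nat \<Rightarrow> (nat list \<Rightarrow>\<^sub>0 'k::comm_ring_1)" where
  "signed_elementary n = scal ((-1) ^ n) (elementary_sym n)"

lemma sum_triangle_swap:
  fixes f :: "nat \<Rightarrow> nat \<Rightarrow> 'a::comm_monoid_add"
  shows "(\<Sum>i\<le>n. \<Sum>k\<le>n - i. f i k) = (\<Sum>k\<le>n. \<Sum>i\<le>n - k. f i k)"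
proof -
  have *: "(\<Sum>k\<le>n - i. h k) = (\<Sum>k\<le>n. if i + k \<le> n then h k else 0)" if "i \<le> n" for h :: "nat \<Rightarrow> 'a" and i
  proof -
    have "{..n - i} = {k \<in> {..n}. i + k \<le> n}" using that by auto
    then show ?thesis by (simp only: sum.inter_filter finite_atMost)
  qed
  have "(\<Sum>i\<le>n. \<Sum>k\<le>n - i. f i k) = (\<Sum>i\<le>n. \<Sum>k\<le>n. if i + k \<le> n then f i k else 0)"
    by (rule sum.cong) (auto simp: *)
  also have "\<dots> = (\<Sum>k\<le>n. \<Sum>i\<le>n. if i + k \<le> n then f i k else 0)"
    by (rule sum.swap)
  also have "\<dots> = (\<Sum>k\<le>n. \<Sum>i\<le>n - k. f i k)"
    by (rule sum.cong) (auto simp: * add.commute)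
  finally show ?thesis .
qed

text \<open>
  The defining recursion of the complete functions, read as the statement that their generating
  series is a right inverse of the generating series \<open>\<lambda>\<close> of the signed elementary functions.
\<close>

lemma elementary_complete:
  "(\<Sum>i\<le>n. ns_mult (signed_elementary i) (complete_sym (n - i))) =
     (if n = 0 then basis_elem [] else (0 :: nat list \<Rightarrow>\<^sub>0 'k::comm_ring_1))"
proof (cases n)
  case 0
  then show ?thesis by (simp add: signed_elementary_def elementary_sym_def)
next
  case (Suc m)
  have "(\<Sum>i\<le>m. ns_mult (signed_elementary (Suc i)) (complete_sym (m - i))) =
     (\<Sum>i\<le>m. scal (-1) (scal ((-1) ^ i) (ns_mult (basis_elem [Suc i]) (complete_sym (m - i)) :: nat list \<Rightarrow>\<^sub>0 'k)))"
    by (rule sum.cong) (auto simp: signed_elementary_def elementary_sym_def ns_mult_linear scal_scal)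
  also have "\<dots> = scal (-1) (complete_sym (Suc m))" by (simp add: scal_sum)
  finally have "(\<Sum>i\<le>m. ns_mult (signed_elementary (Suc i)) (complete_sym (m - i))) =
    (scal (-1) (complete_sym (Suc m)) :: nat list \<Rightarrow>\<^sub>0 'k)" .
  then have "(\<Sum>i\<le>n. ns_mult (signed_elementary i) (complete_sym (n - i))) =
      complete_sym (Suc m) + (scal (-1) (complete_sym (Suc m)) :: nat list \<Rightarrow>\<^sub>0 'k)"
    unfolding Suc sum.atMost_Suc_shift
    by (simp add: signed_elementary_def[of 0] elementary_sym_def[of 0] del: complete_sym.simps)
  also have "\<dots> = 0" by (rule poly_mapping_eqI) (simp add: lookup_add del: complete_sym.simps)
  finally show ?thesis using Suc by simp
qed

text \<open>
  A right inverse of a power series with constant term \<open>1\<close> is also a left inverse: the product \<open>R\<close> of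
  the two series in the other order satisfies \<open>\<lambda> R = \<lambda>\<close>, and \<open>\<lambda>\<close> can be cancelled degree by degree.
\<close>

lemma complete_elementary:
  "(\<Sum>i\<le>n. ns_mult (complete_sym (n - i)) (signed_elementary i)) =
     (if n = 0 then basis_elem [] else (0 :: nat list \<Rightarrow>\<^sub>0 'k::comm_ring_1))"
proof (induction n rule: less_induct)
  case (less n)
  define R where "R n = (\<Sum>i\<le>n. ns_mult (complete_sym (n - i)) (signed_elementary i) :: nat list \<Rightarrow>\<^sub>0 'k)" for n
  have "(\<Sum>i\<le>n. ns_mult (signed_elementary i) (R (n - i))) =
     (\<Sum>i\<le>n. \<Sum>k\<le>n - i. ns_mult (ns_mult (signed_elementary i) (complete_sym (n - i - k))) (signed_elementary k))"
    by (simp add: R_def ns_mult_linear ns_mult_assoc)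
  also have "\<dots> = (\<Sum>k\<le>n. ns_mult (\<Sum>i\<le>n - k. ns_mult (signed_elementary i) (complete_sym (n - k - i))) (signed_elementary k))"
    by (subst sum_triangle_swap) (simp add: ns_mult_linear add.commute)
  also have "\<dots> = (\<Sum>k\<le>n. if n - k = 0 then signed_elementary k else 0)"
    unfolding elementary_complete by (rule sum.cong) (auto simp: ns_mult_linear)
  also have "\<dots> = (\<Sum>k\<le>n. if k = n then signed_elementary k else 0)"
    by (rule sum.cong) auto
  finally have sum: "(\<Sum>i\<le>n. ns_mult (signed_elementary i) (R (n - i))) = signed_elementary n"
    by simp
  show ?case
  proof (cases n)
    case 0
    then show ?thesis by (simp add: signed_elementary_def elementary_sym_def)
  next
    case (Suc m)
    have "ns_mult (signed_elementary (Suc i)) (R (m - i)) = (if i = m then signed_elementary (Suc m) else 0)"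
      if "i \<le> m" for i
      using less[of "m - i"] that Suc by (auto simp: R_def ns_mult_linear)
    then have "(\<Sum>i\<le>m. ns_mult (signed_elementary (Suc i)) (R (m - i))) =
        (\<Sum>i\<le>m. if i = m then signed_elementary (Suc m) else 0)"
      by (intro sum.cong) auto
    then have "R (Suc m) + signed_elementary (Suc m) = signed_elementary (Suc m)"
      using sum unfolding Suc sum.atMost_Suc_shift
      by (simp add: signed_elementary_def[of 0] elementary_sym_def[of 0])
    then show ?thesis using Suc by (simp add: R_def)
  qed
qed

lemma complete_word_Cons: "complete_word (m # w) = ns_mult (complete_sym m) (complete_word w)"
  by (simp add: complete_word_def)

lemma complete_word_Nil: "complete_word [] = basis_elem []"
  by (simp add: complete_word_def)

lemma complete_word_append: "complete_word (u @ v) = ns_mult (complete_word u) (complete_word v)"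
  by (induction u) (simp_all add: complete_word_Cons complete_word_Nil ns_mult_assoc)

lemma complete_hom: "lin_ext complete_word (ns_mult x y) =
   ns_mult (lin_ext complete_word x) (lin_ext complete_word y)"
proof (rule poly_mapping_eq_lin_funI)
  fix \<phi> :: "nat list \<Rightarrow> 'a"
  have "lin_fun \<phi> (ns_mult (lin_ext complete_word x) (lin_ext complete_word y)) =
    lin_fun (\<lambda>u. lin_fun (\<lambda>s. lin_fun (\<lambda>v. lin_fun (\<lambda>t. \<phi> (s @ t)) (complete_word v)) y) (complete_word u)) x"
    by (simp add: lin_fun_ns_mult lin_fun_lin_ext)
  also have "\<dots> = lin_fun (\<lambda>u. lin_fun (\<lambda>v. lin_fun (\<lambda>s. lin_fun (\<lambda>t. \<phi> (s @ t)) (complete_word v)) (complete_word u)) y) x"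
    by (subst lin_fun_swap) (rule refl)
  finally show "lin_fun \<phi> (lin_ext complete_word (ns_mult x y)) =
    lin_fun \<phi> (ns_mult (lin_ext complete_word x) (lin_ext complete_word y))"
    by (simp add: lin_fun_ns_mult lin_fun_lin_ext complete_word_append)
qed

text \<open>
  The algebra endomorphism that sends the elementary to the complete functions also sends the complete
  to the elementary functions. So it is an involution on \<open>NSym\<close>, which computes coordinates with
  respect to the products of complete functions.
\<close>

lemma complete_hom_complete_sym:
  "lin_ext complete_word (complete_sym n) = (elementary_sym n :: nat list \<Rightarrow>\<^sub>0 'k::comm_ring_1)"
proof (induction n rule: less_induct)
  case (less n)
  show ?case
  proof (cases n)
    case 0
    then show ?thesis by (simp add: elementary_sym_def complete_word_Nil)
  next
    case (Suc m)
    let ?t = "\<lambda>i. ns_mult (complete_sym (Suc i)) (elementary_sym (m - i)) :: nat list \<Rightarrow>\<^sub>0 'k"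
    have "lin_ext complete_word (complete_sym n) = (\<Sum>i\<le>m. scal ((-1) ^ i)
       (ns_mult (complete_word [Suc i]) (lin_ext complete_word (complete_sym (m - i))) :: nat list \<Rightarrow>\<^sub>0 'k))"
      by (simp add: Suc lin_ext_sum lin_ext_scal complete_hom)
    also have "\<dots> = (\<Sum>i\<le>m. scal ((-1) ^ i) (?t i))"
    proof (rule sum.cong)
      fix i assume "i \<in> {..m}"
      then have "lin_ext complete_word (complete_sym (m - i)) = (elementary_sym (m - i) :: nat list \<Rightarrow>\<^sub>0 'k)"
        using less[of "m - i"] Suc by auto
      then show "scal ((-1) ^ i) (ns_mult (complete_word [Suc i]) (lin_ext complete_word (complete_sym (m - i)))) =
          scal ((-1) ^ i) (?t i)"
        by (simp add: complete_word_Cons complete_word_Nil del: complete_sym.simps)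
    qed simp
    \<comment> \<open>The order of summation is reversed to reach the form of \<open>complete_elementary\<close>.\<close>
    also have "\<dots> = (\<Sum>j\<le>m. scal ((-1) ^ (m - j)) (ns_mult (complete_sym (Suc m - j)) (elementary_sym j)))"
      by (subst sum.atLeastAtMost_rev[of _ 0 m, simplified atLeast0AtMost])
        (rule sum.cong, auto simp: Suc_diff_le simp del: complete_sym.simps)
    also have "\<dots> = (\<Sum>j\<le>m. scal ((-1) ^ m) (ns_mult (complete_sym (Suc m - j)) (signed_elementary j)))"
    proof (rule sum.cong)
      fix j assume "j \<in> {..m}"
      then obtain k where k: "m = j + k" by (auto dest: le_Suc_ex)
      have "(-1) ^ m * (-1) ^ j = ((-1) ^ (m - j) :: 'k)"
        by (simp add: k power_add mult.assoc mult.commute[of "(-1) ^ k"])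
      then show "scal ((-1) ^ (m - j)) (ns_mult (complete_sym (Suc m - j)) (elementary_sym j)) =
         (scal ((-1) ^ m) (ns_mult (complete_sym (Suc m - j)) (signed_elementary j)) :: nat list \<Rightarrow>\<^sub>0 'k)"
        by (simp add: signed_elementary_def ns_mult_linear scal_scal del: complete_sym.simps)
    qed simp
    also have "\<dots> = scal ((-1) ^ m) (\<Sum>j\<le>m. ns_mult (complete_sym (Suc m - j)) (signed_elementary j))"
      by (simp add: scal_sum del: complete_sym.simps)
    also have "(\<Sum>j\<le>m. ns_mult (complete_sym (Suc m - j)) (signed_elementary j)) =
        - (signed_elementary (Suc m) :: nat list \<Rightarrow>\<^sub>0 'k)"
      using complete_elementary[of "Suc m", where 'k = 'k] unfolding sum.atMost_Suc
      by (simp add: eq_neg_iff_add_eq_0 del: complete_sym.simps(2))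
    also have "scal ((-1) ^ m) (- signed_elementary (Suc m)) = (elementary_sym (Suc m) :: nat list \<Rightarrow>\<^sub>0 'k)"
      by (rule poly_mapping_eqI) (simp add: signed_elementary_def flip: mult.assoc power_add mult_2)
    finally show ?thesis by (simp only: Suc)
  qed
qed

lemma complete_hom_complete_word:
  "w \<in> compositions \<Longrightarrow> lin_ext complete_word (complete_word w) = basis_elem w"
proof (induction w)
  case (Cons m w)
  then have "w \<in> compositions" "m \<noteq> 0" by (auto simp: compositions_def)
  then show ?case
    using Cons.IH by (simp add: complete_word_Cons complete_hom complete_hom_complete_sym
        elementary_sym_def ns_mult_basis_elem)
qed (simp add: complete_word_Nil)

lemma complete_hom_involution:
  assumes "x \<in> NSym"
  shows "lin_ext complete_word (lin_ext complete_word x) = x"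
proof -
  have "lin_ext complete_word (lin_ext complete_word x) = lin_ext basis_elem x"
    unfolding lin_ext_lin_ext
    by (rule lin_ext_cong) (use assms in \<open>auto simp: NSym_def complete_hom_complete_word\<close>)
  then show ?thesis by simp
qed

lemma ns_mult_NSym: "x \<in> NSym \<Longrightarrow> y \<in> NSym \<Longrightarrow> ns_mult x y \<in> NSym"
proof -
  assume xy: "x \<in> NSym" "y \<in> NSym"
  have "keys (ns_mult x y) \<subseteq> compositions"
    unfolding ns_mult_def bilin_ext_def
  proof (intro keys_lin_ext)
    fix u v assume "u \<in> keys x" "v \<in> keys y"
    then have "u @ v \<in> compositions" using xy by (auto simp: NSym_def compositions_def)
    then show "keys (basis_elem (u @ v)) \<subseteq> compositions" by simp
  qed
  then show ?thesis by (simp add: NSym_def)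
qed

lemma complete_sym_NSym: "(complete_sym n :: nat list \<Rightarrow>\<^sub>0 'k::comm_ring_1) \<in> NSym"
proof (induction n rule: less_induct)
  case (less n)
  show ?case
  proof (cases n)
    case 0
    then show ?thesis by (simp add: NSym_def compositions_def)
  next
    case (Suc m)
    have "(scal ((-1) ^ i) (ns_mult (basis_elem [Suc i]) (complete_sym (m - i))) :: nat list \<Rightarrow>\<^sub>0 'k) \<in> NSym" for i
    proof -
      have "(ns_mult (basis_elem [Suc i]) (complete_sym (m - i)) :: nat list \<Rightarrow>\<^sub>0 'k) \<in> NSym"
        by (rule ns_mult_NSym[OF _ less]) (auto simp: NSym_def compositions_def Suc)
      then show ?thesis using keys_scal by (fastforce simp: NSym_def)
    qed
    then show ?thesis unfolding Suc complete_sym.simps NSym_def mem_Collect_eq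
      by (intro order_trans[OF keys_sum] UN_least) auto
  qed
qed

lemma complete_word_NSym: "complete_word w \<in> NSym"
  by (induction w) (simp_all add: complete_word_Cons complete_word_Nil ns_mult_NSym complete_sym_NSym,
      simp add: NSym_def compositions_def)

lemma complete_hom_NSym: "lin_ext complete_word x \<in> NSym"
  using keys_lin_ext[of x complete_word compositions] complete_word_NSym by (auto simp: NSym_def)

lemma complete_coords_eq:
  assumes "x \<in> NSym"
  shows "complete_coords x = lin_ext complete_word x"
  unfolding complete_coords_def
proof (rule the_equality)
  show "keys (lin_ext complete_word x) \<subseteq> compositions \<and>
      lin_ext complete_word (lin_ext complete_word x) = x"
    using complete_hom_NSym[of x] complete_hom_involution[OF assms] by (simp add: NSym_def)
  fix c assume "keys c \<subseteq> compositions \<and> lin_ext complete_word c = x"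
  then show "c = lin_ext complete_word x" using complete_hom_involution[of c] by (auto simp: NSym_def)
qed

section \<open>The transposed map\<close>

text \<open>
  The functional of \<open>T\<^sub>W(S\<^sub>m)\<close>, where \<open>S\<^sub>m\<close> is the complete function.
\<close>

definition complete_functional :: "nat \<Rightarrow> wforest \<Rightarrow> 'k::comm_ring_1" where
  "complete_functional m P = (if forest_weight P = m then 1 else 0)"

text \<open>
  The first letter \<open>m\<close> is the weight of the part that is cut off, the other letters are distributed on the
  remaining forest. So this counts the maps from the vertices of \<open>F\<close> to the positions of \<open>w\<close> that weakly
  decrease away from the roots and have fibers of the prescribed weights.
\<close>

primrec qsym_coeff :: "nat list \<Rightarrow> wforest \<Rightarrow> 'k::comm_ring_1" where
  "qsym_coeff [] F = (if F = {#} then 1 else 0)"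
| "qsym_coeff (m # w) F = cut_sum (\<lambda>P R. complete_functional m P * qsym_coeff w R) F"

lemma forest_weight_eq_zero:
  assumes "W \<subseteq> {n. n > 0}" "F \<in> forests W"
  shows "forest_weight F = 0 \<longleftrightarrow> F = {#}"
proof (cases F)
  case (add T F')
  then have "tree_root T \<in> W" using assms(2) by (cases T) auto
  then have "0 < weight T" using assms(1) weight_ge_root[of T] by auto
  then show ?thesis using add by simp
qed simp

text \<open>
  The recursion of the complete functions for the functionals. As weights add up in a cut, the sum over \<open>i\<close>
  runs over all cuts with \<open>P\<close> nonempty; by \<open>cut_sum_leaf_char\<close> only the missing term for \<open>P\<close> empty
  survives.
\<close>

lemma lambda_complete:
  assumes W: "W \<subseteq> {n. n > 0}" and F: "F \<in> forests W"
  shows "(\<Sum>i\<le>n. (-1) ^ i * cut_sum (\<lambda>P R. lambda_functional (Suc i) P * complete_functional (n - i) R) F) =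
    (complete_functional (Suc n) F :: 'k::comm_ring_1)"
proof -
  have "(\<Sum>i\<le>n. (-1) ^ i * cut_sum (\<lambda>P R. lambda_functional (Suc i) P * complete_functional (n - i) R) F) =
     (cut_sum (\<lambda>P R. \<Sum>i\<le>n. (-1) ^ i * (lambda_functional (Suc i) P * complete_functional (n - i) R)) F :: 'k)"
    by (simp only: cut_sum_sum cut_sum_mult_left)
  also have "\<dots> = cut_sum (\<lambda>P R. (if forest_weight F = Suc n then 1 else 0) *
      ((if P = {#} then 1 else 0) + (-1) * leaf_char P)) F"
  proof (rule cut_sum_cong[OF F])
    fix P R assume PR: "P \<in> forests W" "R \<in> forests W" "forest_weight P + forest_weight R = forest_weight F"
    have "(\<Sum>i\<le>n. (-1) ^ i * (lambda_functional (Suc i) P * complete_functional (n - i) R)) =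
      (\<Sum>i\<le>n. if Suc i = forest_weight P \<and> forest_weight F = Suc n then - leaf_char P else 0 :: 'k)"
    proof (rule sum.cong)
      fix i assume i: "i \<in> {..n}"
      have "(-1) ^ i * ((-1) ^ Suc i * leaf_char P) = (- leaf_char P :: 'k)"
        by simp
      moreover have "forest_weight P = Suc i \<and> forest_weight R = n - i \<longleftrightarrow>
          Suc i = forest_weight P \<and> forest_weight F = Suc n"
        using i PR(3) by auto
      ultimately show "(-1) ^ i * (lambda_functional (Suc i) P * complete_functional (n - i) R) =
         (if Suc i = forest_weight P \<and> forest_weight F = Suc n then - leaf_char P else 0 :: 'k)"
        unfolding lambda_functional_def complete_functional_def
        by (cases "forest_weight P = Suc i"; cases "forest_weight R = n - i") simp_all
    qed simp
    also have "\<dots> = (if forest_weight F = Suc n \<and> P \<noteq> {#} then - leaf_char P else 0)"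
    proof (cases "forest_weight F = Suc n \<and> P \<noteq> {#}")
      case True
      then obtain j where j: "forest_weight P = Suc j"
        using forest_weight_eq_zero[OF W PR(1)] by (cases "forest_weight P") auto
      then have "j \<le> n" using PR(3) True by linarith
      then show ?thesis using True j by simp
    next
      case False
      then show ?thesis by auto
    qed
    also have "\<dots> = (if forest_weight F = Suc n then 1 else 0) * ((if P = {#} then 1 else 0) + (-1) * leaf_char P)"
      by (simp add: leaf_char_empty)
    finally show "(\<Sum>i\<le>n. (-1) ^ i * (lambda_functional (Suc i) P * complete_functional (n - i) R)) =
      (if forest_weight F = Suc n then 1 else 0) * ((if P = {#} then 1 else 0) + (-1) * (leaf_char P :: 'k))" .
  qed
  also have "\<dots> = (if forest_weight F = Suc n then 1 else 0) * (1 - (if F = {#} then 1 else 0))"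
    using cut_sum_left_counit[of "\<lambda>_. 1 :: 'k" F] by (simp only: cut_sum_mult_left cut_sum_add cut_sum_leaf_char) simp
  also have "\<dots> = complete_functional (Suc n) F" by (auto simp: complete_functional_def)
  finally show ?thesis .
qed

lemma gl_functional_linear:
  "gl_functional (sum f A) F = (\<Sum>a\<in>A. gl_functional (f a) F)"
  "gl_functional (scal c X) F = c * gl_functional X F"
  "gl_functional (lin_ext g x) F = lin_fun (\<lambda>a. gl_functional (g a) F) x"
  by (simp_all add: gl_functional_def lookup_sum sum_distrib_right mult.assoc lookup_lin_ext lin_fun_mult_right)

lemma TW_Nil: "TW \<iota> W (basis_elem []) = gl_unit"
  by (simp add: TW_def)

lemma TW_ns_mult: "TW \<iota> W (ns_mult (basis_elem [m]) x) = gl_mult (TW_Lambda \<iota> W m) (TW \<iota> W x)"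
proof (rule poly_mapping_eq_lin_funI)
  fix \<phi> :: "wtree \<Rightarrow> 'a"
  show "lin_fun \<phi> (TW \<iota> W (ns_mult (basis_elem [m]) x)) = lin_fun \<phi> (gl_mult (TW_Lambda \<iota> W m) (TW \<iota> W x))"
    unfolding TW_def gl_mult_def lin_fun_lin_ext lin_fun_bilin_ext lin_fun_ns_mult
    by (subst lin_fun_swap) (simp add: lin_fun_bilin_ext)
qed

lemma TW_sum: "TW \<iota> W (sum f A) = (\<Sum>a\<in>A. TW \<iota> W (f a))"
  by (simp add: TW_def lin_ext_sum)

lemma TW_scal: "TW \<iota> W (scal c x) = scal c (TW \<iota> W x)"
  by (simp add: TW_def lin_ext_scal)

text \<open>
  The recursion of the complete functions reduces this to products with \<open>T\<^sub>W(\<Lambda>\<^sub>i)\<close>; coassociativity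
  brings the two functionals together, so that \<open>lambda_complete\<close> applies.
\<close>

lemma gl_functional_complete_sym:
  assumes \<iota>: "rat_algebra (\<iota> :: rat \<Rightarrow> 'k::comm_ring_1)" and W: "W \<subseteq> {n. n > 0}"
    and F: "F \<in> forests W"
  shows "gl_functional (TW \<iota> W (ns_mult (complete_sym m) x)) F =
    cut_sum (\<lambda>P R. complete_functional m P * gl_functional (TW \<iota> W x) R) F"
  using F
proof (induction m arbitrary: F rule: less_induct)
  case (less m)
  note F = less.prems
  let ?A = "gl_functional (TW \<iota> W x)"
  show ?case
  proof (cases m)
    case 0
    have "cut_sum (\<lambda>P R. complete_functional 0 P * ?A R) F = cut_sum (\<lambda>P R. if P = {#} then ?A R else 0) F"
      by (rule cut_sum_cong[OF F]) (auto simp: complete_functional_def forest_weight_eq_zero[OF W])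
    then show ?thesis using 0 by (simp add: cut_sum_left_counit)
  next
    case (Suc n)
    have "ns_mult (complete_sym m) x = (\<Sum>i\<le>n. scal ((-1) ^ i)
        (ns_mult (basis_elem [Suc i]) (ns_mult (complete_sym (n - i)) x)))"
      by (simp add: Suc ns_mult_linear ns_mult_assoc)
    then have "gl_functional (TW \<iota> W (ns_mult (complete_sym m) x)) F = (\<Sum>i\<le>n. (-1) ^ i *
        cut_sum (\<lambda>P R. lambda_functional (Suc i) P * gl_functional (TW \<iota> W (ns_mult (complete_sym (n - i)) x)) R) F)"
      by (simp add: TW_sum TW_scal TW_ns_mult gl_functional_linear gl_functional_TW_Lambda[OF \<iota> W F])
    also have "\<dots> = (\<Sum>i\<le>n. (-1) ^ i * cut_sum (\<lambda>P R.
        cut_sum (\<lambda>P\<^sub>1 P\<^sub>2. lambda_functional (Suc i) P\<^sub>1 * complete_functional (n - i) P\<^sub>2) P * ?A R) F)"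
    proof (rule sum.cong)
      fix i assume "i \<in> {..n}"
      then have IH: "gl_functional (TW \<iota> W (ns_mult (complete_sym (n - i)) x)) R =
          cut_sum (\<lambda>P R. complete_functional (n - i) P * ?A R) R" if "R \<in> forests W" for R
        using less.IH[of "n - i" R] that Suc by auto
      have "cut_sum (\<lambda>P R. lambda_functional (Suc i) P * gl_functional (TW \<iota> W (ns_mult (complete_sym (n - i)) x)) R) F =
         cut_sum (\<lambda>P R. lambda_functional (Suc i) P * cut_sum (\<lambda>P R. complete_functional (n - i) P * ?A R) R) F"
        by (rule cut_sum_cong[OF F]) (simp add: IH)
      also have "\<dots> = cut_sum (\<lambda>P R. cut_sum (\<lambda>R\<^sub>1 R\<^sub>2. lambda_functional (Suc i) P * complete_functional (n - i) R\<^sub>1 * ?A R\<^sub>2) R) F"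
        by (simp only: cut_sum_mult_left mult.assoc)
      also have "\<dots> = cut_sum (\<lambda>P R. cut_sum (\<lambda>P\<^sub>1 P\<^sub>2. lambda_functional (Suc i) P\<^sub>1 * complete_functional (n - i) P\<^sub>2 * ?A R) P) F"
        by (rule cut_sum_coassoc[symmetric])
      finally show "(-1) ^ i * cut_sum (\<lambda>P R. lambda_functional (Suc i) P *
          gl_functional (TW \<iota> W (ns_mult (complete_sym (n - i)) x)) R) F = (-1) ^ i * cut_sum (\<lambda>P R.
        cut_sum (\<lambda>P\<^sub>1 P\<^sub>2. lambda_functional (Suc i) P\<^sub>1 * complete_functional (n - i) P\<^sub>2) P * ?A R) F"
        by (simp only: cut_sum_mult_right)
    qed simp
    also have "\<dots> = cut_sum (\<lambda>P R. (\<Sum>i\<le>n. (-1) ^ i *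
        cut_sum (\<lambda>P\<^sub>1 P\<^sub>2. lambda_functional (Suc i) P\<^sub>1 * complete_functional (n - i) P\<^sub>2) P) * ?A R) F"
      by (simp only: sum_distrib_right cut_sum_sum mult.assoc cut_sum_mult_left)
    also have "\<dots> = cut_sum (\<lambda>P R. complete_functional m P * ?A R) F"
      by (rule cut_sum_cong[OF F]) (simp add: lambda_complete[OF W] Suc)
    finally show ?thesis .
  qed
qed

lemma gl_functional_complete_word:
  assumes \<iota>: "rat_algebra (\<iota> :: rat \<Rightarrow> 'k::comm_ring_1)" and W: "W \<subseteq> {n. n > 0}"
    and F: "F \<in> forests W"
  shows "gl_functional (TW \<iota> W (complete_word w)) F = qsym_coeff w F"
  using F
proof (induction w arbitrary: F)
  case Nil
  show ?case by (auto simp: complete_word_Nil TW_Nil gl_functional_def gl_unit_def lookup_basis_elem B_plus_def)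
next
  case (Cons m w)
  have "gl_functional (TW \<iota> W (complete_word (m # w))) F =
      cut_sum (\<lambda>P R. complete_functional m P * gl_functional (TW \<iota> W (complete_word w)) R) F"
    unfolding complete_word_Cons by (rule gl_functional_complete_sym[OF \<iota> W Cons.prems])
  also have "\<dots> = qsym_coeff (m # w) F"
    unfolding qsym_coeff.simps by (rule cut_sum_cong[OF Cons.prems]) (simp add: Cons.IH)
  finally show ?case .
qed

lemma qsym_coeff_weight:
  "F \<in> forests W \<Longrightarrow> sum_list w \<noteq> forest_weight F \<Longrightarrow> qsym_coeff w F = 0"
proof (induction w arbitrary: F)
  case (Cons m w)
  have "cut_sum (\<lambda>P R. complete_functional m P * qsym_coeff w R) F = cut_sum (\<lambda>P R. 0 :: 'a) F"
    by (rule cut_sum_cong[OF Cons.prems(1)]) (use Cons in \<open>auto simp: complete_functional_def\<close>)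
  then show ?case by simp
qed auto

text \<open>
  Since all labels are positive, a part of weight \<open>0\<close> is empty.
\<close>

lemma qsym_coeff_remove_zeros:
  assumes W: "W \<subseteq> {n. n > 0}"
  shows "F \<in> forests W \<Longrightarrow> qsym_coeff (remove_zeros w) F = qsym_coeff w F"
proof (induction w arbitrary: F)
  case (Cons m w)
  note F = Cons.prems
  show ?case
  proof (cases "m = 0")
    case True
    have "qsym_coeff (m # w) F = cut_sum (\<lambda>P R. if P = {#} then qsym_coeff w R else 0 :: 'a) F"
      unfolding qsym_coeff.simps
      by (rule cut_sum_cong[OF F]) (auto simp: complete_functional_def forest_weight_eq_zero[OF W] True)
    then show ?thesis using Cons True by (simp add: cut_sum_left_counit remove_zeros_def)
  next
    case False
    have "cut_sum (\<lambda>P R. complete_functional m P * qsym_coeff (remove_zeros w) R) F =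
        cut_sum (\<lambda>P R. complete_functional m P * qsym_coeff w R :: 'a) F"
      by (rule cut_sum_cong[OF F]) (simp add: Cons.IH)
    then show ?thesis using False by (simp add: remove_zeros_def)
  qed
qed (simp add: remove_zeros_def)

lemma qsym_coeff_append:
  "(qsym_coeff (u @ v) F :: 'k::comm_ring_1) = cut_sum (\<lambda>P R. qsym_coeff u P * qsym_coeff v R) F"
proof (induction u arbitrary: F)
  case Nil
  have "(\<lambda>P R. qsym_coeff [] P * qsym_coeff v R) = (\<lambda>P R. if P = {#} then qsym_coeff v R else 0 :: 'k)"
    by (intro ext) simp
  then show ?case by (simp only: cut_sum_left_counit append_Nil)
next
  case (Cons m u)
  have "(qsym_coeff ((m # u) @ v) F :: 'k) =
      cut_sum (\<lambda>P R. cut_sum (\<lambda>R\<^sub>1 R\<^sub>2. complete_functional m P * qsym_coeff u R\<^sub>1 * qsym_coeff v R\<^sub>2) R) F"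
    by (simp add: Cons.IH cut_sum_mult_left mult.assoc)
  also have "\<dots> = cut_sum (\<lambda>P R. cut_sum (\<lambda>P\<^sub>1 P\<^sub>2. complete_functional m P\<^sub>1 * qsym_coeff u P\<^sub>2 * qsym_coeff v R) P) F"
    by (rule cut_sum_coassoc[symmetric])
  finally show ?case by (simp add: cut_sum_mult_right)
qed

definition splittings :: "nat list \<Rightarrow> (nat list \<times> nat list) set" where
  "splittings w = {(a, b). length a = length b \<and> map2 (+) a b = w}"

lemma splittings_Nil: "splittings [] = {([], [])}"
  by (auto simp: splittings_def)

lemma splittings_Cons:
  "splittings (m # w) = (\<lambda>(i, a, b). (i # a, (m - i) # b)) ` ({..m} \<times> splittings w)"
proof (intro equalityI subsetI)
  fix p assume "p \<in> splittings (m # w)"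
  then obtain a b where p: "p = (a, b)" "length a = length b" "map2 (+) a b = m # w"
    by (auto simp: splittings_def)
  then obtain i a' j b' where ab: "a = i # a'" "b = j # b'" by (cases a; cases b) auto
  then have "(a', b') \<in> splittings w" "i \<le> m" "j = m - i" using p by (auto simp: splittings_def)
  then show "p \<in> (\<lambda>(i, a, b). (i # a, (m - i) # b)) ` ({..m} \<times> splittings w)"
    using p(1) ab by (intro image_eqI[of _ _ "(i, a', b')"]) auto
qed (auto simp: splittings_def)

lemma finite_splittings [simp]: "finite (splittings w)"
  by (induction w) (auto simp: splittings_Nil splittings_Cons)

lemma sum_splittings_Cons:
  "(\<Sum>p\<in>splittings (m # w). f p) = (\<Sum>i\<le>m. \<Sum>p\<in>splittings w. f (i # fst p, (m - i) # snd p))"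
  unfolding splittings_Cons
  by (subst sum.reindex) (auto simp: inj_on_def sum.cartesian_product case_prod_unfold)

text \<open>
  Each letter of \<open>w\<close> is distributed to the two components.
\<close>

lemma qsym_coeff_union:
  "qsym_coeff w (F + G) = (\<Sum>p\<in>splittings w. qsym_coeff (fst p) F * qsym_coeff (snd p) G)"
proof (induction w arbitrary: F G)
  case (Cons m w)
  have split: "complete_functional m (P + P') =
      (\<Sum>i\<le>m. complete_functional i P * complete_functional (m - i) P' :: 'a)" for P P'
  proof -
    have "(\<Sum>i\<le>m. complete_functional i P * complete_functional (m - i) P') =
       (\<Sum>i\<le>m. if i = forest_weight P then complete_functional m (P + P') else 0 :: 'a)"
      by (rule sum.cong) (auto simp: complete_functional_def)
    also have "\<dots> = complete_functional m (P + P')" by (auto simp: complete_functional_def)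
    finally show ?thesis by simp
  qed
  have "complete_functional m (P + P') * qsym_coeff w (R + R') =
    (\<Sum>i\<le>m. \<Sum>p\<in>splittings w. (complete_functional i P * qsym_coeff (fst p) R) *
       (complete_functional (m - i) P' * qsym_coeff (snd p) R') :: 'a)" for P P' R R'
    unfolding split Cons.IH sum_product by (intro sum.cong refl) (simp only: ac_simps)
  then have "qsym_coeff (m # w) (F + G) =
    cut_sum (\<lambda>P R. cut_sum (\<lambda>P' R'. \<Sum>i\<le>m. \<Sum>p\<in>splittings w. (complete_functional i P * qsym_coeff (fst p) R) *
       (complete_functional (m - i) P' * qsym_coeff (snd p) R') :: 'a) G) F"
    by (simp only: qsym_coeff.simps cut_sum_union)
  also have "\<dots> = (\<Sum>i\<le>m. \<Sum>p\<in>splittings w. qsym_coeff (i # fst p) F * qsym_coeff ((m - i) # snd p) G)"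
    by (simp only: cut_sum_sum cut_sum_mult_left cut_sum_mult_right qsym_coeff.simps)
  finally show ?case by (simp add: sum_splittings_Cons del: qsym_coeff.simps)
qed (auto simp: splittings_Nil)

definition ck_to_qsym :: "(wforest \<Rightarrow>\<^sub>0 'k) \<Rightarrow> (nat list \<Rightarrow>\<^sub>0 'k::comm_ring_1)" where
  "ck_to_qsym = lin_ext (\<lambda>F. \<Sum>w\<in>{w \<in> compositions. sum_list w = forest_weight F}.
     scal (qsym_coeff w F) (basis_elem w))"

lemma finite_compositions_of: "finite {w \<in> compositions. sum_list w = n}"
proof (rule finite_subset)
  show "{w \<in> compositions. sum_list w = n} \<subseteq> {w. set w \<subseteq> {..n} \<and> length w \<le> n}"
  proof safe
    fix w :: "nat list" assume "w \<in> compositions"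
    then show "length w \<le> sum_list w" by (induction w) (auto simp: compositions_def Suc_le_eq add_pos_nonneg intro: add_mono)
    fix m assume "m \<in> set w"
    then show "m \<le> sum_list w" by (rule member_le_sum_list) auto
  qed
qed (simp add: finite_lists_length_le)

lemma lookup_ck_to_qsym:
  assumes "y \<in> hopf_space (H_CK W)"
  shows "lookup (ck_to_qsym y) w = (if w \<in> compositions then lin_fun (qsym_coeff w) y else 0)"
proof -
  have "lin_fun (\<lambda>F. lookup (\<Sum>w\<in>{w \<in> compositions. sum_list w = forest_weight F}.
     scal (qsym_coeff w F) (basis_elem w)) w) y = lin_fun (\<lambda>F. if w \<in> compositions then qsym_coeff w F else 0) y"
  proof (rule lin_fun_cong)
    fix F assume "F \<in> keys y"
    then have "F \<in> forests W" using assms by (auto simp: hopf_space_def H_CK_def)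
    then show "lookup (\<Sum>w\<in>{w \<in> compositions. sum_list w = forest_weight F}.
     scal (qsym_coeff w F) (basis_elem w)) w = (if w \<in> compositions then qsym_coeff w F else 0)"
      using qsym_coeff_weight[of F W w] by (auto simp: lookup_sum_basis_elem[OF finite_compositions_of])
  qed
  then show ?thesis by (simp add: ck_to_qsym_def lookup_lin_ext)
qed

lemma ck_to_qsym_QSym: "ck_to_qsym y \<in> hopf_space QSym"
proof -
  have "keys (ck_to_qsym y) \<subseteq> compositions"
    unfolding ck_to_qsym_def
  proof (rule keys_lin_ext)
    fix F show "keys (\<Sum>w\<in>{w \<in> compositions. sum_list w = forest_weight F}.
       scal (qsym_coeff w F) (basis_elem w) :: nat list \<Rightarrow>\<^sub>0 'a) \<subseteq> compositions"
      by (auto simp: in_keys_iff lookup_sum_basis_elem[OF finite_compositions_of] split: if_splits)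
  qed
  then show ?thesis by (simp add: hopf_space_def QSym_def)
qed

lemma lin_fun_lookup_commute: "lin_fun (lookup x) y = lin_fun (lookup y) x"
proof -
  let ?A = "keys x \<union> keys y"
  have "lin_fun (lookup x) y = (\<Sum>b\<in>?A. lookup y b * lookup x b)"
    by (rule lin_fun_superset) auto
  also have "\<dots> = lin_fun (lookup y) x"
    by (subst lin_fun_superset[of ?A]) (auto simp: mult.commute)
  finally show ?thesis .
qed

lemma ns_qs_pairing_eq:
  assumes "x \<in> NSym"
  shows "ns_qs_pairing x q = lin_fun (lookup q) (lin_ext complete_word x)"
  unfolding lin_fun_lookup_commute[of q]
  by (simp add: ns_qs_pairing_def complete_coords_eq[OF assms] lin_fun_def mult.commute)

lemma gl_ck_pairing_TW:
  assumes \<iota>: "rat_algebra (\<iota> :: rat \<Rightarrow> 'k::comm_ring_1)" and W: "W \<subseteq> {n. n > 0}"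
    and x: "x \<in> NSym" and y: "y \<in> hopf_space (H_CK W)"
  shows "gl_ck_pairing (TW \<iota> W x) y = lin_fun (\<lambda>w. lin_fun (qsym_coeff w) y) (lin_ext complete_word x)"
proof -
  let ?c = "lin_ext complete_word x"
  have "TW \<iota> W x = lin_ext (\<lambda>w. TW \<iota> W (complete_word w)) ?c"
    by (subst complete_hom_involution[OF x, symmetric]) (simp add: TW_def lin_ext_lin_ext)
  then have "gl_functional (TW \<iota> W x) F = lin_fun (\<lambda>w. gl_functional (TW \<iota> W (complete_word w)) F) ?c" for F
    by (simp only: gl_functional_linear)
  then have "gl_ck_pairing (TW \<iota> W x) y = lin_fun (\<lambda>F. lin_fun (\<lambda>w. gl_functional (TW \<iota> W (complete_word w)) F) ?c) y"
    unfolding gl_ck_pairing_eq by (rule lin_fun_cong)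
  also have "\<dots> = lin_fun (\<lambda>F. lin_fun (\<lambda>w. qsym_coeff w F) ?c) y"
  proof (rule lin_fun_cong)
    fix F assume "F \<in> keys y"
    then have "F \<in> forests W" using y by (auto simp: hopf_space_def H_CK_def)
    then show "lin_fun (\<lambda>w. gl_functional (TW \<iota> W (complete_word w)) F) ?c = lin_fun (\<lambda>w. qsym_coeff w F) ?c"
      by (simp add: gl_functional_complete_word[OF \<iota> W])
  qed
  also have "\<dots> = lin_fun (\<lambda>w. lin_fun (qsym_coeff w) y) ?c" by (rule lin_fun_swap)
  finally show ?thesis .
qed

text \<open>
  Elements of \<open>NSym\<close> may be tested on the words in the complete functions, whose coordinates are trivial.
\<close>

lemma is_graded_dual_iff:
  assumes \<iota>: "rat_algebra (\<iota> :: rat \<Rightarrow> 'k::comm_ring_1)" and W: "W \<subseteq> {n. n > 0}"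
    and y: "y \<in> hopf_space (H_CK W)"
  shows "is_graded_dual \<iota> W y q \<longleftrightarrow> q = ck_to_qsym y"
proof
  assume q: "is_graded_dual \<iota> W y q"
  show "q = ck_to_qsym y"
  proof (rule poly_mapping_eqI)
    fix w
    show "lookup q w = lookup (ck_to_qsym y) w"
    proof (cases "w \<in> compositions")
      case True
      have word: "(complete_word w :: nat list \<Rightarrow>\<^sub>0 'k) \<in> NSym" by (rule complete_word_NSym)
      have "ns_qs_pairing (complete_word w) q = gl_ck_pairing (TW \<iota> W (complete_word w)) y"
        using q word by (simp add: is_graded_dual_def)
      then show ?thesis
        unfolding ns_qs_pairing_eq[OF word] gl_ck_pairing_TW[OF \<iota> W word y]
          complete_hom_complete_word[OF True] lin_fun_basis_elem
        using lookup_ck_to_qsym[OF y, of w] True by simp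
    next
      case False
      then have "w \<notin> keys q"
        using q by (auto simp: is_graded_dual_def hopf_space_def QSym_def)
      then show ?thesis using False lookup_ck_to_qsym[OF y, of w] by (simp add: in_keys_iff)
    qed
  qed
next
  assume q: "q = ck_to_qsym y"
  have "ns_qs_pairing x q = gl_ck_pairing (TW \<iota> W x) y" if x: "x \<in> NSym" for x
    unfolding ns_qs_pairing_eq[OF x] gl_ck_pairing_TW[OF \<iota> W x y]
  proof (rule lin_fun_cong)
    fix w assume "w \<in> keys (lin_ext complete_word x)"
    then have "w \<in> compositions" using complete_hom_NSym[of x] by (auto simp: NSym_def)
    then show "lookup q w = lin_fun (qsym_coeff w) y"
      by (simp add: q lookup_ck_to_qsym[OF y])
  qed
  then show "is_graded_dual \<iota> W y q" by (simp add: is_graded_dual_def q ck_to_qsym_QSym)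
qed

lemma TW_dual_eq:
  assumes "rat_algebra (\<iota> :: rat \<Rightarrow> 'k::comm_ring_1)" "W \<subseteq> {n. n > 0}" "y \<in> hopf_space (H_CK W)"
  shows "TW_dual \<iota> W y = ck_to_qsym y"
  unfolding TW_dual_def is_graded_dual_iff[OF assms] by (rule the_eq_trivial)

section \<open>Compatibility with the Hopf algebra structures\<close>

lemma hopf_space_simps:
  "x \<in> hopf_space (H_CK W) \<longleftrightarrow> keys x \<subseteq> forests W"
  "q \<in> hopf_space QSym \<longleftrightarrow> keys q \<subseteq> compositions"
  by (simp_all add: hopf_space_def H_CK_def QSym_def)

lemma basis_elem_hopf_space: "F \<in> forests W \<Longrightarrow> basis_elem F \<in> hopf_space (H_CK W)"
  by (simp add: hopf_space_simps)

lemma times_hopf_space: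
  "x \<in> hopf_space (H_CK W) \<Longrightarrow> y \<in> hopf_space (H_CK W) \<Longrightarrow> x * y \<in> hopf_space (H_CK W)"
  using keys_mult[of x y] by (fastforce simp: hopf_space_simps)

text \<open>
  No position of a composition is \<open>0\<close>, so at each position one of the two exponents is positive; this bounds
  the length of the exponent vectors.
\<close>

lemma finite_quasi_shuffles:
  "finite {(a, b). length a = length b \<and> remove_zeros a = u \<and> remove_zeros b = v \<and> map2 (+) a b \<in> compositions}"
proof (rule finite_subset)
  let ?A = "\<lambda>w. {a. set a \<subseteq> insert 0 (set w) \<and> length a \<le> length u + length v}"
  have "length a \<le> length (remove_zeros a) + length (remove_zeros b)"
    if "length a = length b" "map2 (+) a b \<in> compositions" for a b
    using that by (induction a b rule: list_induct2) (auto simp: remove_zeros_def compositions_def)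
  moreover have "set a \<subseteq> insert 0 (set (remove_zeros a))" for a by (auto simp: remove_zeros_def)
  ultimately show "{(a, b). length a = length b \<and> remove_zeros a = u \<and> remove_zeros b = v \<and>
      map2 (+) a b \<in> compositions} \<subseteq> ?A u \<times> ?A v"
    by fastforce
  show "finite (?A u \<times> ?A v)" by (intro finite_cartesian_product finite_lists_length_le) auto
qed

lemma lookup_qs_mult_basis:
  "lookup (qs_mult_basis u v) w = (if w \<in> compositions then
     (\<Sum>p\<in>splittings w. (if remove_zeros (fst p) = u then 1 else 0) * (if remove_zeros (snd p) = v then 1 else 0))
   else (0 :: 'k::comm_ring_1))"
proof -
  let ?A = "{(a, b). length a = length b \<and> remove_zeros a = u \<and> remove_zeros b = v \<and> map2 (+) a b \<in> compositions}"
  let ?B = "{p \<in> splittings w. remove_zeros (fst p) = u \<and> remove_zeros (snd p) = v}"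
  have "lookup (qs_mult_basis u v) w = (\<Sum>p\<in>?A. if map2 (+) (fst p) (snd p) = w then 1 else 0 :: 'k)"
    unfolding qs_mult_basis_def lookup_sum
    by (rule sum.cong) (auto simp: lookup_basis_elem)
  also have "\<dots> = (\<Sum>p\<in>{p \<in> ?A. map2 (+) (fst p) (snd p) = w}. 1)"
    by (rule sum.inter_filter[symmetric, OF finite_quasi_shuffles])
  also have "{p \<in> ?A. map2 (+) (fst p) (snd p) = w} = (if w \<in> compositions then ?B else {})"
    by (auto simp: splittings_def)
  also have "(\<Sum>p\<in>(if w \<in> compositions then ?B else {}). 1) = (if w \<in> compositions then
     (\<Sum>p\<in>splittings w. if remove_zeros (fst p) = u \<and> remove_zeros (snd p) = v then 1 else 0) else (0 :: 'k))"
    by (simp only: sum.inter_filter[OF finite_splittings] split: if_split) simp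
  also have "\<dots> = (if w \<in> compositions then
     (\<Sum>p\<in>splittings w. (if remove_zeros (fst p) = u then 1 else 0) * (if remove_zeros (snd p) = v then 1 else 0)) else 0)"
    by (auto intro!: sum.cong)
  finally show ?thesis .
qed

text \<open>
  If the coefficients of \<open>X\<close> and \<open>Y\<close> are extended to exponent vectors by deleting zeros, multiplication of
  quasi-symmetric functions is multiplication of power series.
\<close>

lemma lookup_qs_mult:
  "lookup (bilin_ext qs_mult_basis X Y) w = (if w \<in> compositions then
     (\<Sum>p\<in>splittings w. lookup X (remove_zeros (fst p)) * lookup Y (remove_zeros (snd p)))
   else (0 :: 'k::comm_ring_1))"
proof (cases "w \<in> compositions")
  case True
  then have "lookup (bilin_ext qs_mult_basis X Y) w =
    lin_fun (\<lambda>u. lin_fun (\<lambda>v. \<Sum>p\<in>splittings w. (if u = remove_zeros (fst p) then 1 else 0) *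
      (if v = remove_zeros (snd p) then 1 else 0 :: 'k)) Y) X"
    by (simp add: lookup_bilin_ext lookup_qs_mult_basis eq_commute)
  also have "\<dots> = (\<Sum>p\<in>splittings w. lookup X (remove_zeros (fst p)) * lookup Y (remove_zeros (snd p)))"
    by (simp only: lin_fun_sum_functional lin_fun_mult_left lin_fun_mult_right lin_fun_indicator)
  finally show ?thesis using True by simp
qed (simp add: lookup_bilin_ext lookup_qs_mult_basis)

lemma ck_to_qsym_times:
  assumes W: "W \<subseteq> {n. n > 0}" and x: "x \<in> hopf_space (H_CK W)" and y: "y \<in> hopf_space (H_CK W)"
  shows "ck_to_qsym (x * y) = bilin_ext qs_mult_basis (ck_to_qsym x) (ck_to_qsym y)"
proof (rule poly_mapping_eqI)
  fix w
  have rz: "lookup (ck_to_qsym z) (remove_zeros a) = lin_fun (qsym_coeff a) z"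
    if z: "z \<in> hopf_space (H_CK W)" for z :: "wforest \<Rightarrow>\<^sub>0 'a" and a
  proof -
    have "remove_zeros a \<in> compositions" by (simp add: remove_zeros_def compositions_def)
    then have "lookup (ck_to_qsym z) (remove_zeros a) = lin_fun (qsym_coeff (remove_zeros a)) z"
      by (simp add: lookup_ck_to_qsym[OF z])
    also have "\<dots> = lin_fun (qsym_coeff a) z"
      by (rule lin_fun_cong, rule qsym_coeff_remove_zeros[OF W]) (use z in \<open>auto simp: hopf_space_simps\<close>)
    finally show ?thesis .
  qed
  have "lin_fun (qsym_coeff w) (x * y) =
    (\<Sum>p\<in>splittings w. lin_fun (qsym_coeff (fst p)) x * lin_fun (qsym_coeff (snd p)) y)"
    by (simp only: lin_fun_times qsym_coeff_union lin_fun_sum_functional lin_fun_mult_left lin_fun_mult_right)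
  then show "lookup (ck_to_qsym (x * y)) w =
      lookup (bilin_ext qs_mult_basis (ck_to_qsym x) (ck_to_qsym y)) w"
    by (simp add: lookup_qs_mult lookup_ck_to_qsym[OF times_hopf_space[OF x y]] rz x y)
qed

lemma lookup_tensor: "lookup (tensor X Y) (u, v) = lookup X u * lookup Y v"
proof -
  have "lookup (tensor X Y) (u, v) =
    lin_fun (\<lambda>a. lin_fun (\<lambda>b. (if a = u then 1 else 0) * (if b = v then 1 else 0)) Y) X"
    unfolding tensor_def lookup_bilin_ext
    by (intro lin_fun_cong) (auto simp: lookup_basis_elem)
  then show ?thesis by (simp only: lin_fun_mult_left lin_fun_mult_right lin_fun_indicator)
qed

lemma lookup_qs_comult_basis:
  "lookup (qs_comult_basis w) (u, v) = (if w = u @ v then 1 else 0 :: 'k::comm_ring_1)"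
proof -
  have "lookup (qs_comult_basis w) (u, v) =
     (\<Sum>i\<le>length w. if i = length u then (if w = u @ v then 1 else 0) else 0 :: 'k)"
    unfolding qs_comult_basis_def lookup_sum
  proof (rule sum.cong)
    fix i assume "i \<in> {..length w}"
    then have "(u, v) = (take i w, drop i w) \<longleftrightarrow> i = length u \<and> w = u @ v"
      by (auto simp: min_def)
    then show "lookup (basis_elem (take i w, drop i w)) (u, v) =
        (if i = length u then (if w = u @ v then 1 else 0) else 0 :: 'k)"
      by (simp add: lookup_basis_elem)
  qed simp
  also have "\<dots> = (if w = u @ v then 1 else 0)" by auto
  finally show ?thesis .
qed

lemma ck_to_qsym_comult:
  fixes x :: "wforest \<Rightarrow>\<^sub>0 'k::comm_ring_1"
  assumes x: "x \<in> hopf_space (H_CK W)"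
  shows "lin_ext qs_comult_basis (ck_to_qsym x) = tensor_map ck_to_qsym ck_to_qsym (lin_ext ck_comult_basis x)"
proof (rule poly_mapping_eqI, clarify)
  fix u v
  let ?f = "\<lambda>u. if u \<in> compositions then qsym_coeff u else (\<lambda>F. 0 :: 'k)"
  have f: "(lookup (ck_to_qsym (basis_elem F)) u :: 'k) = ?f u F" if "F \<in> forests W" for F u
    by (simp add: lookup_ck_to_qsym[OF basis_elem_hopf_space[OF that]])
  have "lookup (tensor_map ck_to_qsym ck_to_qsym (lin_ext ck_comult_basis x)) (u, v) =
    lin_fun (cut_sum (\<lambda>P R. lookup (ck_to_qsym (basis_elem P)) u * lookup (ck_to_qsym (basis_elem R)) v)) x"
    unfolding tensor_map_def lookup_lin_ext lin_fun_lin_ext cut_sum_def case_prod_unfold lookup_tensor ..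
  also have "\<dots> = lin_fun (cut_sum (\<lambda>P R. ?f u P * ?f v R)) x"
  proof (rule lin_fun_cong)
    fix F assume "F \<in> keys x"
    then have "F \<in> forests W" using x by (auto simp: hopf_space_simps)
    then show "cut_sum (\<lambda>P R. lookup (ck_to_qsym (basis_elem P)) u * lookup (ck_to_qsym (basis_elem R)) v) F =
        cut_sum (\<lambda>P R. ?f u P * ?f v R) F"
      by (rule cut_sum_cong) (simp only: f)
  qed
  also have "\<dots> = (if u @ v \<in> compositions then lin_fun (qsym_coeff (u @ v)) x else 0)"
  proof (cases "u @ v \<in> compositions")
    case True
    then have "u \<in> compositions" "v \<in> compositions" by (auto simp: compositions_def)
    then show ?thesis using True by (simp add: qsym_coeff_append[abs_def])
  next
    case False
    then have "u \<notin> compositions \<or> v \<notin> compositions" by (auto simp: compositions_def)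
    then have "cut_sum (\<lambda>P R. ?f u P * ?f v R) = (\<lambda>F. 0)" by (auto simp: cut_sum_def fun_eq_iff)
    then show ?thesis using False by (simp only: lin_fun_zero_functional if_False)
  qed
  also have "\<dots> = lookup (ck_to_qsym x) (u @ v)"
    by (simp add: lookup_ck_to_qsym[OF x])
  also have "\<dots> = lookup (lin_ext qs_comult_basis (ck_to_qsym x)) (u, v)"
    by (simp add: lookup_lin_ext lookup_qs_comult_basis lin_fun_indicator)
  finally show "lookup (lin_ext qs_comult_basis (ck_to_qsym x)) (u, v) =
    lookup (tensor_map ck_to_qsym ck_to_qsym (lin_ext ck_comult_basis x)) (u, v)" by simp
qed

lemma linear_between_eq_lin_ext:
  assumes f: "linear_between {x. keys x \<subseteq> B} Y f" and x: "keys x \<subseteq> B"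
  shows "f x = lin_ext (\<lambda>b. f (basis_elem b)) (x :: 'b \<Rightarrow>\<^sub>0 'k::comm_ring_1)"
proof -
  let ?s = "\<lambda>A. \<Sum>b\<in>A. scal (lookup x b) (basis_elem b)"
  have keys: "keys (?s A) \<subseteq> B" if "A \<subseteq> B" for A
    using keys_sum[of "\<lambda>b. scal (lookup x b) (basis_elem b)" A]
      keys_scal[of _ "basis_elem _ :: 'b \<Rightarrow>\<^sub>0 'k"] that by fastforce
  have add: "f (y + z) = f y + f z" if "keys y \<subseteq> B" "keys z \<subseteq> B" for y z
    using f that by (simp add: linear_between_def)
  have scal: "f (scal c y) = scal c (f y)" if "keys y \<subseteq> B" for c y
    using f that by (simp add: linear_between_def)
  have zero: "scal 0 z = 0" for z :: "'d \<Rightarrow>\<^sub>0 'k" by (rule poly_mapping_eqI) simp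
  have f0: "f 0 = 0" using scal[of 0 0] by (simp add: zero)
  have f_sum: "f (?s A) = (\<Sum>b\<in>A. scal (lookup x b) (f (basis_elem b)))" if "finite A" "A \<subseteq> B" for A
    using that
  proof (induction A rule: finite_induct)
    case (insert b A)
    have b: "keys (basis_elem b :: 'b \<Rightarrow>\<^sub>0 'k) \<subseteq> B" using insert.prems by simp
    have "keys (scal (lookup x b) (basis_elem b)) \<subseteq> B"
      using keys_scal b by (rule order_trans)
    then show ?case using insert keys[of A] by (simp add: add scal[OF b])
  qed (simp add: f0)
  have "?s (keys x) = x"
    using lin_ext_basis_id[of x] by (simp add: lin_ext_def)
  then show ?thesis using f_sum[OF finite_keys x] by (simp add: lin_ext_def)
qed

lemma basis_qsym_unit_right:
  assumes "X \<in> hopf_space QSym"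
  shows "bilin_ext qs_mult_basis X (basis_elem []) = X"
proof (rule poly_mapping_eqI)
  fix w
  have nil: "remove_zeros b = [] \<longleftrightarrow> b = replicate (length b) 0" for b
    by (induction b) (auto simp: remove_zeros_def)
  have p: "(a, b) \<in> splittings w \<and> remove_zeros b = [] \<longleftrightarrow> a = w \<and> b = replicate (length w) 0" for a b
  proof
    assume "(a, b) \<in> splittings w \<and> remove_zeros b = []"
    then have "length a = length b" "map2 (+) a b = w" "b = replicate (length b) 0"
      using nil[of b] by (auto simp: splittings_def)
    moreover have "map2 (+) a (replicate (length a) 0) = a" for a :: "nat list"
      by (induction a) auto
    ultimately show "a = w \<and> b = replicate (length w) 0" by metis
  next
    assume "a = w \<and> b = replicate (length w) 0"
    moreover have "map2 (+) w (replicate (length w) 0) = w" for w :: "nat list"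
      by (induction w) auto
    ultimately show "(a, b) \<in> splittings w \<and> remove_zeros b = []"
      by (auto simp: splittings_def remove_zeros_def)
  qed
  show "lookup (bilin_ext qs_mult_basis X (basis_elem [])) w = lookup X w"
  proof (cases "w \<in> compositions")
    case True
    have "(\<Sum>p\<in>splittings w. lookup X (remove_zeros (fst p)) *
        lookup (basis_elem []) (remove_zeros (snd p))) =
      (\<Sum>p\<in>splittings w. if p = (w, replicate (length w) 0) then lookup X (remove_zeros w) else 0)"
    proof (rule sum.cong)
      fix q assume "q \<in> splittings w"
      then show "lookup X (remove_zeros (fst q)) *
        lookup (basis_elem []) (remove_zeros (snd q)) =
        (if q = (w, replicate (length w) 0) then lookup X (remove_zeros w) else 0)"
        using p[of "fst q" "snd q"] by (cases q) (auto simp: lookup_basis_elem)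
    qed simp
    also have "\<dots> = lookup X (remove_zeros w)"
      using p[of w "replicate (length w) 0"] by simp
    also have "remove_zeros w = w"
      unfolding remove_zeros_def by (rule filter_True) (use True in \<open>auto simp: compositions_def intro!: gr0I\<close>)
    finally show ?thesis using True by (simp add: lookup_qs_mult)
  next
    case False
    then have "w \<notin> keys X" using assms by (auto simp: hopf_space_simps)
    then show ?thesis using False by (simp add: lookup_qs_mult in_keys_iff)
  qed
qed

text \<open>
  In the coproduct of \<open>F\<close> the summand \<open>F \<otimes> 1\<close> is the only one whose left component is not of smaller
  weight. As \<open>f\<close> sends \<open>1\<close> to the unit, the values of \<open>g\<close> are determined by recursion on the weight.
\<close>

lemma left_convolution_inverse_unique:
  fixes g g' :: "wforest \<Rightarrow> (nat list \<Rightarrow>\<^sub>0 'k::comm_ring_1)"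
  assumes W: "W \<subseteq> {n. n > 0}" and F: "F \<in> forests W"
    and g: "\<And>P. P \<in> forests W \<Longrightarrow> g P \<in> hopf_space QSym" "\<And>P. P \<in> forests W \<Longrightarrow> g' P \<in> hopf_space QSym"
    and unit: "f {#} = basis_elem []"
    and eq: "\<And>F w. F \<in> forests W \<Longrightarrow>
      cut_sum (\<lambda>P R. lookup (bilin_ext qs_mult_basis (g P) (f R)) w) F =
      cut_sum (\<lambda>P R. lookup (bilin_ext qs_mult_basis (g' P) (f R)) w) F"
  shows "g F = g' F"
  using F
proof (induction "forest_weight F" arbitrary: F rule: less_induct)
  case less
  note F = less.prems
  show ?case
  proof (rule poly_mapping_eqI)
    fix w
    let ?h = "\<lambda>g P R. lookup (bilin_ext qs_mult_basis (g P) (f R)) w"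
    have split: "cut_sum (?h g) F = cut_sum (\<lambda>P R. if R = {#} then lookup (g P) w else 0) F +
        cut_sum (\<lambda>P R. if R = {#} then 0 else ?h g P R) F"
      if "\<And>P. P \<in> forests W \<Longrightarrow> g P \<in> hopf_space QSym" for g
      unfolding cut_sum_add[symmetric]
      by (rule cut_sum_cong[OF F]) (simp add: unit basis_qsym_unit_right[OF that])
    have "cut_sum (\<lambda>P R. if R = {#} then 0 else ?h g P R) F = cut_sum (\<lambda>P R. if R = {#} then 0 else ?h g' P R) F"
    proof (rule cut_sum_cong[OF F])
      fix P R assume PR: "P \<in> forests W" "R \<in> forests W" "forest_weight P + forest_weight R = forest_weight F"
      show "(if R = {#} then 0 else ?h g P R) = (if R = {#} then 0 else ?h g' P R)"
      proof (cases "R = {#}")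
        case False
        then have "forest_weight P < forest_weight F"
          using PR forest_weight_eq_zero[OF W PR(2)] by linarith
        then show ?thesis using less.hyps[of P] PR(1) by simp
      qed simp
    qed
    then show "lookup (g F) w = lookup (g' F) w"
      using eq[OF F, of w] split[of g] split[of g'] g by (simp add: cut_sum_right_counit)
  qed
qed

lemma ck_to_qsym_unit: "ck_to_qsym 1 = basis_elem []"
proof -
  have "{w \<in> compositions. sum_list w = 0} = {[]}"
    by (auto simp: compositions_def) (metis list.set_intros(1) neq_Nil_conv)
  then have "ck_to_qsym (basis_elem {#}) = (basis_elem [] :: nat list \<Rightarrow>\<^sub>0 'a)"
    by (simp add: ck_to_qsym_def)
  then show ?thesis by (simp add: basis_elem_zero)
qed

text \<open>
  Both composites are left convolution inverses of \<open>ck_to_qsym\<close>: the first since \<open>ck_to_qsym\<close> is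
  multiplicative, the second since it is comultiplicative.
\<close>

lemma ck_to_qsym_antipode:
  assumes W: "W \<subseteq> {n. n > 0}"
    and S: "is_antipode (H_CK W) S" and S': "is_antipode QSym S'"
    and x: "x \<in> hopf_space (H_CK W)"
  shows "ck_to_qsym (S x) = S' (ck_to_qsym x :: nat list \<Rightarrow>\<^sub>0 'k::comm_ring_1)"
proof -
  let ?m = "bilin_ext qs_mult_basis :: (nat list \<Rightarrow>\<^sub>0 'k) \<Rightarrow> _"
  define f where "f F = (ck_to_qsym (basis_elem F) :: nat list \<Rightarrow>\<^sub>0 'k)" for F
  define g where "g F = ck_to_qsym (S (basis_elem F))" for F
  define g' where "g' F = S' (f F)" for F
  have linS: "linear_between (hopf_space (H_CK W)) (hopf_space (H_CK W)) S"
    and linS': "linear_between (hopf_space QSym) (hopf_space QSym) S'"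
    using S S' by (simp_all add: is_antipode_def)
  have S_in: "S y \<in> hopf_space (H_CK W)" if "y \<in> hopf_space (H_CK W)" for y
    using linS that by (simp add: linear_between_def)
  have S'_in: "S' y \<in> hopf_space QSym" if "y \<in> hopf_space QSym" for y
    using linS' that by (simp add: linear_between_def)
  have S_ext: "S y = lin_ext (\<lambda>F. S (basis_elem F)) y" if "y \<in> hopf_space (H_CK W)" for y
    by (rule linear_between_eq_lin_ext[of "forests W" "hopf_space (H_CK W)"])
      (use linS that in \<open>simp_all add: hopf_space_def H_CK_def\<close>)
  have S'_ext: "S' y = lin_ext (\<lambda>u. S' (basis_elem u)) y" if "y \<in> hopf_space QSym" for y
    by (rule linear_between_eq_lin_ext[of "compositions" "hopf_space QSym"])
      (use linS' that in \<open>simp_all add: hopf_space_def QSym_def\<close>)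
  have f_in: "f F \<in> hopf_space QSym" for F unfolding f_def by (rule ck_to_qsym_QSym)
  let ?e = "\<lambda>F w. lookup (scal (if F = {#} then 1 else 0 :: 'k) (basis_elem [])) w"
  have g_inverse: "cut_sum (\<lambda>P R. lookup (?m (g P) (f R)) w) F = ?e F w"
    if F: "F \<in> forests W" for F w
  proof -
    have "lin_ext (\<lambda>(a, b). S (basis_elem a) * basis_elem b) (ck_comult_basis F) =
        scal (if F = {#} then 1 else 0) 1"
      using S basis_elem_hopf_space[OF F]
      by (auto simp: is_antipode_def H_CK_def lookup_basis_elem)
    then have "ck_to_qsym (lin_ext (\<lambda>(a, b). S (basis_elem a) * basis_elem b) (ck_comult_basis F)) =
        scal (if F = {#} then 1 else 0 :: 'k) (ck_to_qsym 1)"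
      by (simp only: ck_to_qsym_def lin_ext_scal)
    then have "lookup (ck_to_qsym (lin_ext (\<lambda>(a, b). S (basis_elem a) * basis_elem b) (ck_comult_basis F))) w = ?e F w"
      by (simp only: ck_to_qsym_unit)
    moreover have "lookup (ck_to_qsym (lin_ext (\<lambda>(a, b). S (basis_elem a) * basis_elem b) (ck_comult_basis F))) w =
      cut_sum (\<lambda>P R. lookup (ck_to_qsym (S (basis_elem P) * basis_elem R)) w) F"
      unfolding ck_to_qsym_def lin_ext_lin_ext
      by (simp only: lookup_lin_ext cut_sum_def case_prod_unfold)
    moreover have "\<dots> = cut_sum (\<lambda>P R. lookup (?m (g P) (f R)) w) F"
      by (rule cut_sum_cong[OF F])
        (simp add: ck_to_qsym_times[OF W] S_in basis_elem_hopf_space g_def f_def)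
    ultimately show ?thesis by simp
  qed
  have g'_inverse: "cut_sum (\<lambda>P R. lookup (?m (g' P) (f R)) w) F = ?e F w"
    if F: "F \<in> forests W" for F w
  proof -
    let ?h = "\<lambda>(u, v). ?m (S' (basis_elem u)) (basis_elem v)"
    have unit: "lookup (f F) [] = (if F = {#} then 1 else 0)"
      unfolding f_def lookup_ck_to_qsym[OF basis_elem_hopf_space[OF F]] by (simp add: compositions_def)
    have "lin_ext ?h (lin_ext qs_comult_basis (f F)) = scal (if F = {#} then 1 else 0) (basis_elem [])"
      using S' f_in[of F] unit by (auto simp: is_antipode_def QSym_def)
    moreover have "lin_ext qs_comult_basis (f F) = lin_ext (\<lambda>(P, R). tensor (f P) (f R)) (ck_comult_basis F)"
      unfolding f_def ck_to_qsym_comult[OF basis_elem_hopf_space[OF F]] by (simp add: tensor_map_def)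
    ultimately have lookup: "lookup (lin_ext ?h (lin_ext (\<lambda>(P, R). tensor (f P) (f R)) (ck_comult_basis F))) w = ?e F w"
      by simp
    have tensor: "lin_ext ?h (tensor X Y) = ?m (S' X) Y" if "X \<in> hopf_space QSym" for X Y
    proof -
      have "lin_ext ?h (tensor X Y) = ?m (lin_ext (\<lambda>u. S' (basis_elem u)) X) Y"
      proof (rule poly_mapping_eq_lin_funI)
        fix \<phi> :: "nat list \<Rightarrow> 'k"
        show "lin_fun \<phi> (lin_ext ?h (tensor X Y)) = lin_fun \<phi> (?m (lin_ext (\<lambda>u. S' (basis_elem u)) X) Y)"
          unfolding tensor_def lin_fun_lin_ext lin_fun_bilin_ext
          by (simp add: lin_fun_bilin_ext lin_fun_swap[of _ Y])
      qed
      then show ?thesis using S'_ext[OF that] by simp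
    qed
    have "lin_ext ?h (lin_ext (\<lambda>(P, R). tensor (f P) (f R)) (ck_comult_basis F)) =
        lin_ext (\<lambda>p. ?m (g' (fst p)) (f (snd p))) (ck_comult_basis F)"
      unfolding lin_ext_lin_ext
    proof (rule lin_ext_cong)
      fix p :: "wforest \<times> wforest"
      obtain P R where "p = (P, R)" by (cases p)
      then show "lin_ext ?h (case p of (P, R) \<Rightarrow> tensor (f P) (f R)) = ?m (g' (fst p)) (f (snd p))"
        by (simp only: tensor[OF f_in] g'_def prod.case fst_conv snd_conv)
    qed
    then show ?thesis using lookup by (simp only: lookup_lin_ext cut_sum_def)
  qed
  have "g F = g' F" if F: "F \<in> forests W" for F
  proof (rule left_convolution_inverse_unique[OF W F, where f = f])
    show "g P \<in> hopf_space QSym" for P unfolding g_def by (rule ck_to_qsym_QSym)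
    show "g' P \<in> hopf_space QSym" for P unfolding g'_def by (intro S'_in f_in)
    show "f {#} = basis_elem []" using ck_to_qsym_unit by (simp add: f_def basis_elem_zero)
    show "cut_sum (\<lambda>P R. lookup (?m (g P) (f R)) w) F = cut_sum (\<lambda>P R. lookup (?m (g' P) (f R)) w) F"
      if "F \<in> forests W" for F w
      using that by (simp only: g_inverse g'_inverse)
  qed
  then have "lin_ext g x = lin_ext g' x"
    by (intro lin_ext_cong) (use x in \<open>auto simp: hopf_space_simps\<close>)
  moreover have "ck_to_qsym (S x) = lin_ext g x"
    unfolding S_ext[OF x] g_def[abs_def] by (simp add: ck_to_qsym_def lin_ext_lin_ext)
  moreover have "S' (ck_to_qsym x) = lin_ext g' x"
  proof -
    have "ck_to_qsym x = lin_ext f x"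
      unfolding f_def[abs_def] by (simp add: ck_to_qsym_def)
    then have "S' (ck_to_qsym x) = lin_ext (\<lambda>F. lin_ext (\<lambda>u. S' (basis_elem u)) (f F)) x"
      using S'_ext[OF ck_to_qsym_QSym[of x]] by (simp add: lin_ext_lin_ext)
    also have "\<dots> = lin_ext g' x"
      by (simp add: g'_def[abs_def] S'_ext[OF f_in, symmetric])
    finally show ?thesis .
  qed
  ultimately show ?thesis by simp
qed

lemma ck_to_qsym_homogeneous:
  assumes "x \<in> homogeneous (H_CK W) n"
  shows "ck_to_qsym x \<in> homogeneous QSym n"
proof -
  have "keys (ck_to_qsym x) \<subseteq> {w \<in> compositions. sum_list w = n}"
    unfolding ck_to_qsym_def
  proof (rule keys_lin_ext)
    fix F assume "F \<in> keys x"
    then have "forest_weight F = n" using assms by (auto simp: homogeneous_def H_CK_def)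
    then show "keys (\<Sum>w\<in>{w \<in> compositions. sum_list w = forest_weight F}.
       scal (qsym_coeff w F) (basis_elem w) :: nat list \<Rightarrow>\<^sub>0 'a) \<subseteq> {w \<in> compositions. sum_list w = n}"
      by (auto simp: in_keys_iff lookup_sum_basis_elem[OF finite_compositions_of] split: if_splits)
  qed
  then show ?thesis by (simp add: homogeneous_def QSym_def)
qed

theorem corollary4p7:
  fixes \<iota> :: "rat \<Rightarrow> 'k::comm_ring_1" and W :: "nat set"
  assumes "rat_algebra \<iota>"
    and "W \<noteq> {}" and "W \<subseteq> {n. n > 0}"
  shows "(\<forall>y\<in>hopf_space (H_CK W). is_graded_dual \<iota> W y (TW_dual \<iota> W y)) \<and>
         graded_hopf_hom (H_CK W) QSym (TW_dual \<iota> W)"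
proof
  note W = assms(3)
  let ?A = "H_CK W :: (wforest, 'k) hopf" and ?B = "QSym :: (nat list, 'k) hopf" and ?f = "TW_dual \<iota> W"
  have f: "?f y = ck_to_qsym y" if "y \<in> hopf_space ?A" for y
    by (rule TW_dual_eq[OF assms(1) W that])
  show "\<forall>y\<in>hopf_space (H_CK W). is_graded_dual \<iota> W y (TW_dual \<iota> W y)"
    using is_graded_dual_iff[OF assms(1) W] f by simp
  have add_in: "x + y \<in> hopf_space ?A" if "x \<in> hopf_space ?A" "y \<in> hopf_space ?A" for x y
    using that keys_add[of x y] by (auto simp: hopf_space_simps)
  have scal_in: "scal c x \<in> hopf_space ?A" if "x \<in> hopf_space ?A" for c x
    using that keys_scal[of c x] by (auto simp: hopf_space_simps)
  have one_in: "1 \<in> hopf_space ?A" by (simp add: hopf_space_simps)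
  show "graded_hopf_hom ?A ?B ?f"
    unfolding graded_hopf_hom_def
  proof (intro conjI ballI allI impI)
    show "linear_between (hopf_space ?A) (hopf_space ?B) ?f"
      by (auto simp: linear_between_def f add_in scal_in ck_to_qsym_QSym)
        (simp_all add: ck_to_qsym_def lin_ext_add lin_ext_scal)
  next
    fix n x assume x: "x \<in> homogeneous ?A n"
    then have "x \<in> hopf_space ?A" by (auto simp: homogeneous_def hopf_space_def)
    then show "?f x \<in> homogeneous ?B n" using ck_to_qsym_homogeneous[OF x] by (simp add: f)
  next
    show "?f (unit ?A) = unit ?B"
      using f[OF one_in] by (simp add: H_CK_def QSym_def ck_to_qsym_unit)
  next
    fix x y assume "x \<in> hopf_space ?A" "y \<in> hopf_space ?A"
    then show "?f (mult ?A x y) = mult ?B (?f x) (?f y)"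
      using times_hopf_space[of x W y] ck_to_qsym_times[OF W, of x y] f
      by (simp add: H_CK_def QSym_def)
  next
    fix x assume x: "x \<in> hopf_space ?A"
    have "(\<lambda>F. qsym_coeff [] F) = (\<lambda>F. if F = {#} then 1 else 0 :: 'k)" by (rule ext) simp
    then have "lin_fun (qsym_coeff []) x = lookup x {#}"
      by (simp only: lin_fun_indicator)
    then show "counit ?B (?f x) = counit ?A x"
      using lookup_ck_to_qsym[OF x, of "[]"]
      by (simp add: f[OF x] H_CK_def QSym_def compositions_def)
  next
    fix x assume x: "x \<in> hopf_space ?A"
    have "tensor_map ?f ?f (lin_ext ck_comult_basis x) = tensor_map ck_to_qsym ck_to_qsym (lin_ext ck_comult_basis x)"
    proof (rule poly_mapping_eq_lin_funI)
      fix \<phi> :: "nat list \<times> nat list \<Rightarrow> 'k"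
      have "lin_fun (cut_sum (\<lambda>P R. lin_fun \<phi> (tensor (?f (basis_elem P)) (?f (basis_elem R))))) x =
        lin_fun (cut_sum (\<lambda>P R. lin_fun \<phi> (tensor (ck_to_qsym (basis_elem P)) (ck_to_qsym (basis_elem R))))) x"
      proof (rule lin_fun_cong)
        fix F assume "F \<in> keys x"
        then have "F \<in> forests W" using x by (auto simp: hopf_space_simps)
        then show "cut_sum (\<lambda>P R. lin_fun \<phi> (tensor (?f (basis_elem P)) (?f (basis_elem R)))) F =
          cut_sum (\<lambda>P R. lin_fun \<phi> (tensor (ck_to_qsym (basis_elem P)) (ck_to_qsym (basis_elem R)))) F"
          by (rule cut_sum_cong) (simp add: f basis_elem_hopf_space)
      qed
      then show "lin_fun \<phi> (tensor_map ?f ?f (lin_ext ck_comult_basis x)) =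
          lin_fun \<phi> (tensor_map ck_to_qsym ck_to_qsym (lin_ext ck_comult_basis x))"
        by (simp add: tensor_map_def lin_fun_lin_ext cut_sum_def[abs_def] case_prod_unfold)
    qed
    then show "comult ?B (?f x) = tensor_map ?f ?f (comult ?A x)"
      using ck_to_qsym_comult[OF x] by (simp add: f[OF x] H_CK_def QSym_def)
  next
    fix S S' x assume S: "is_antipode ?A S" and S': "is_antipode ?B S'" and x: "x \<in> hopf_space ?A"
    then have "S x \<in> hopf_space ?A" by (simp add: is_antipode_def linear_between_def)
    then show "?f (S x) = S' (?f x)"
      using ck_to_qsym_antipode[OF W S S' x] by (simp add: f x)
  qed
qed

end
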